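(* Let $L$ be a well-defined IPS generator with semigroup $(P^L_t)_{t\ge 0}$ which satisfies conditions (i), (ii), (iii), (iv) and (v) of the context. Let $\gamma$ be a translation-invariant, non-null and quasilocal specification, and let $\mu\in\mathcal{G}(\gamma)$ be translation invariant, asymptotically decoupled and time-stationary for $L$ (i.e. $\mu P^L_t=\mu$ for all $t\ge0$). Let $D_L(\mu)\subset\mathcal{P}_\theta$ be a weakly closed set with $\mu\in D_L(\mu)$ which is preserved by the dynamics (i.e. $\nu\in D_L(\mu)$ implies $\nu P_t^L\in D_L(\mu)$ for all $t\ge 0$). Assume that for every $\nu\in D_L(\mu)$ we have $\tilde g_L(\nu|\mu)\le0$, and that $\tilde g_L(\nu|\mu)=0$ implies $\nu\in\mathcal{G}(\gamma)$. Then, for any starting measure $\nu\in D_L(\mu)$ and any sequence of times $t_n\uparrow\infty$ such that $(\nu P^L_{t_n})_{n\in\mathbb{N}}$ converges weakly to $\nu_*$, we have $\nu_*\in\mathcal{G}(\gamma)$.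
   Context: **Configurations and measures.** Fix integers $d,q\ge1$; $\Omega=\{1,\dots,q\}^{\mathbb{Z}^d}$ carries the product topology and Borel $\sigma$-algebra $\mathcal{F}$. $\mathcal{P}_\theta$ is the set of translation-invariant probability measures on $\Omega$, with the weak topology. $\Lambda\Subset\mathbb{Z}^d$ means that $\Lambda$ is a finite nonempty subset; $\Lambda^c=\mathbb{Z}^d\setminus\Lambda$; $o$ is the origin; $\eta_\Lambda$ is the restriction of $\eta$ to $\Lambda$, and $\eta_\Lambda\xi_\Delta$ is concatenation for disjoint $\Lambda,\Delta$. $1_{\eta_\Lambda}$ is the indicator function of $\{\omega:\omega_\Lambda=\eta_\Lambda\}$, $\nu(f)=\int f\,d\nu$, and $\nu(1_{\eta_\Delta}|\eta_\Lambda)=\nu(1_{\eta_\Delta}1_{\eta_\Lambda})/\nu(1_{\eta_\Lambda})$ for disjoint finite $\Delta,\Lambda$. **Specifications.** A specification is a family $\gamma=(\gamma_\Lambda)_{\Lambda\Subset\mathbb{Z}^d}$ of probability kernels $\gamma_\Lambda(\cdot|\eta_{\Lambda^c})$ from $(\Omega,\mathcal{F}_{\Lambda^c})$ to $(\Omega,\mathcal{F})$ ($\mathcal{F}_{\Lambda^c}$ the $\sigma$-algebra generated by the coordinates in $\Lambda^c$) that are proper ($\gamma_\Lambda(1_{\eta_\Lambda}1_{\eta_\Delta}|\eta_{\Lambda^c})=\gamma_\Lambda(1_{\eta_\Lambda}|\eta_{\Lambda^c})1_{\eta_\Delta}(\eta_{\Lambda^c})$ for $\Delta\subset\Lambda^c$)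 and consistent ($\gamma_\Lambda\gamma_\Delta=\gamma_\Lambda$ for $\Delta\subset\Lambda$). It is translation invariant if $\gamma_{\Lambda+i}(1_{\eta_{\Lambda+i}}|\eta_{(\Lambda+i)^c})=\gamma_\Lambda(1_{\eta_\Lambda}|\eta_{\Lambda^c})$ for all $\Lambda\Subset\mathbb{Z}^d$, $i\in\mathbb{Z}^d$ (configurations being translated along); non-null if $\inf_\eta\gamma_o(1_{\eta_o}|\eta_{o^c})\ge\delta$ for some $\delta>0$; quasilocal if for all $\Lambda\Subset\mathbb{Z}^d$, $\lim_{\Delta\uparrow\mathbb{Z}^d}\sup_{\eta,\xi}|\gamma_\Lambda(1_{\eta_\Lambda}|\eta_{\Delta\setminus\Lambda}\xi_{\Delta^c})-\gamma_\Lambda(1_{\eta_\Lambda}|\eta_{\Lambda^c})|=0$. $\mathcal{G}(\gamma)$ is the set of probability measures $\mu$ with $\mu(\gamma_\Lambda(1_{\eta_\Lambda}|\cdot))=\mu(1_{\eta_\Lambda})$ for all $\Lambda\Subset\mathbb{Z}^d$ and $\eta_\Lambda$ (DLR equation: Gibbs measures for $\gamma$). **Asymptotic decoupling.** With $V_n=[-n,n]^d\cap\mathbb{Z}^d$, $\mu$ is asymptotically decoupled if there are $d(\cdot):\mathbb{N}\to\mathbb{N}$ and $c(\cdot):\mathbb{N}\to[0,\infty)$ with $d(n)/n\to0$, $c(n)/|V_n|\to0$ and $e^{-c(n)}\mu(A)\mu(B)\le\mu(A\cap B)\le e^{c(n)}\mu(A)\mu(B)$ for all $i\in\mathbb{Z}^d$,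 $n\in\mathbb{N}$, all events $A$ measurable w.r.t. the coordinates in $V_n+i$ and all $B$ measurable w.r.t. the coordinates in $(V_{n+d(n)}+i)^c$. **IPS.** An interacting particle system (IPS) is given by rates $c_\Delta(\eta,\xi_\Delta)\ge0$, $\Delta\Subset\mathbb{Z}^d$, $\xi_\Delta\in\{1,\dots,q\}^\Delta$, continuous in $\eta\in\Omega$, with generator $Lf(\eta)=\sum_{\Delta\Subset\mathbb{Z}^d}\sum_{\xi_\Delta}c_\Delta(\eta,\xi_\Delta)[f(\xi_\Delta\eta_{\Delta^c})-f(\eta)]$ (sums only over terms with positive rate). Put $c_\Delta(\eta)=\sum_{\xi_\Delta\ne\eta_\Delta}c_\Delta(\eta,\xi_\Delta)$ and $c_\Delta=\sup_\eta c_\Delta(\eta)$. It is well-defined if it satisfies Liggett's conditions $\sup_x\sum_{\Delta\ni x}c_\Delta<\infty$ and $\sup_x\sum_{u\neq x}\sum_{\Delta\ni x}\sup\{\sum_{\xi_\Delta}|c_\Delta(\eta,\xi_\Delta)-c_\Delta(\zeta,\xi_\Delta)|:\eta_y=\zeta_y\ \forall y\ne u\}<\infty$; then (the closure of) $L$ generates a unique Feller Markov semigroup $(P^L_t)_{t\ge0}$ on $C(\Omega)$, and $\nu P_t^L$ denotes the time-evolved measure. **Conditions on $L$.** (i) $L$ is translation invariant: all rates are translation invariant. (ii) Finitely many types of transitions: up to lattice translations, $c_\Delta>0$ for only finitely many $\Delta\Subset\mathbb{Z}^d$. (iii) Uniformly continuous rates: $\lim_{\Lambda\uparrow\mathbb{Z}^d}\sup_{\Delta\ni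 o}\sup_{\eta,\xi,\sigma}|c_\Delta(\eta_\Lambda\sigma_{\Lambda^c},\xi_\Delta)-c_\Delta(\eta,\xi_\Delta)|=0$. (iv) Strictly positive minimal transition rate: for all $\Delta$ with $c_\Delta>0$, $\inf_{\eta,\xi:\,c_\Delta(\eta,\xi_\Delta)>0}c_\Delta(\eta,\xi_\Delta)>0$. (v) $L$ cannot enter trap states: for all $\eta$, $\Delta$ and $\xi_\Delta$, $c_\Delta(\eta,\xi_\Delta)>0$ implies $c_\Delta(\xi_\Delta\eta_{\Delta^c})>0$. **Approximating relative entropy loss density.** Let $\Lambda_n=[-2^n+1,2^n-1]^d\cap\mathbb{Z}^d$ and $\tilde\Lambda_n=[-2^n+n,2^n-n]^d\cap\mathbb{Z}^d$. Define $$\tilde g_L^n(\nu|\mu)=\sum_{i\in\tilde\Lambda_n}\sum_{\Delta\ni i}\frac{1}{|\Delta\cap\Lambda_n|}\sum_{\xi_\Delta}\int\nu(d\eta)\,c_\Delta(\eta,\xi_\Delta)\log\frac{\nu(1_{\xi_{\Delta\cap\Lambda_n}}|\eta_{\Lambda_n\setminus\Delta})\,\mu(1_{\eta_{\Delta\cap\Lambda_n}}|\eta_{\Lambda_n\setminus\Delta})}{\nu(1_{\eta_{\Delta\cap\Lambda_n}}|\eta_{\Lambda_n\setminus\Delta})\,\mu(1_{\xi_{\Delta\cap\Lambda_n}}|\eta_{\Lambda_n\setminus\Delta})}\in[-\infty,\infty)$$ (sums over terms with positive rate, $\log0=-\infty$), and $\tilde g_L(\nu|\mu)=\limsup_{n\uparrow\infty}|\Lambda_n|^{-1}\tilde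 g_L^n(\nu|\mu)$. *)

theory Defs
  imports "HOL-Probability.Probability"
begin

text \<open>
  The dimension is the cardinality of the finite index type \<open>'d\<close> and the number of spin values is
  the cardinality of the finite type \<open>'q\<close>. The wrapper \<open>discrete\<close> equips \<open>'q\<close> with the discrete
  topology, so that the library topology on functions is the product topology on configurations
  and \<^term>\<open>borel\<close> is the corresponding Borel sigma-algebra.
\<close>

type_synonym 'd site = "int ^ 'd"
type_synonym ('d, 'q) config = "int ^ 'd \<Rightarrow> 'q discrete"

instance discrete :: (finite) finite
proof
  have "(UNIV :: 'a discrete set) = discrete ` UNIV"
    by (metis UNIV_eq_I of_discrete_inverse rangeI)
  then show "finite (UNIV :: 'a discrete set)"
    by (metis finite finite_imageI)
qed

definition regions :: "('d::finite) site set set" where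
  "regions = {\<Lambda>. finite \<Lambda> \<and> \<Lambda> \<noteq> {}}"

definition translate :: "('d::finite) site \<Rightarrow> 'd site set \<Rightarrow> 'd site set" where
  "translate i \<Lambda> = (\<lambda>x. x + i) ` \<Lambda>"

definition shift :: "('d::finite) site \<Rightarrow> ('d, 'q) config \<Rightarrow> ('d, 'q) config" where
  "shift i \<eta> = (\<lambda>x. \<eta> (x - i))"

text \<open>
  A pattern on \<open>\<Delta>\<close> is a configuration that is undefined off \<open>\<Delta>\<close>. Concatenation is
  \<^const>\<open>override_on\<close>: the term \<open>override_on \<eta> \<xi> \<Delta>\<close> equals \<open>\<xi>\<close> on \<open>\<Delta>\<close> and \<open>\<eta>\<close> elsewhere. The function
  \<^const>\<open>shift\<close> maps patterns on \<open>\<Delta>\<close> to patterns on the translate of \<open>\<Delta>\<close>.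
\<close>

definition patterns :: "('d::finite) site set \<Rightarrow> ('d, 'q) config set" where
  "patterns \<Delta> = (\<Pi>\<^sub>E x\<in>\<Delta>. UNIV)"

definition cyl :: "('d::finite) site set \<Rightarrow> ('d, 'q) config \<Rightarrow> ('d, 'q) config set" where
  "cyl \<Lambda> \<eta> = {\<omega>. \<forall>x\<in>\<Lambda>. \<omega> x = \<eta> x}"

definition coord_algebra :: "('d::finite) site set \<Rightarrow> ('d, 'q) config measure" where
  "coord_algebra \<Lambda> = sigma UNIV {{\<omega>. \<omega> x = a} | x a. x \<in> \<Lambda>}"

definition lattice_cube :: "int \<Rightarrow> ('d::finite) site set" where
  "lattice_cube m = {x. \<forall>k. - m \<le> x $ k \<and> x $ k \<le> m}"

abbreviation prob_measures :: "('d::finite, 'q::finite) config measure set" where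
  "prob_measures \<equiv> space (prob_algebra borel)"

definition invariant_measures :: "('d::finite, 'q::finite) config measure set" where
  "invariant_measures = {\<nu> \<in> prob_measures. \<forall>i. distr \<nu> borel (shift i) = \<nu>}"

text \<open>The coarsest topology making all integrals of continuous functions continuous.\<close>

definition weak_topology :: "('d::finite, 'q::finite) config measure topology" where
  "weak_topology = pullback_topology prob_measures
     (\<lambda>\<nu> (f :: ('d, 'q) config \<Rightarrow>\<^sub>C real). \<integral>\<eta>. apply_bcontfun f \<eta> \<partial>\<nu>) euclidean"

text \<open>
  Conditional probability of \<open>\<xi>\<close> on \<open>A\<close> given \<open>\<eta>\<close> on \<open>B\<close>, for disjoint \<open>A\<close> and \<open>B\<close>; it is \<open>0\<close> when the
  conditioning event is null.
\<close>

definition cond_cyl ::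
  "('d::finite, 'q::finite) config measure \<Rightarrow> 'd site set \<Rightarrow> ('d, 'q) config \<Rightarrow>
   'd site set \<Rightarrow> ('d, 'q) config \<Rightarrow> real" where
  "cond_cyl \<nu> A \<xi> B \<eta> = measure \<nu> (cyl A \<xi> \<inter> cyl B \<eta>) / measure \<nu> (cyl B \<eta>)"

definition asymptotically_decoupled :: "('d::finite, 'q::finite) config measure \<Rightarrow> bool" where
  "asymptotically_decoupled \<mu> \<longleftrightarrow>
     (\<exists>(d :: nat \<Rightarrow> nat) (c :: nat \<Rightarrow> real).
        (\<forall>n. 0 \<le> c n) \<and>
        (\<lambda>n. real (d n) / real n) \<longlonglongrightarrow> 0 \<and>
        (\<lambda>n. c n / real (card (lattice_cube (int n) :: 'd site set))) \<longlonglongrightarrow> 0 \<and>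
        (\<forall>i n. \<forall>A \<in> sets (coord_algebra (translate i (lattice_cube (int n)))).
                \<forall>B \<in> sets (coord_algebra (- translate i (lattice_cube (int (n + d n))))).
           exp (- c n) * measure \<mu> A * measure \<mu> B \<le> measure \<mu> (A \<inter> B) \<and>
           measure \<mu> (A \<inter> B) \<le> exp (c n) * measure \<mu> A * measure \<mu> B))"

text \<open>
  In \<open>\<gamma> \<Lambda> \<eta>\<close> the boundary condition is a full configuration \<open>\<eta>\<close>; measurability with respect to the
  coordinates off \<open>\<Lambda>\<close> makes the value depend on \<open>\<eta>\<close> off \<open>\<Lambda>\<close> only.
\<close>

type_synonym ('d, 'q) kernels =
  "(int ^ 'd) set \<Rightarrow> (int ^ 'd \<Rightarrow> 'q discrete) \<Rightarrow> (int ^ 'd \<Rightarrow> 'q discrete) measure"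

definition is_specification ::
  "('d::finite, 'q::finite) kernels \<Rightarrow> bool" where
  "is_specification \<gamma> \<longleftrightarrow>
     (\<forall>\<Lambda>\<in>regions. \<gamma> \<Lambda> \<in> measurable (coord_algebra (- \<Lambda>)) (prob_algebra borel)) \<and>
     (\<forall>\<Lambda>\<in>regions. \<forall>\<Delta>\<in>regions. \<Delta> \<subseteq> - \<Lambda> \<longrightarrow>
        (\<forall>\<xi> \<eta>. measure (\<gamma> \<Lambda> \<eta>) (cyl \<Lambda> \<xi> \<inter> cyl \<Delta> \<xi>) =
               measure (\<gamma> \<Lambda> \<eta>) (cyl \<Lambda> \<xi>) * indicator (cyl \<Delta> \<xi>) \<eta>)) \<and>
     (\<forall>\<Lambda>\<in>regions. \<forall>\<Delta>\<in>regions. \<Delta> \<subseteq> \<Lambda> \<longrightarrow> (\<forall>\<eta>. \<gamma> \<Lambda> \<eta> \<bind> \<gamma> \<Delta> = \<gamma> \<Lambda> \<eta>))"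

definition spec_translation_invariant ::
  "('d::finite, 'q::finite) kernels \<Rightarrow> bool" where
  "spec_translation_invariant \<gamma> \<longleftrightarrow>
     (\<forall>\<Lambda>\<in>regions. \<forall>i \<eta>.
        measure (\<gamma> (translate i \<Lambda>) (shift i \<eta>)) (cyl (translate i \<Lambda>) (shift i \<eta>)) =
        measure (\<gamma> \<Lambda> \<eta>) (cyl \<Lambda> \<eta>))"

definition non_null ::
  "('d::finite, 'q::finite) kernels \<Rightarrow> bool" where
  "non_null \<gamma> \<longleftrightarrow> (\<exists>\<delta>>0. \<delta> \<le> (INF \<eta>. measure (\<gamma> {0} \<eta>) (cyl {0} \<eta>)))"

definition quasilocal ::
  "('d::finite, 'q::finite) kernels \<Rightarrow> bool" where
  "quasilocal \<gamma> \<longleftrightarrow>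
     (\<forall>\<Lambda>\<in>regions.
        ((\<lambda>\<Delta>. SUP \<eta>. SUP \<xi>.
            \<bar>measure (\<gamma> \<Lambda> (override_on \<xi> \<eta> (\<Delta> - \<Lambda>))) (cyl \<Lambda> \<eta>) - measure (\<gamma> \<Lambda> \<eta>) (cyl \<Lambda> \<eta>)\<bar>)
         \<longlongrightarrow> 0) (finite_subsets_at_top UNIV))"

definition gibbs_measures ::
  "('d::finite, 'q::finite) kernels \<Rightarrow>
   ('d, 'q) config measure set" where
  "gibbs_measures \<gamma> =
     {\<mu> \<in> prob_measures. \<forall>\<Lambda>\<in>regions. \<forall>\<eta>.
        (\<integral>\<omega>. measure (\<gamma> \<Lambda> \<omega>) (cyl \<Lambda> \<eta>) \<partial>\<mu>) = measure \<mu> (cyl \<Lambda> \<eta>)}"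

text \<open>
  Rates are given by \<open>c \<Delta> \<eta> \<xi>\<close>, used only for regions \<open>\<Delta>\<close> and patterns \<open>\<xi>\<close> on \<open>\<Delta>\<close>. Suprema and
  series that may diverge are taken in \<^typ>\<open>ennreal\<close>.
\<close>

type_synonym ('d, 'q) rates =
  "(int ^ 'd) set \<Rightarrow> (int ^ 'd \<Rightarrow> 'q discrete) \<Rightarrow> (int ^ 'd \<Rightarrow> 'q discrete) \<Rightarrow> real"

definition ips_rates :: "('d::finite, 'q::finite) rates \<Rightarrow> bool" where
  "ips_rates c \<longleftrightarrow>
     (\<forall>\<Delta>\<in>regions. \<forall>\<xi>\<in>patterns \<Delta>.
        (\<forall>\<eta>. 0 \<le> c \<Delta> \<eta> \<xi>) \<and> continuous_on UNIV (\<lambda>\<eta>. c \<Delta> \<eta> \<xi>))"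

definition exit_rate ::
  "('d::finite, 'q::finite) rates \<Rightarrow> 'd site set \<Rightarrow> ('d, 'q) config \<Rightarrow> real" where
  "exit_rate c \<Delta> \<eta> = (\<Sum>\<xi>\<in>patterns \<Delta> - {restrict \<eta> \<Delta>}. c \<Delta> \<eta> \<xi>)"

definition max_exit_rate :: "('d::finite, 'q::finite) rates \<Rightarrow> 'd site set \<Rightarrow> ennreal" where
  "max_exit_rate c \<Delta> = (SUP \<eta>. ennreal (exit_rate c \<Delta> \<eta>))"

definition rate_influence ::
  "('d::finite, 'q::finite) rates \<Rightarrow> 'd site set \<Rightarrow> 'd site \<Rightarrow> ennreal" where
  "rate_influence c \<Delta> u =
     (SUP (\<eta>, \<zeta>)\<in>{(\<eta>, \<zeta>). \<forall>y. y \<noteq> u \<longrightarrow> \<eta> y = \<zeta> y}.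
        ennreal (\<Sum>\<xi>\<in>patterns \<Delta>. \<bar>c \<Delta> \<eta> \<xi> - c \<Delta> \<zeta> \<xi>\<bar>))"

definition well_defined :: "('d::finite, 'q::finite) rates \<Rightarrow> bool" where
  "well_defined c \<longleftrightarrow>
     ips_rates c \<and>
     (SUP x. \<Sum>\<^sub>\<infinity>\<Delta>\<in>{\<Delta>\<in>regions. x \<in> \<Delta>}. max_exit_rate c \<Delta>) < \<infinity> \<and>
     (SUP x. \<Sum>\<^sub>\<infinity>u\<in>UNIV - {x}. \<Sum>\<^sub>\<infinity>\<Delta>\<in>{\<Delta>\<in>regions. x \<in> \<Delta>}. rate_influence c \<Delta> u) < \<infinity>"

definition pregenerator ::
  "('d::finite, 'q::finite) rates \<Rightarrow> (('d, 'q) config \<Rightarrow> real) \<Rightarrow> ('d, 'q) config \<Rightarrow> real" where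
  "pregenerator c f \<eta> =
     (\<Sum>\<^sub>\<infinity>\<Delta>\<in>regions. \<Sum>\<xi>\<in>patterns \<Delta>. c \<Delta> \<eta> \<xi> * (f (override_on \<eta> \<xi> \<Delta>) - f \<eta>))"

text \<open>
  Liggett's domain of the pregenerator: continuous functions whose oscillations at single sites are
  summable.
\<close>

definition oscillation :: "(('d::finite, 'q::finite) config \<Rightarrow> real) \<Rightarrow> 'd site \<Rightarrow> ennreal" where
  "oscillation f x =
     (SUP (\<eta>, \<zeta>)\<in>{(\<eta>, \<zeta>). \<forall>y. y \<noteq> x \<longrightarrow> \<eta> y = \<zeta> y}. ennreal \<bar>f \<eta> - f \<zeta>\<bar>)"

definition smooth_functions :: "(('d::finite, 'q::finite) config \<Rightarrow>\<^sub>C real) set" where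
  "smooth_functions = {f. (\<Sum>\<^sub>\<infinity>x\<in>UNIV. oscillation (apply_bcontfun f) x) < \<infinity>}"

text \<open>
  The space of configurations is compact, so the type of bounded continuous functions is the Banach
  space of all continuous functions with the supremum norm. Only times \<open>t \<ge> 0\<close> matter.
\<close>

type_synonym ('d, 'q) semigroup =
  "real \<Rightarrow> ((int ^ 'd \<Rightarrow> 'q discrete) \<Rightarrow>\<^sub>C real) \<Rightarrow> ((int ^ 'd \<Rightarrow> 'q discrete) \<Rightarrow>\<^sub>C real)"

definition feller_semigroup :: "('d::finite, 'q::finite) semigroup \<Rightarrow> bool" where
  "feller_semigroup P \<longleftrightarrow>
     (\<forall>t\<ge>0. linear (P t)) \<and>
     (\<forall>f. P 0 f = f) \<and>
     (\<forall>s\<ge>0. \<forall>t\<ge>0. \<forall>f. P (s + t) f = P s (P t f)) \<and>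
     (\<forall>t\<ge>0. P t (const_bcontfun 1) = const_bcontfun 1) \<and>
     (\<forall>t\<ge>0. \<forall>f. (\<forall>\<eta>. 0 \<le> apply_bcontfun f \<eta>) \<longrightarrow> (\<forall>\<eta>. 0 \<le> apply_bcontfun (P t f) \<eta>)) \<and>
     (\<forall>f. ((\<lambda>t. P t f) \<longlongrightarrow> f) (at_right 0))"

definition generator_graph ::
  "('d::finite, 'q::finite) semigroup \<Rightarrow>
   ((('d, 'q) config \<Rightarrow>\<^sub>C real) \<times> (('d, 'q) config \<Rightarrow>\<^sub>C real)) set" where
  "generator_graph P = {(f, g). ((\<lambda>t. (P t f - f) /\<^sub>R t) \<longlongrightarrow> g) (at_right 0)}"

definition has_semigroup ::
  "('d::finite, 'q::finite) rates \<Rightarrow> ('d, 'q) semigroup \<Rightarrow> bool" where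
  "has_semigroup c P \<longleftrightarrow>
     feller_semigroup P \<and>
     generator_graph P =
       closure {(f, g). f \<in> smooth_functions \<and>
                        apply_bcontfun g = pregenerator c (apply_bcontfun f)}"

text \<open>
  The evolved measure is determined by its integrals of continuous functions; it exists by the Riesz
  representation theorem.
\<close>

definition evolve ::
  "('d::finite, 'q::finite) semigroup \<Rightarrow> real \<Rightarrow> ('d, 'q) config measure \<Rightarrow>
   ('d, 'q) config measure" where
  "evolve P t \<nu> =
     (THE \<nu>'. \<nu>' \<in> prob_measures \<and>
        (\<forall>f. (\<integral>\<eta>. apply_bcontfun f \<eta> \<partial>\<nu>') = (\<integral>\<eta>. apply_bcontfun (P t f) \<eta> \<partial>\<nu>)))"

definition rates_translation_invariant :: "('d::finite, 'q::finite) rates \<Rightarrow> bool" where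
  "rates_translation_invariant c \<longleftrightarrow>
     (\<forall>\<Delta>\<in>regions. \<forall>\<xi>\<in>patterns \<Delta>. \<forall>i \<eta>.
        c (translate i \<Delta>) (shift i \<eta>) (shift i \<xi>) = c \<Delta> \<eta> \<xi>)"

definition finitely_many_types :: "('d::finite, 'q::finite) rates \<Rightarrow> bool" where
  "finitely_many_types c \<longleftrightarrow>
     (\<exists>\<T>. finite \<T> \<and>
        (\<forall>\<Delta>\<in>regions. 0 < max_exit_rate c \<Delta> \<longrightarrow> (\<exists>\<Delta>\<^sub>0\<in>\<T>. \<exists>i. \<Delta> = translate i \<Delta>\<^sub>0)))"

definition uniformly_continuous_rates :: "('d::finite, 'q::finite) rates \<Rightarrow> bool" where
  "uniformly_continuous_rates c \<longleftrightarrow>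
     ((\<lambda>\<Lambda>. SUP \<Delta>\<in>{\<Delta>\<in>regions. 0 \<in> \<Delta>}. SUP \<xi>\<in>patterns \<Delta>. SUP \<eta>. SUP \<sigma>.
         ennreal \<bar>c \<Delta> (override_on \<sigma> \<eta> \<Lambda>) \<xi> - c \<Delta> \<eta> \<xi>\<bar>) \<longlongrightarrow> 0)
     (finite_subsets_at_top UNIV)"

definition positive_minimal_rate :: "('d::finite, 'q::finite) rates \<Rightarrow> bool" where
  "positive_minimal_rate c \<longleftrightarrow>
     (\<forall>\<Delta>\<in>regions. 0 < max_exit_rate c \<Delta> \<longrightarrow>
        0 < (INF (\<eta>, \<xi>)\<in>{(\<eta>, \<xi>). \<xi> \<in> patterns \<Delta> \<and> 0 < c \<Delta> \<eta> \<xi>}. c \<Delta> \<eta> \<xi>))"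

definition no_trap_states :: "('d::finite, 'q::finite) rates \<Rightarrow> bool" where
  "no_trap_states c \<longleftrightarrow>
     (\<forall>\<eta>. \<forall>\<Delta>\<in>regions. \<forall>\<xi>\<in>patterns \<Delta>.
        0 < c \<Delta> \<eta> \<xi> \<longrightarrow> 0 < exit_rate c \<Delta> (override_on \<eta> \<xi> \<Delta>))"

definition elog :: "real \<Rightarrow> ereal" where
  "elog x = (if x \<le> 0 then - \<infinity> else ereal (ln x))"

text \<open>
  \<^const>\<open>e2ennreal\<close> truncates negative values to \<open>0\<close>, so this is the integral of the positive part minus
  that of the negative part.
\<close>

definition eintegral :: "'a measure \<Rightarrow> ('a \<Rightarrow> ereal) \<Rightarrow> ereal" where
  "eintegral M f =
     enn2ereal (\<integral>\<^sup>+x. e2ennreal (f x) \<partial>M) - enn2ereal (\<integral>\<^sup>+x. e2ennreal (- f x) \<partial>M)"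

definition Lam :: "nat \<Rightarrow> ('d::finite) site set" where
  "Lam n = lattice_cube (2 ^ n - 1)"

definition Lam_inner :: "nat \<Rightarrow> ('d::finite) site set" where
  "Lam_inner n = lattice_cube (2 ^ n - int n)"

definition loss_integrand ::
  "('d::finite, 'q::finite) rates \<Rightarrow> ('d, 'q) config measure \<Rightarrow> ('d, 'q) config measure \<Rightarrow>
   nat \<Rightarrow> 'd site set \<Rightarrow> ('d, 'q) config \<Rightarrow> ('d, 'q) config \<Rightarrow> ereal" where
  "loss_integrand c \<nu> \<mu> n \<Delta> \<xi> \<eta> =
     (if 0 < c \<Delta> \<eta> \<xi>
      then ereal (c \<Delta> \<eta> \<xi>) *
           elog ((cond_cyl \<nu> (\<Delta> \<inter> Lam n) \<xi> (Lam n - \<Delta>) \<eta> *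
                  cond_cyl \<mu> (\<Delta> \<inter> Lam n) \<eta> (Lam n - \<Delta>) \<eta>) /
                 (cond_cyl \<nu> (\<Delta> \<inter> Lam n) \<eta> (Lam n - \<Delta>) \<eta> *
                  cond_cyl \<mu> (\<Delta> \<inter> Lam n) \<xi> (Lam n - \<Delta>) \<eta>))
      else 0)"

definition approx_loss ::
  "('d::finite, 'q::finite) rates \<Rightarrow> nat \<Rightarrow> ('d, 'q) config measure \<Rightarrow>
   ('d, 'q) config measure \<Rightarrow> ereal" where
  "approx_loss c n \<nu> \<mu> =
     (\<Sum>i\<in>Lam_inner n. \<Sum>\<^sub>\<infinity>\<Delta>\<in>{\<Delta>\<in>regions. i \<in> \<Delta>}.
        ereal (1 / real (card (\<Delta> \<inter> Lam n))) *
        (\<Sum>\<xi>\<in>patterns \<Delta>. eintegral \<nu> (loss_integrand c \<nu> \<mu> n \<Delta> \<xi>)))"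

definition approx_loss_density ::
  "('d::finite, 'q::finite) rates \<Rightarrow> ('d, 'q) config measure \<Rightarrow>
   ('d, 'q) config measure \<Rightarrow> ereal" where
  "approx_loss_density c \<nu> \<mu> =
     limsup (\<lambda>n. ereal (1 / real (card (Lam n :: 'd site set))) * approx_loss c n \<nu> \<mu>)"

end

theory Submission
  imports Defs
begin

text \<open>
  Let \<open>H\<^sub>\<Lambda>\<close> be the relative entropy of \<open>\<nu>P\<^sub>t\<close> with respect to \<open>\<mu>\<close> in the volume \<open>\<Lambda>\<close>. Its time derivative is
  a sum over sites of local losses. The loss at a site is, up to an error that vanishes as the volume
  grows, decreasing in the volume: the part involving \<open>\<nu>\<close> by the log sum inequality and the near locality
  of the rates, the part involving \<open>\<mu>\<close> because its conditional probabilities converge uniformly by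
  quasilocality. The errors are uniform in \<open>\<nu>\<close>, so a bound \<open>g\<^sub>L(\<nu>|\<mu>) < a\<close> on the loss density forces
  \<open>dH\<^sub>\<Lambda>/dt \<le> a|\<Lambda>|\<close> for all large cubes \<open>\<Lambda>\<close> and all measures in a weak neighbourhood of \<open>\<nu>\<close>.
  If the loss density at the limit point were negative, \<open>H\<^sub>\<Lambda>/|\<Lambda>|\<close> would decrease by a fixed amount during
  each of infinitely many disjoint time intervals of equal length, while its increase between them is
  arbitrarily small by compactness of time intervals; but \<open>H\<^sub>\<Lambda>/|\<Lambda>|\<close> is bounded uniformly in \<open>\<Lambda>\<close>.
  Adding \<open>\<epsilon>\<close> to the probabilities inside the logarithms of \<open>\<nu>\<close> removes all infinite values.
\<close>

section \<open>Cylinder sets and measures on configurations\<close>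

text \<open>The loss density is a limit superior of functionals that may take the value
  \<open>- \<infinity>\<close>, so weak continuity cannot be applied to it directly. Regularisation
  helps only if it is tied to the volume:
  \<open>\<epsilon> * card (patterns \<Lambda>) \<le> \<epsilon>0\<close> makes the extra masses of
  all fine cells inside one coarse cell add up to at most the extra mass \<open>\<epsilon>0\<close>
  of that cell. Hence \<open>\<epsilon>\<close> is chosen after the volume, and statements about
  large cubes quantify over all admissible \<open>\<epsilon>\<close>. A bound on the limit superior
  yields one cube, one \<open>\<epsilon>0\<close> and, by averaging, one site with a small gain.
  Translation invariance moves this site to the origin, and the gain there, built from finitely many
  integrals, is weakly continuous; it controls all larger cubes. The thresholds found near a time
  depend on that time, so the number of descent rounds has to be fixed before the volume. This is
  harmless because the entropy bounds grow linearly in the volume, with constants that depend only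
  on the lower bound for the single-site kernels.\<close>

lemma in_cyl: "\<omega> \<in> cyl \<Lambda> \<eta> \<longleftrightarrow> (\<forall>x\<in>\<Lambda>. \<omega> x = \<eta> x)"
  by (simp add: cyl_def)

lemma self_in_cyl [simp]: "\<omega> \<in> cyl \<Lambda> \<omega>"
  by (simp add: in_cyl)

lemma cyl_cong: "\<omega> \<in> cyl \<Lambda> \<eta> \<Longrightarrow> cyl \<Lambda> \<omega> = cyl \<Lambda> \<eta>"
  by (auto simp: cyl_def)

lemma cyl_mono: "\<Lambda> \<subseteq> \<Lambda>' \<Longrightarrow> cyl \<Lambda>' \<eta> \<subseteq> cyl \<Lambda> \<eta>"
  by (auto simp: cyl_def)

lemma cyl_Un: "cyl (A \<union> B) \<eta> = cyl A \<eta> \<inter> cyl B \<eta>"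
  by (auto simp: cyl_def)

lemma cyl_eq_INT: "cyl \<Lambda> \<eta> = (\<Inter>x\<in>\<Lambda>. (\<lambda>\<omega>. \<omega> x) -` {\<eta> x})"
  by (auto simp: cyl_def)

lemma open_coordinate: "open ((\<lambda>\<omega> :: ('d::finite, 'q) config. \<omega> x) -` A)"
  by (intro open_vimage open_discrete continuous_on_product_coordinates)

lemma closed_coordinate: "closed ((\<lambda>\<omega> :: ('d::finite, 'q) config. \<omega> x) -` A)"
  unfolding closed_def using open_coordinate[of x "- A"] by (simp add: vimage_Compl)

lemma open_cyl: "finite \<Lambda> \<Longrightarrow> open (cyl \<Lambda> (\<eta> :: ('d::finite, 'q) config))"
  unfolding cyl_eq_INT by (intro open_INT ballI open_coordinate)

lemma closed_cyl: "closed (cyl \<Lambda> (\<eta> :: ('d::finite, 'q) config))"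
  unfolding cyl_eq_INT by (intro closed_INT ballI closed_coordinate)

lemma cyl_borel [measurable]: "cyl \<Lambda> (\<eta> :: ('d::finite, 'q) config) \<in> sets borel"
  using closed_cyl by (rule borel_closed)

text \<open>Shrinking each of the finitely many constrained factors of a basic open set to the
  single spin of \<open>\<omega>\<close> leaves a cylinder.\<close>

lemma cyl_in_open:
  fixes \<omega> :: "('d::finite, 'q) config"
  assumes "open U" "\<omega> \<in> U"
  obtains \<Lambda> where "finite \<Lambda>" "cyl \<Lambda> \<omega> \<subseteq> U"
proof -
  have "openin (product_topology (\<lambda>_. euclidean) UNIV) U"
    using assms(1) unfolding open_fun_def .
  then have "\<exists>X. \<omega> \<in> (\<Pi>\<^sub>E i\<in>UNIV. X i) \<and> (\<forall>i. openin euclidean (X i)) \<and>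
      finite {i. X i \<noteq> topspace euclidean} \<and> (\<Pi>\<^sub>E i\<in>UNIV. X i) \<subseteq> U"
    using assms(2) by (auto dest!: product_topology_open_contains_basis)
  then obtain X where X: "\<omega> \<in> (\<Pi>\<^sub>E i\<in>UNIV. X i)" "finite {i. X i \<noteq> UNIV}" "(\<Pi>\<^sub>E i\<in>UNIV. X i) \<subseteq> U"
    by auto
  have "cyl {i. X i \<noteq> UNIV} \<omega> \<subseteq> (\<Pi>\<^sub>E i\<in>UNIV. X i)"
  proof
    fix \<omega>' assume a: "\<omega>' \<in> cyl {i. X i \<noteq> UNIV} \<omega>"
    have "\<omega>' i \<in> X i" for i
      using a X(1) by (cases "X i = UNIV") (auto simp: in_cyl PiE_def Pi_def)
    then show "\<omega>' \<in> (\<Pi>\<^sub>E i\<in>UNIV. X i)" by (auto simp: PiE_def Pi_def)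
  qed
  then show ?thesis using X(2,3) by (intro that[of "{i. X i \<noteq> UNIV}"]) simp_all
qed

lemma compact_configs: "compact (UNIV :: ('d::finite, 'q::finite) config set)"
proof -
  have "compact_space (product_topology (\<lambda>_. euclidean :: 'q discrete topology) (UNIV :: 'd site set))"
    unfolding compact_space_product_topology
    by (intro disjI2 ballI) (simp add: compact_space_def finite_imp_compact)
  then show ?thesis
    by (simp add: euclidean_product_topology compact_space_def)
qed

section \<open>Patterns as indices of cylinder partitions\<close>

lemma restrict_in_patterns [simp]: "restrict \<omega> \<Lambda> \<in> patterns \<Lambda>"
  by (auto simp: patterns_def)

lemma finite_patterns [simp]: "finite \<Lambda> \<Longrightarrow> finite (patterns \<Lambda> :: ('d::finite, 'q::finite) config set)"
  by (auto simp: patterns_def intro: finite_PiE)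

lemma patterns_ne [simp]: "patterns \<Lambda> \<noteq> {}"
  by (auto simp: patterns_def PiE_eq_empty_iff)

lemma cyl_restrict [simp]: "cyl \<Lambda> (restrict \<omega> \<Lambda>) = cyl \<Lambda> \<omega>"
  by (auto simp: cyl_def)

text \<open>Makes the patterns on \<open>\<Lambda>\<close> an index set for a partition: a
  configuration lies in the cell of its own restriction and in no other.\<close>

lemma in_cyl_pattern:
  assumes "\<eta> \<in> patterns \<Lambda>"
  shows "\<omega> \<in> cyl \<Lambda> \<eta> \<longleftrightarrow> \<eta> = restrict \<omega> \<Lambda>"
proof
  assume "\<omega> \<in> cyl \<Lambda> \<eta>"
  with assms show "\<eta> = restrict \<omega> \<Lambda>"
    by (auto simp: in_cyl patterns_def intro!: PiE_ext[of \<eta> \<Lambda> "\<lambda>_. UNIV"])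
next
  assume "\<eta> = restrict \<omega> \<Lambda>"
  then have "cyl \<Lambda> \<eta> = cyl \<Lambda> \<omega>" using cyl_restrict by metis
  then show "\<omega> \<in> cyl \<Lambda> \<eta>" by simp
qed

lemma countable_cyls:
  "countable {cyl \<Lambda> \<omega> | (\<Lambda> :: ('d::finite) site set) (\<omega> :: ('d, 'q::finite) config). finite \<Lambda>}"
proof -
  have "{cyl \<Lambda> \<omega> | (\<Lambda> :: 'd site set) (\<omega> :: ('d, 'q) config). finite \<Lambda>}
      \<subseteq> (\<Union>\<Lambda>\<in>Collect finite. cyl \<Lambda> ` patterns \<Lambda>)"
  proof clarify
    fix \<Lambda> :: "'d site set" and \<omega> :: "('d, 'q) config" assume "finite \<Lambda>"
    then show "cyl \<Lambda> \<omega> \<in> (\<Union>\<Lambda>\<in>Collect finite. cyl \<Lambda> ` patterns \<Lambda>)"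
      by (intro UN_I[of \<Lambda>] image_eqI[of _ _ "restrict \<omega> \<Lambda>"]) auto
  qed
  moreover have "countable (\<Union>\<Lambda>\<in>Collect finite. cyl \<Lambda> ` (patterns \<Lambda> :: ('d, 'q) config set))"
    by (intro countable_UN countable_Collect_finite) (simp add: countable_finite)
  ultimately show ?thesis by (rule countable_subset)
qed

text \<open>An algebra that generates the Borel sets and whose indicators are continuous, so that
  its measures can be read off from integrals of continuous functions.\<close>

definition clopens :: "('d::finite, 'q::finite) config set set" where
  "clopens = {A. open A \<and> closed A}"

text \<open>Every open set is a union of cylinders over finite regions, and there are only countably
  many of these.\<close>

lemma borel_eq_clopens:
  "sets (borel :: ('d::finite, 'q::finite) config measure) = sigma_sets UNIV clopens"
proof -
  have "sets (borel :: ('d, 'q) config measure) = sigma_sets UNIV (Collect open)"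
    by (simp add: borel_def)
  also have "\<dots> = sigma_sets UNIV clopens"
  proof (rule sigma_sets_eqI)
    fix U :: "('d, 'q) config set" assume "U \<in> Collect open"
    then have U: "open U" by simp
    let ?C = "{cyl \<Lambda> \<omega> | \<Lambda> \<omega>. finite \<Lambda> \<and> cyl \<Lambda> \<omega> \<subseteq> U}"
    have eq: "U = \<Union> ?C"
    proof (intro equalityI subsetI)
      fix \<omega> assume "\<omega> \<in> U"
      then obtain \<Lambda> where "finite \<Lambda>" "cyl \<Lambda> \<omega> \<subseteq> U" using U cyl_in_open by blast
      then show "\<omega> \<in> \<Union> ?C" by (intro UnionI[of "cyl \<Lambda> \<omega>"]) auto
    qed auto
    have cnt: "countable ?C"
      by (rule countable_subset[OF _ countable_cyls]) auto
    have "?C \<subseteq> clopens"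
      by (auto simp: clopens_def open_cyl closed_cyl)
    then have "\<Union> ?C \<in> sigma_sets UNIV clopens"
      using cnt by (intro sigma_sets_UNION) (auto intro: sigma_sets.Basic)
    then show "U \<in> sigma_sets UNIV clopens" using eq by simp
  next
    fix A :: "('d, 'q) config set" assume "A \<in> clopens"
    then show "A \<in> sigma_sets UNIV (Collect open)"
      by (auto simp: clopens_def intro: sigma_sets.Basic)
  qed
  finally show ?thesis .
qed

section \<open>Continuous functions and the measures they determine\<close>

lemma continuous_on_indicator_clopen:
  assumes "open A" "closed A"
  shows "continuous_on UNIV (indicator A :: 'a::topological_space \<Rightarrow> real)"
proof -
  have "continuous_on (A \<union> - A) (\<lambda>x. if x \<in> A then 1 else (0::real))"
    using assms by (intro continuous_on_If open_closed) auto
  then show ?thesis by (simp add: indicator_def of_bool_def)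
qed

lemma continuous_config_bounded:
  fixes f :: "('d::finite, 'q::finite) config \<Rightarrow> real"
  assumes "continuous_on UNIV f"
  shows "f \<in> bcontfun"
  using assms compact_continuous_image[OF assms compact_configs]
  by (auto simp: bcontfun_def compact_imp_bounded)

lemma apply_Bcontfun_continuous:
  fixes f :: "('d::finite, 'q::finite) config \<Rightarrow> real"
  assumes "continuous_on UNIV f"
  shows "apply_bcontfun (Bcontfun f) = f"
  using continuous_config_bounded[OF assms] by (rule Bcontfun_inverse)

lemma prob_measuresD:
  assumes "\<nu> \<in> prob_measures"
  shows "prob_space \<nu>" "sets \<nu> = sets borel" "space \<nu> = UNIV"
  using assms sets_eq_imp_space_eq[of \<nu> borel] by (auto simp: space_prob_algebra)

lemma measurable_prob_measures:
  fixes f :: "('d::finite, 'q::finite) config \<Rightarrow> real"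
  assumes "\<nu> \<in> prob_measures" "f \<in> borel_measurable borel"
  shows "f \<in> borel_measurable \<nu>"
proof -
  have "(borel_measurable \<nu> :: (_ \<Rightarrow> real) set) = borel_measurable borel"
    by (rule measurable_cong_sets) (use prob_measuresD[OF assms(1)] in simp_all)
  then show ?thesis using assms(2) by simp
qed

lemma integrable_bounded:
  fixes f :: "('d::finite, 'q::finite) config \<Rightarrow> real"
  assumes "\<nu> \<in> prob_measures" "f \<in> borel_measurable borel" "\<And>\<omega>. \<bar>f \<omega>\<bar> \<le> B"
  shows "integrable \<nu> f"
proof -
  interpret prob_space \<nu> using assms prob_measuresD by blast
  show ?thesis
    using assms by (intro integrable_const_bound[of _ B]) (auto intro: measurable_prob_measures)
qed

lemma integrable_bcontfun:
  fixes f :: "('d::finite, 'q::finite) config \<Rightarrow>\<^sub>C real"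
  assumes "\<nu> \<in> prob_measures"
  shows "integrable \<nu> (apply_bcontfun f)"
  using assms
  by (intro integrable_bounded[of _ _ "norm f"])
     (auto intro: borel_measurable_continuous_onI simp: norm_bounded[of f, simplified])

lemma abs_integral_bcontfun_le:
  fixes f :: "('d::finite, 'q::finite) config \<Rightarrow>\<^sub>C real"
  assumes "\<nu> \<in> prob_measures"
  shows "\<bar>\<integral>\<eta>. apply_bcontfun f \<eta> \<partial>\<nu>\<bar> \<le> norm f"
proof -
  interpret prob_space \<nu> using assms prob_measuresD by blast
  have "\<bar>\<integral>\<eta>. apply_bcontfun f \<eta> \<partial>\<nu>\<bar> \<le> (\<integral>\<eta>. \<bar>apply_bcontfun f \<eta>\<bar> \<partial>\<nu>)"
    by (rule integral_abs_bound)
  also have "\<dots> \<le> (\<integral>\<eta>. norm f \<partial>\<nu>)"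
    using integrable_bcontfun[OF assms, of f]
    by (intro integral_mono) (auto simp: norm_bounded[of f, simplified])
  finally show ?thesis using prob_space by simp
qed

text \<open>Indicators of clopen sets are continuous and clopen sets are stable under intersection,
  so the hypothesis includes agreement on a generating pi-system.\<close>

lemma prob_measure_eqI:
  fixes \<nu> \<nu>' :: "('d::finite, 'q::finite) config measure"
  assumes \<nu>: "\<nu> \<in> prob_measures" and \<nu>': "\<nu>' \<in> prob_measures"
    and eq: "\<And>f :: ('d, 'q) config \<Rightarrow>\<^sub>C real. (\<integral>\<eta>. apply_bcontfun f \<eta> \<partial>\<nu>) = (\<integral>\<eta>. apply_bcontfun f \<eta> \<partial>\<nu>')"
  shows "\<nu> = \<nu>'"
proof (rule measure_eqI_generator_eq[where E = clopens and \<Omega> = UNIV and A = "\<lambda>_. UNIV"])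
  interpret N: prob_space \<nu> using \<nu> prob_measuresD by blast
  interpret N': prob_space \<nu>' using \<nu>' prob_measuresD by blast
  show "Int_stable (clopens :: ('d, 'q) config set set)"
    by (auto simp: Int_stable_def clopens_def)
  fix A :: "('d, 'q) config set" assume A: "A \<in> clopens"
  then have c: "continuous_on UNIV (indicator A :: _ \<Rightarrow> real)"
    by (auto simp: clopens_def intro: continuous_on_indicator_clopen)
  have "measure \<nu> A = measure \<nu>' A"
    using eq[of "Bcontfun (indicator A)"] prob_measuresD[OF \<nu>] prob_measuresD[OF \<nu>']
    by (simp add: apply_Bcontfun_continuous[OF c])
  then show "emeasure \<nu> A = emeasure \<nu>' A"
    by (simp add: N.emeasure_eq_measure N'.emeasure_eq_measure)
qed (use prob_measuresD[OF \<nu>] prob_measuresD[OF \<nu>'] in \<open>auto simp: borel_eq_clopens clopens_def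
  finite_measure.emeasure_finite prob_space_def\<close>)

text \<open>On the compact space of configurations countable additivity on clopen sets is automatic, so the
  extension theorem of Caratheodory replaces the Riesz representation theorem.\<close>

lemma positive_functional_measure:
  fixes \<phi> :: "(('d::finite, 'q::finite) config \<Rightarrow>\<^sub>C real) \<Rightarrow> real"
  assumes lin: "linear \<phi>"
    and pos: "\<And>f. (\<And>\<eta>. 0 \<le> apply_bcontfun f \<eta>) \<Longrightarrow> 0 \<le> \<phi> f"
    and one: "\<phi> (const_bcontfun 1) = 1"
  obtains \<nu> where "\<nu> \<in> prob_measures" "\<And>A. A \<in> clopens \<Longrightarrow> measure \<nu> A = \<phi> (Bcontfun (indicator A))"
proof -
  define I where "I A = (Bcontfun (indicator A) :: ('d, 'q) config \<Rightarrow>\<^sub>C real)" for A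
  have I: "apply_bcontfun (I A) = indicator A" if "A \<in> clopens" for A
    unfolding I_def using that
    by (intro apply_Bcontfun_continuous continuous_on_indicator_clopen) (auto simp: clopens_def)
  define m where "m A = ennreal (\<phi> (I A))" for A
  interpret algebra UNIV "clopens :: ('d, 'q) config set set"
    by (rule algebra_iff_Int[THEN iffD2]) (auto simp: clopens_def Compl_eq_Diff_UNIV[symmetric])
  have I0: "I {} = 0"
    by (rule bcontfun_eqI) (simp add: I[of "{}"] clopens_def)
  have nonneg: "0 \<le> \<phi> (I A)" if "A \<in> clopens" for A
    by (rule pos) (simp add: I that)
  have "\<exists>\<mu>. (\<forall>s\<in>clopens. \<mu> s = m s) \<and> measure_space UNIV (sigma_sets UNIV clopens) \<mu>"
  proof (rule caratheodory_empty_continuous)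
    show "positive clopens m"
      by (simp add: positive_def m_def I0 linear_0[OF lin])
    show "additive clopens m"
      unfolding additive_def
    proof (intro ballI impI)
      fix A B :: "('d, 'q) config set" assume AB: "A \<in> clopens" "B \<in> clopens" "A \<inter> B = {}"
      have "I (A \<union> B) = I A + I B"
        by (rule bcontfun_eqI)
           (use AB in \<open>auto simp: I Un plus_bcontfun.rep_eq indicator_def\<close>)
      then show "m (A \<union> B) = m A + m B"
        using AB nonneg by (simp add: m_def linear_add[OF lin] ennreal_plus)
    qed
    fix A :: "nat \<Rightarrow> ('d, 'q) config set"
    assume A: "range A \<subseteq> clopens" "decseq A" "(\<Inter>i. A i) = {}"
    \<comment> \<open>Decreasing nonempty closed sets in a compact space have a common point. A
      sequence of clopen sets that decreases to the empty set therefore reaches it after finitely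
      many steps.\<close>
    have "\<exists>n. A n = {}"
    proof (rule ccontr)
      assume "\<nexists>n. A n = {}"
      then have ne: "\<And>n. A n \<noteq> {}" by auto
      have "UNIV \<inter> (\<Inter>n\<in>UNIV. A n) \<noteq> {}"
      proof (rule compact_imp_fip_image[OF compact_configs])
        show "closed (A n)" for n using A(1) by (auto simp: clopens_def)
        fix J :: "nat set" assume J: "finite J" "J \<subseteq> UNIV"
        show "UNIV \<inter> (\<Inter>n\<in>J. A n) \<noteq> {}"
        proof -
          obtain N where N: "\<forall>n\<in>J. n \<le> N" using J(1) finite_nat_set_iff_bounded_le by blast
          then have "A N \<subseteq> (\<Inter>n\<in>J. A n)" using A(2) by (auto simp: decseq_def)
          then show ?thesis using ne[of N] by auto
        qed
      qed
      then show False using A(3) by simp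
    qed
    then obtain n where n: "A n = {}" ..
    have "A k = {}" if "k \<ge> n" for k
      using n A(2) that by (auto simp: decseq_def)
    then have "\<forall>\<^sub>F k in sequentially. m (A k) = 0"
      by (intro eventually_sequentiallyI[of n]) (simp add: m_def I0 linear_0[OF lin])
    then show "(\<lambda>i. m (A i)) \<longlonglongrightarrow> 0" by (rule tendsto_eventually)
  qed (simp add: m_def)
  then obtain \<mu>0 where \<mu>0: "\<And>A. A \<in> clopens \<Longrightarrow> \<mu>0 A = m A"
    "measure_space UNIV (sigma_sets UNIV clopens) \<mu>0" by blast
  define \<nu> where "\<nu> = measure_of UNIV (sigma_sets UNIV clopens) \<mu>0"
  have sp: "space \<nu> = UNIV" and st: "sets \<nu> = sets borel"
    by (simp_all add: \<nu>_def borel_eq_clopens sigma_sets_sigma_sets_eq)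
  have em: "emeasure \<nu> A = \<mu>0 A" if "A \<in> sigma_sets UNIV clopens" for A
    unfolding \<nu>_def using \<mu>0(2) that
    by (intro emeasure_measure_of_sigma) (auto simp: measure_space_def)
  have UN: "UNIV \<in> (clopens :: ('d, 'q) config set set)" by (simp add: clopens_def)
  have I1: "I UNIV = const_bcontfun 1"
    by (rule bcontfun_eqI) (simp add: I[OF UN] const_bcontfun.rep_eq)
  have "emeasure \<nu> (space \<nu>) = 1"
    using em[of UNIV] UN \<mu>0(1)[OF UN] by (simp add: sp m_def I1 one sigma_sets.Basic)
  then have "\<nu> \<in> prob_measures"
    using st by (simp add: space_prob_algebra prob_spaceI)
  moreover have "measure \<nu> A = \<phi> (Bcontfun (indicator A))" if A: "A \<in> clopens" for A
    using em[of A] A \<mu>0(1)[OF A] nonneg[OF A]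
    by (simp add: measure_def sigma_sets.Basic m_def I_def)
  ultimately show ?thesis using that by blast
qed

section \<open>Evolution of measures under a Feller semigroup\<close>

lemma sum_patterns_indicator:
  fixes h :: "('d::finite, 'q::finite) config \<Rightarrow> real"
  assumes "finite \<Lambda>"
  shows "(\<Sum>\<eta>\<in>patterns \<Lambda>. h \<eta> * indicator (cyl \<Lambda> \<eta>) \<omega>) = h (restrict \<omega> \<Lambda>)"
proof -
  have "(\<Sum>\<eta>\<in>patterns \<Lambda>. h \<eta> * indicator (cyl \<Lambda> \<eta>) \<omega>) =
      (\<Sum>\<eta>\<in>patterns \<Lambda>. if \<eta> = restrict \<omega> \<Lambda> then h \<eta> else 0)"
    by (intro sum.cong) (auto simp: in_cyl_pattern indicator_def)
  then show ?thesis using assms by simp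
qed

definition cyl_fun :: "('d::finite) site set \<Rightarrow> ('d, 'q::finite) config \<Rightarrow> ('d, 'q) config \<Rightarrow>\<^sub>C real" where
  "cyl_fun \<Lambda> \<eta> = Bcontfun (indicator (cyl \<Lambda> \<eta>))"

lemma apply_cyl_fun [simp]: "finite \<Lambda> \<Longrightarrow> apply_bcontfun (cyl_fun \<Lambda> \<eta>) = indicator (cyl \<Lambda> \<eta>)"
  unfolding cyl_fun_def
  by (intro apply_Bcontfun_continuous continuous_on_indicator_clopen open_cyl closed_cyl)

lemma apply_bcontfun_sum:
  fixes f :: "'i \<Rightarrow> ('a::topological_space \<Rightarrow>\<^sub>C real)"
  shows "apply_bcontfun (\<Sum>i\<in>I. f i) x = (\<Sum>i\<in>I. apply_bcontfun (f i) x)"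
  by (induction I rule: infinite_finite_induct) (auto simp: plus_bcontfun.rep_eq)

text \<open>Uniform continuity in terms of cylinders: finitely many cylinders on which
  \<open>f\<close> stays within \<open>e/2\<close> of its value at the centre cover the space, and
  agreement on the union of their regions puts both configurations into a common one.\<close>

lemma continuous_almost_local:
  fixes f :: "('d::finite, 'q::finite) config \<Rightarrow> real"
  assumes f: "continuous_on UNIV f" and e: "e > 0"
  obtains \<Lambda> where "finite \<Lambda>" "\<And>\<omega> \<omega>'. \<omega>' \<in> cyl \<Lambda> \<omega> \<Longrightarrow> \<bar>f \<omega>' - f \<omega>\<bar> < e"
proof -
  have "\<exists>\<Lambda>. finite \<Lambda> \<and> cyl \<Lambda> \<omega> \<subseteq> f -` ball (f \<omega>) (e/2)" for \<omega>
  proof -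
    have "open (f -` ball (f \<omega>) (e/2))" using f by (intro open_vimage) auto
    moreover have "\<omega> \<in> f -` ball (f \<omega>) (e/2)" using e by simp
    ultimately show ?thesis using cyl_in_open by metis
  qed
  then obtain L where L: "\<And>\<omega>. finite (L \<omega>)" "\<And>\<omega>. cyl (L \<omega>) \<omega> \<subseteq> f -` ball (f \<omega>) (e/2)"
    by metis
  obtain C where C: "C \<subseteq> UNIV" "finite C" "UNIV \<subseteq> (\<Union>\<omega>\<in>C. cyl (L \<omega>) \<omega>)"
    by (rule compactE_image[OF compact_configs, where C = UNIV and f = "\<lambda>\<omega>. cyl (L \<omega>) \<omega>"])
       (use open_cyl[OF L(1)] in auto)
  show ?thesis
  proof (rule that[of "\<Union>\<omega>\<in>C. L \<omega>"])
    show "finite (\<Union>\<omega>\<in>C. L \<omega>)" using C L by auto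
    fix \<omega> \<omega>' :: "('d, 'q) config" assume *: "\<omega>' \<in> cyl (\<Union>\<omega>\<in>C. L \<omega>) \<omega>"
    obtain \<zeta> where \<zeta>: "\<zeta> \<in> C" "\<omega> \<in> cyl (L \<zeta>) \<zeta>" using C by auto
    then have "\<omega>' \<in> cyl (L \<zeta>) \<zeta>" using * by (auto simp: in_cyl)
    then have "f \<omega> \<in> ball (f \<zeta>) (e/2)" "f \<omega>' \<in> ball (f \<zeta>) (e/2)" using \<zeta> L(2) by blast+
    then show "\<bar>f \<omega>' - f \<omega>\<bar> < e" by (auto simp: dist_real_def abs_if split: if_splits)
  qed
qed

text \<open>A pattern is itself a total configuration, so \<open>f\<close> can be sampled at it; the
  approximation is \<open>f\<close> evaluated at \<open>restrict \<omega> \<Lambda>\<close>, which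
  agrees with \<open>\<omega>\<close> on \<open>\<Lambda>\<close>.\<close>

lemma bcontfun_approx_local:
  fixes f :: "('d::finite, 'q::finite) config \<Rightarrow>\<^sub>C real"
  assumes e: "e > 0"
  obtains \<Lambda> where "finite \<Lambda>" "norm (f - (\<Sum>\<eta>\<in>patterns \<Lambda>. apply_bcontfun f \<eta> *\<^sub>R cyl_fun \<Lambda> \<eta>)) \<le> e"
proof -
  obtain \<Lambda> where \<Lambda>: "finite \<Lambda>"
    "\<And>\<omega> \<omega>'. \<omega>' \<in> cyl \<Lambda> \<omega> \<Longrightarrow> \<bar>apply_bcontfun f \<omega>' - apply_bcontfun f \<omega>\<bar> < e"
    using continuous_almost_local[OF _ e, of "apply_bcontfun f"] by auto
  have "norm (f - (\<Sum>\<eta>\<in>patterns \<Lambda>. apply_bcontfun f \<eta> *\<^sub>R cyl_fun \<Lambda> \<eta>)) \<le> e"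
  proof (rule norm_bound)
    fix \<omega>
    have "apply_bcontfun (\<Sum>\<eta>\<in>patterns \<Lambda>. apply_bcontfun f \<eta> *\<^sub>R cyl_fun \<Lambda> \<eta>) \<omega> =
        (\<Sum>\<eta>\<in>patterns \<Lambda>. apply_bcontfun f \<eta> * indicator (cyl \<Lambda> \<eta>) \<omega>)"
      using \<Lambda> by (simp add: apply_bcontfun_sum scaleR_bcontfun.rep_eq)
    also have "\<dots> = apply_bcontfun f (restrict \<omega> \<Lambda>)"
      by (rule sum_patterns_indicator) fact
    finally show "norm (apply_bcontfun (f - (\<Sum>\<eta>\<in>patterns \<Lambda>. apply_bcontfun f \<eta> *\<^sub>R cyl_fun \<Lambda> \<eta>)) \<omega>) \<le> e"
      using \<Lambda>(2)[of \<omega> "restrict \<omega> \<Lambda>"] by (simp add: minus_bcontfun.rep_eq in_cyl)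
  qed
  with \<Lambda>(1) show ?thesis by (rule that)
qed

lemma
  fixes c :: real and A :: "('d::finite, 'q::finite) config set"
  assumes "\<nu> \<in> prob_measures" "A \<in> sets borel"
  shows integrable_scaled_indicator: "integrable \<nu> (\<lambda>\<omega>. c * indicator A \<omega>)"
    and integral_scaled_indicator: "(\<integral>\<omega>. c * indicator A \<omega> \<partial>\<nu>) = c * measure \<nu> A"
proof -
  interpret prob_space \<nu> using assms prob_measuresD by blast
  show "integrable \<nu> (\<lambda>\<omega>. c * indicator A \<omega>)"
    using assms prob_measuresD[OF assms(1)]
    by (intro integrable_mult_right integrable_real_indicator) (auto simp: less_top[symmetric])
  show "(\<integral>\<omega>. c * indicator A \<omega> \<partial>\<nu>) = c * measure \<nu> A"
    using prob_measuresD[OF assms(1)] by simp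
qed

text \<open>Lets limits of the semigroup as its time decreases to 0 be used on both sides of a time
  \<open>r\<close>.\<close>

lemma filterlim_abs_diff_at_right:
  "filterlim (\<lambda>y. \<bar>y - r\<bar>) (at_right 0) (at (r::real) within S)"
proof -
  have "((\<lambda>y. \<bar>y - r\<bar>) \<longlongrightarrow> \<bar>r - r\<bar>) (at r within S)" by (intro tendsto_intros)
  then show ?thesis
    by (auto simp: filterlim_at eventually_at_filter)
qed

section \<open>The evolved measure and its dependence on time\<close>

context
  fixes P :: "('d::finite, 'q::finite) semigroup"
  assumes P: "feller_semigroup P"
begin

lemma semigroup_linear: "t \<ge> 0 \<Longrightarrow> linear (P t)"
  using P by (simp add: feller_semigroup_def)

lemma semigroup_add: "s \<ge> 0 \<Longrightarrow> t \<ge> 0 \<Longrightarrow> P (s + t) f = P s (P t f)"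
  using P by (simp add: feller_semigroup_def)

text \<open>Positivity is applied to \<open>norm f\<close> times the constant 1, minus and plus
  \<open>f\<close>; constants are preserved.\<close>

lemma semigroup_contraction:
  assumes "t \<ge> 0"
  shows "norm (P t f) \<le> norm f"
proof (rule norm_bound)
  fix \<omega>
  have pos: "0 \<le> apply_bcontfun (P t g) \<omega>" if "\<And>\<eta>. 0 \<le> apply_bcontfun g \<eta>" for g
    using P assms that by (auto simp: feller_semigroup_def)
  have one: "P t (const_bcontfun 1) = const_bcontfun 1"
    using P assms by (simp add: feller_semigroup_def)
  have b: "\<bar>apply_bcontfun f \<eta>\<bar> \<le> norm f" for \<eta>
    using norm_bounded[of f \<eta>] by simp
  note rep = minus_bcontfun.rep_eq plus_bcontfun.rep_eq scaleR_bcontfun.rep_eq const_bcontfun.rep_eq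
  have "0 \<le> apply_bcontfun (P t (norm f *\<^sub>R const_bcontfun 1 - f)) \<omega>"
    by (rule pos) (use b in \<open>simp add: rep abs_le_iff\<close>)
  moreover have "0 \<le> apply_bcontfun (P t (norm f *\<^sub>R const_bcontfun 1 + f)) \<omega>"
  proof (rule pos)
    fix \<eta> show "0 \<le> apply_bcontfun (norm f *\<^sub>R const_bcontfun 1 + f) \<eta>"
      using b[of \<eta>] by (simp add: rep abs_le_iff)
  qed
  ultimately show "norm (apply_bcontfun (P t f) \<omega>) \<le> norm f"
    using semigroup_linear[OF assms]
    by (simp add: linear_diff linear_add linear_scale one rep abs_le_iff)
qed

lemma semigroup_at_0: "((\<lambda>t. P t f) \<longlongrightarrow> f) (at_right 0)"
  using P by (simp add: feller_semigroup_def)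

text \<open>The positive functional sending \<open>f\<close> to the integral of \<open>P t f\<close>
  is represented on clopen sets; density of cylinder functions extends the representation to all
  continuous functions.\<close>

lemma evolve_exists:
  assumes t: "t \<ge> 0" and \<nu>: "\<nu> \<in> prob_measures"
  shows "\<exists>\<nu>'. \<nu>' \<in> prob_measures \<and>
    (\<forall>f. (\<integral>\<eta>. apply_bcontfun f \<eta> \<partial>\<nu>') = (\<integral>\<eta>. apply_bcontfun (P t f) \<eta> \<partial>\<nu>))"
proof -
  interpret N: prob_space \<nu> using \<nu> prob_measuresD by blast
  define \<phi> where "\<phi> f = (\<integral>\<eta>. apply_bcontfun (P t f) \<eta> \<partial>\<nu>)" for f
  note lt = semigroup_linear[OF t]
  have lin: "linear \<phi>"
  proof (rule linearI)
    show "\<phi> (f + g) = \<phi> f + \<phi> g" for f g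
      unfolding \<phi>_def using integrable_bcontfun[OF \<nu>]
      by (simp add: linear_add[OF lt] plus_bcontfun.rep_eq)
    show "\<phi> (r *\<^sub>R f) = r *\<^sub>R \<phi> f" for f r
      unfolding \<phi>_def by (simp add: linear_scale[OF lt] scaleR_bcontfun.rep_eq)
  qed
  obtain \<nu>' where \<nu>': "\<nu>' \<in> prob_measures" "\<And>A. A \<in> clopens \<Longrightarrow> measure \<nu>' A = \<phi> (Bcontfun (indicator A))"
  proof (rule positive_functional_measure[OF lin])
    show "0 \<le> \<phi> f" if "\<And>\<eta>. 0 \<le> apply_bcontfun f \<eta>" for f
      unfolding \<phi>_def using that P t by (intro Bochner_Integration.integral_nonneg) (auto simp: feller_semigroup_def)
    show "\<phi> (const_bcontfun 1) = 1"
      using P t N.prob_space by (simp add: \<phi>_def feller_semigroup_def const_bcontfun.rep_eq)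
  qed blast
  interpret N': prob_space \<nu>' using \<nu>' prob_measuresD by blast
  \<comment> \<open>Both sides agree on cylinder functions and are bounded by the norm.
    Approximating \<open>f\<close> within a quarter of a supposed gap \<open>e\<close> would bound
    \<open>e\<close> by \<open>e/2\<close>.\<close>
  have "(\<integral>\<eta>. apply_bcontfun f \<eta> \<partial>\<nu>') = \<phi> f" for f
  proof (rule ccontr)
    assume neq: "\<not> ?thesis"
    define e where "e = \<bar>(\<integral>\<eta>. apply_bcontfun f \<eta> \<partial>\<nu>') - \<phi> f\<bar>"
    obtain \<Lambda> where \<Lambda>: "finite \<Lambda>"
      "norm (f - (\<Sum>\<eta>\<in>patterns \<Lambda>. apply_bcontfun f \<eta> *\<^sub>R cyl_fun \<Lambda> \<eta>)) \<le> e / 4" (is "norm (f - ?g) \<le> _")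
      using bcontfun_approx_local[of "e/4" f] neq by (auto simp: e_def)
    have c: "cyl \<Lambda> \<eta> \<in> clopens" for \<eta> :: "('d, 'q) config"
      using \<Lambda>(1) by (simp add: clopens_def open_cyl closed_cyl)
    have "(\<integral>\<eta>. apply_bcontfun ?g \<eta> \<partial>\<nu>') =
        (\<integral>\<omega>. (\<Sum>\<eta>\<in>patterns \<Lambda>. apply_bcontfun f \<eta> * indicator (cyl \<Lambda> \<eta>) \<omega>) \<partial>\<nu>')"
      using \<Lambda>(1) by (simp add: apply_bcontfun_sum scaleR_bcontfun.rep_eq del: sum_mult_indicator)
    also have "\<dots> = (\<Sum>\<eta>\<in>patterns \<Lambda>. \<integral>\<omega>. apply_bcontfun f \<eta> * indicator (cyl \<Lambda> \<eta>) \<omega> \<partial>\<nu>')"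
      by (rule Bochner_Integration.integral_sum) (rule integrable_scaled_indicator[OF \<nu>'(1)], simp)
    also have "\<dots> = (\<Sum>\<eta>\<in>patterns \<Lambda>. apply_bcontfun f \<eta> * measure \<nu>' (cyl \<Lambda> \<eta>))"
      by (intro sum.cong refl integral_scaled_indicator[OF \<nu>'(1)]) simp
    also have "\<dots> = \<phi> ?g"
      using lin by (simp add: linear_sum linear_scale \<nu>'(2)[OF c] cyl_fun_def)
    finally have eq: "(\<integral>\<eta>. apply_bcontfun ?g \<eta> \<partial>\<nu>') = \<phi> ?g" .
    have "(\<integral>\<eta>. apply_bcontfun f \<eta> \<partial>\<nu>') - \<phi> f = (\<integral>\<eta>. apply_bcontfun (f - ?g) \<eta> \<partial>\<nu>') - \<phi> (f - ?g)"
      using eq integrable_bcontfun[OF \<nu>'(1)] lin by (simp add: minus_bcontfun.rep_eq linear_diff)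
    moreover have "\<bar>\<integral>\<eta>. apply_bcontfun (f - ?g) \<eta> \<partial>\<nu>'\<bar> \<le> e / 4"
      using abs_integral_bcontfun_le[OF \<nu>'(1)] \<Lambda>(2) by (rule order_trans)
    moreover have "\<bar>\<phi> (f - ?g)\<bar> \<le> e / 4"
      unfolding \<phi>_def
      using order_trans[OF abs_integral_bcontfun_le[OF \<nu>] order_trans[OF semigroup_contraction[OF t] \<Lambda>(2)]] .
    ultimately have "e \<le> e / 4 + e / 4" unfolding e_def by linarith
    then show False using neq by (simp add: e_def)
  qed
  with \<nu>'(1) show ?thesis unfolding \<phi>_def by blast
qed

lemma
  assumes t: "t \<ge> 0" and \<nu>: "\<nu> \<in> prob_measures"
  shows evolve_prob: "evolve P t \<nu> \<in> prob_measures"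
    and evolve_integral: "(\<integral>\<eta>. apply_bcontfun f \<eta> \<partial>evolve P t \<nu>) = (\<integral>\<eta>. apply_bcontfun (P t f) \<eta> \<partial>\<nu>)"
proof -
  let ?Q = "\<lambda>\<nu>'. \<nu>' \<in> prob_measures \<and>
    (\<forall>f. (\<integral>\<eta>. apply_bcontfun f \<eta> \<partial>\<nu>') = (\<integral>\<eta>. apply_bcontfun (P t f) \<eta> \<partial>\<nu>))"
  have "\<exists>!\<nu>'. ?Q \<nu>'"
    using evolve_exists[OF t \<nu>] by (auto intro!: prob_measure_eqI)
  then have "?Q (evolve P t \<nu>)" unfolding evolve_def by (rule theI')
  then show "evolve P t \<nu> \<in> prob_measures"
    "(\<integral>\<eta>. apply_bcontfun f \<eta> \<partial>evolve P t \<nu>) = (\<integral>\<eta>. apply_bcontfun (P t f) \<eta> \<partial>\<nu>)" by auto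
qed

text \<open>The increment is the integral of \<open>P h f - f\<close> against the measure at time
  \<open>s\<close>. The bound does not involve \<open>s\<close> or \<open>\<nu>\<close>, which later
  gives time windows of a length common to all \<open>t n\<close>.\<close>

lemma evolve_increment:
  assumes \<nu>: "\<nu> \<in> prob_measures" and s: "s \<ge> 0" and h: "h \<ge> 0"
  shows "\<bar>(\<integral>\<eta>. apply_bcontfun f \<eta> \<partial>evolve P (s + h) \<nu>) - (\<integral>\<eta>. apply_bcontfun f \<eta> \<partial>evolve P s \<nu>)\<bar>
    \<le> norm (P h f - f)"
proof -
  have "(\<integral>\<eta>. apply_bcontfun (P h f - f) \<eta> \<partial>evolve P s \<nu>) = (\<integral>\<eta>. apply_bcontfun (P s (P h f) - P s f) \<eta> \<partial>\<nu>)"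
    by (simp only: evolve_integral[OF s \<nu>] linear_diff[OF semigroup_linear[OF s]])
  also have "\<dots> = (\<integral>\<eta>. apply_bcontfun (P s (P h f)) \<eta> \<partial>\<nu>) - (\<integral>\<eta>. apply_bcontfun (P s f) \<eta> \<partial>\<nu>)"
    using integrable_bcontfun[OF \<nu>] by (simp add: minus_bcontfun.rep_eq)
  also have "\<dots> = (\<integral>\<eta>. apply_bcontfun f \<eta> \<partial>evolve P (s + h) \<nu>) - (\<integral>\<eta>. apply_bcontfun f \<eta> \<partial>evolve P s \<nu>)"
    using s h \<nu> by (simp add: evolve_integral semigroup_add)
  finally show ?thesis using abs_integral_bcontfun_le[OF evolve_prob[OF s \<nu>], of "P h f - f"] by simp
qed

lemma evolve_difference_quotient:
  assumes \<nu>: "\<nu> \<in> prob_measures" and s: "s \<ge> 0" and h: "h > 0"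
  defines "m \<equiv> \<lambda>t f. \<integral>\<eta>. apply_bcontfun f \<eta> \<partial>evolve P t \<nu>"
  shows "\<bar>(m (s + h) f - m s f) / h - m s g\<bar> \<le> norm ((P h f - f) /\<^sub>R h - g)"
proof -
  have "m (s + h) f = m s (P h f)"
    unfolding m_def using s h \<nu> by (simp add: evolve_integral semigroup_add)
  moreover have "m s ((P h f - f) /\<^sub>R h - g) = (m s (P h f) - m s f) / h - m s g"
    unfolding m_def using integrable_bcontfun[OF evolve_prob[OF s \<nu>]]
    by (simp add: minus_bcontfun.rep_eq scaleR_bcontfun.rep_eq divide_inverse_commute)
  ultimately show ?thesis
    unfolding m_def using abs_integral_bcontfun_le[OF evolve_prob[OF s \<nu>], of "(P h f - f) /\<^sub>R h - g"] by simp
qed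

lemma evolve_continuous:
  fixes f :: "('d, 'q) config \<Rightarrow>\<^sub>C real"
  assumes \<nu>: "\<nu> \<in> prob_measures" and r: "r \<ge> 0"
  shows "((\<lambda>t. \<integral>\<eta>. apply_bcontfun f \<eta> \<partial>evolve P t \<nu>) \<longlongrightarrow> (\<integral>\<eta>. apply_bcontfun f \<eta> \<partial>evolve P r \<nu>))
    (at r within {0..})"
proof (rule LIM_zero_cancel, rule Lim_null_comparison)
  show "\<forall>\<^sub>F t in at r within {0..}. norm ((\<integral>\<eta>. apply_bcontfun f \<eta> \<partial>evolve P t \<nu>) -
      (\<integral>\<eta>. apply_bcontfun f \<eta> \<partial>evolve P r \<nu>)) \<le> norm (P \<bar>t - r\<bar> f - f)"
  proof (unfold eventually_at_filter, intro always_eventually allI impI)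
    fix t assume "t \<in> {0::real..}"
    then show "norm ((\<integral>\<eta>. apply_bcontfun f \<eta> \<partial>evolve P t \<nu>) -
      (\<integral>\<eta>. apply_bcontfun f \<eta> \<partial>evolve P r \<nu>)) \<le> norm (P \<bar>t - r\<bar> f - f)"
      using evolve_increment[OF \<nu> r, of "t - r" f] evolve_increment[OF \<nu>, of t "r - t" f] r
      by (cases "t \<le> r") (auto simp: abs_minus_commute)
  qed
  have "((\<lambda>t. P \<bar>t - r\<bar> f) \<longlongrightarrow> f) (at r within {0..})"
    by (rule filterlim_compose[OF semigroup_at_0 filterlim_abs_diff_at_right])
  then show "((\<lambda>t. norm (P \<bar>t - r\<bar> f - f)) \<longlongrightarrow> 0) (at r within {0..})"
    by (intro tendsto_norm_zero LIM_zero)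
qed

text \<open>A two-sided derivative at \<open>r\<close> is needed for the mean value theorem, whereas
  the generator is a right derivative at 0. For \<open>t < r\<close> the quotient is based at
  \<open>t\<close>, and the integral of \<open>g\<close> is then moved from \<open>t\<close> to
  \<open>r\<close>.\<close>

lemma evolve_derivative:
  assumes \<nu>: "\<nu> \<in> prob_measures" and r: "r \<ge> 0" and fg: "(f, g) \<in> generator_graph P"
  shows "((\<lambda>t. \<integral>\<eta>. apply_bcontfun f \<eta> \<partial>evolve P t \<nu>)
    has_real_derivative (\<integral>\<eta>. apply_bcontfun g \<eta> \<partial>evolve P r \<nu>)) (at r within {0..})"
proof -
  define m where "m t f = (\<integral>\<eta>. apply_bcontfun f \<eta> \<partial>evolve P t \<nu>)"
    for t and f :: "('d, 'q) config \<Rightarrow>\<^sub>C real"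
  \<comment> \<open>The second summand pays for moving the integral of \<open>g\<close> from the
    earlier base time to \<open>r\<close>.\<close>
  define e where "e h = norm ((P h f - f) /\<^sub>R h - g) + norm (P h g - g)" for h
  have "(e \<longlongrightarrow> 0 + 0) (at_right 0)"
    unfolding e_def
    by (intro tendsto_add tendsto_norm_zero LIM_zero semigroup_at_0)
       (use fg in \<open>simp add: generator_graph_def\<close>)
  then have lim: "((\<lambda>t. e \<bar>t - r\<bar>) \<longlongrightarrow> 0) (at r within {0..})"
    using filterlim_compose[OF _ filterlim_abs_diff_at_right] by fastforce
  have "((\<lambda>t. (m t f - m r f) / (t - r)) \<longlongrightarrow> m r g) (at r within {0..})"
  proof (rule LIM_zero_cancel, rule Lim_null_comparison[OF _ lim])
    show "\<forall>\<^sub>F t in at r within {0..}. norm ((m t f - m r f) / (t - r) - m r g) \<le> e \<bar>t - r\<bar>"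
      unfolding eventually_at_filter
    proof (intro always_eventually allI impI)
      fix t assume t: "t \<noteq> r" "t \<in> {0::real..}"
      show "norm ((m t f - m r f) / (t - r) - m r g) \<le> e \<bar>t - r\<bar>"
      proof (cases "r < t")
        case True
        then have "\<bar>(m t f - m r f) / (t - r) - m r g\<bar> \<le> norm ((P (t - r) f - f) /\<^sub>R (t - r) - g)"
          unfolding m_def using evolve_difference_quotient[OF \<nu> r, of "t - r" f g] by simp
        then show ?thesis using True by (simp add: e_def add_increasing2)
      next
        case False
        then have tr: "t < r" using t by simp
        have "\<bar>(m r f - m t f) / (r - t) - m t g\<bar> \<le> norm ((P (r - t) f - f) /\<^sub>R (r - t) - g)"
          unfolding m_def using evolve_difference_quotient[OF \<nu>, of t "r - t" f g] t tr by simp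
        moreover have "\<bar>m r g - m t g\<bar> \<le> norm (P (r - t) g - g)"
          unfolding m_def using evolve_increment[OF \<nu>, of t "r - t" g] t tr by simp
        moreover have "(m t f - m r f) / (t - r) = (m r f - m t f) / (r - t)"
          using minus_divide_divide[of "m r f - m t f" "r - t"] by simp
        ultimately show ?thesis using tr by (simp add: e_def abs_if split: if_splits)
      qed
    qed
  qed
  then show ?thesis by (simp add: has_field_derivative_iff m_def)
qed

end

section \<open>Conditional probabilities of Gibbs measures\<close>

lemma measurable_borel_coord_algebra:
  assumes "f \<in> measurable (coord_algebra \<Lambda>) M"
  shows "f \<in> measurable (borel :: ('d::finite, 'q::finite) config measure) M"
proof -
  have "sets (coord_algebra \<Lambda>) \<subseteq> sets (borel :: ('d, 'q) config measure)"
  proof -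
    have "{\<omega> :: ('d, 'q) config. \<omega> x = a} \<in> sets borel" for x a
      using borel_closed[OF closed_coordinate[of x "{a}"]] by (simp add: vimage_def)
    then have "{{\<omega>. \<omega> x = a} | x a. x \<in> \<Lambda>} \<subseteq> sets (borel :: ('d, 'q) config measure)" by auto
    from sets.sigma_sets_subset[OF this] show ?thesis by (simp add: coord_algebra_def)
  qed
  then show ?thesis
    using measurable_space[OF assms] measurable_sets[OF assms]
    by (intro measurableI) (auto simp: coord_algebra_def)
qed

lemma coord_algebra_local:
  assumes "A \<in> sets (coord_algebra \<Lambda>)" "\<omega>' \<in> cyl \<Lambda> \<omega>"
  shows "\<omega> \<in> A \<longleftrightarrow> \<omega>' \<in> A"
proof -
  have "A \<in> sigma_sets UNIV {{\<omega>. \<omega> x = a} | x a. x \<in> \<Lambda>}"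
    using assms(1) by (simp add: coord_algebra_def)
  then show ?thesis
    by induction (use assms(2) in \<open>auto simp: in_cyl\<close>)
qed

text \<open>The level set of \<open>f\<close> through \<open>\<omega>\<close> lies in the coordinate
  algebra, whose sets cannot separate configurations that agree on \<open>\<Lambda>\<close>.\<close>

lemma coord_measurable_local:
  fixes f :: "('d::finite, 'q) config \<Rightarrow> real"
  assumes "f \<in> borel_measurable (coord_algebra \<Lambda>)" "\<omega>' \<in> cyl \<Lambda> \<omega>"
  shows "f \<omega>' = f \<omega>"
proof -
  have "f -` {f \<omega>} \<inter> space (coord_algebra \<Lambda>) \<in> sets (coord_algebra \<Lambda>)"
    using assms(1) by (rule measurable_sets) simp
  then have "f -` {f \<omega>} \<in> sets (coord_algebra \<Lambda>)" by (simp add: coord_algebra_def)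
  from coord_algebra_local[OF this assms(2)] have "\<omega>' \<in> f -` {f \<omega>}" by (rule iffD1) simp
  then show ?thesis by simp
qed

lemma sum_measure_patterns:
  fixes \<nu> :: "('d::finite, 'q::finite) config measure"
  assumes "\<nu> \<in> prob_measures" "finite B" "A \<in> sets borel"
  shows "(\<Sum>\<zeta>\<in>patterns B. measure \<nu> (A \<inter> cyl B \<zeta>)) = measure \<nu> A"
proof -
  interpret prob_space \<nu> by (rule prob_measuresD[OF assms(1)])
  have disj: "A \<inter> cyl B \<zeta> \<inter> (A \<inter> cyl B \<zeta>') = {}" if "\<zeta> \<in> patterns B" "\<zeta>' \<in> patterns B" "\<zeta> \<noteq> \<zeta>'" for \<zeta> \<zeta>'
  proof -
    have False if "\<omega> \<in> cyl B \<zeta>" "\<omega> \<in> cyl B \<zeta>'" for \<omega>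
      using that \<open>\<zeta> \<noteq> \<zeta>'\<close> in_cyl_pattern[OF \<open>\<zeta> \<in> patterns B\<close>, of \<omega>]
        in_cyl_pattern[OF \<open>\<zeta>' \<in> patterns B\<close>, of \<omega>] by simp
    then show ?thesis by blast
  qed
  have "(\<Sum>\<zeta>\<in>patterns B. measure \<nu> (A \<inter> cyl B \<zeta>)) = measure \<nu> (\<Union>\<zeta>\<in>patterns B. A \<inter> cyl B \<zeta>)"
  proof (rule finite_measure_finite_Union[symmetric])
    show "disjoint_family_on (\<lambda>\<zeta>. A \<inter> cyl B \<zeta>) (patterns B)"
      unfolding disjoint_family_on_def using disj by blast
    show "finite (patterns B :: ('d, 'q) config set)" by (rule finite_patterns[OF assms(2)])
    show "(\<lambda>\<zeta>. A \<inter> cyl B \<zeta>) ` patterns B \<subseteq> events"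
      unfolding prob_measuresD(2)[OF assms(1)] using assms(3) by (intro image_subsetI sets.Int cyl_borel)
  qed
  also have "(\<Union>\<zeta>\<in>patterns B. A \<inter> cyl B \<zeta>) = A"
  proof
    show "A \<subseteq> (\<Union>\<zeta>\<in>patterns B. A \<inter> cyl B \<zeta>)"
    proof
      fix \<omega> assume "\<omega> \<in> A"
      then show "\<omega> \<in> (\<Union>\<zeta>\<in>patterns B. A \<inter> cyl B \<zeta>)"
        by (intro UN_I[of "restrict \<omega> B"]) auto
    qed
  qed auto
  finally show ?thesis .
qed

lemma abs_ln_diff_le:
  fixes a b m :: real
  assumes "0 < m" "m \<le> a" "m \<le> b"
  shows "\<bar>ln a - ln b\<bar> \<le> \<bar>a - b\<bar> / m"
proof -
  have *: "ln a - ln b \<le> \<bar>a - b\<bar> / m" if "m \<le> a" "m \<le> b" for a b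
  proof -
    have "ln a - ln b = ln (a / b)" using assms(1) that by (simp add: ln_div)
    also have "\<dots> \<le> a / b - 1" using assms(1) that by (intro ln_le_minus_one) auto
    also have "\<dots> = (a - b) / b" using assms(1) that by (simp add: field_simps)
    also have "\<dots> \<le> \<bar>a - b\<bar> / m" using assms(1) that by (intro frac_le) auto
    finally show ?thesis .
  qed
  show ?thesis using *[of a b] *[of b a] assms by (auto simp: abs_le_iff abs_minus_commute)
qed

locale gibbs =
  fixes \<gamma> :: "('d::finite, 'q::finite) kernels" and \<mu> :: "('d, 'q) config measure"
  assumes spec: "is_specification \<gamma>"
    and nonnull: "non_null \<gamma>"
    and spec_inv: "spec_translation_invariant \<gamma>"
    and quasi: "quasilocal \<gamma>"
    and gibbs: "\<mu> \<in> gibbs_measures \<gamma>"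
begin

lemma mu_prob: "\<mu> \<in> prob_measures"
  using gibbs by (simp add: gibbs_measures_def)

sublocale prob_space \<mu>
  using mu_prob by (rule prob_measuresD)

lemma kernel_coord: "\<Lambda> \<in> regions \<Longrightarrow> \<gamma> \<Lambda> \<in> measurable (coord_algebra (- \<Lambda>)) (prob_algebra borel)"
  using spec by (simp add: is_specification_def)

lemma kernel_borel: "\<Lambda> \<in> regions \<Longrightarrow> \<gamma> \<Lambda> \<in> measurable borel (prob_algebra borel)"
  using kernel_coord by (rule measurable_borel_coord_algebra)

lemma kernel_prob: "\<Lambda> \<in> regions \<Longrightarrow> \<gamma> \<Lambda> \<eta> \<in> prob_measures"
  using measurable_space[OF kernel_borel, of \<Lambda> \<eta>] by simp

lemma kernel_local:
  assumes "\<Lambda> \<in> regions" "A \<in> sets borel" "\<omega>' \<in> cyl (- \<Lambda>) \<omega>"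
  shows "measure (\<gamma> \<Lambda> \<omega>') A = measure (\<gamma> \<Lambda> \<omega>) A"
proof -
  have "(\<lambda>\<omega>. measure (\<gamma> \<Lambda> \<omega>) A) \<in> borel_measurable (coord_algebra (- \<Lambda>))"
    using kernel_coord[OF assms(1)] assms(2)
    by (intro measurable_compose[OF measurable_prob_algebraD measurable_measure_subprob_algebra]) auto
  then show ?thesis using assms(3) by (rule coord_measurable_local)
qed

lemma kernel_measurable: "\<Lambda> \<in> regions \<Longrightarrow> A \<in> sets borel \<Longrightarrow> (\<lambda>\<omega>. measure (\<gamma> \<Lambda> \<omega>) A) \<in> borel_measurable borel"
  using kernel_borel
  by (intro measurable_compose[OF measurable_prob_algebraD measurable_measure_subprob_algebra]) auto

lemma kernel_proper:
  assumes "\<Delta> \<in> regions" "finite \<Lambda>" "\<Delta> \<subseteq> \<Lambda>"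
  shows "measure (\<gamma> \<Delta> \<omega>) (cyl \<Lambda> \<eta>) = measure (\<gamma> \<Delta> \<omega>) (cyl \<Delta> \<eta>) * indicator (cyl (\<Lambda> - \<Delta>) \<eta>) \<omega>"
\<comment> \<open>Properness is stated for nonempty regions, so an empty remainder
  \<open>\<Lambda> - \<Delta>\<close> is a case of its own.\<close>
proof (cases "\<Lambda> = \<Delta>")
  case True then show ?thesis by (simp add: cyl_def)
next
  case False
  then have "\<Lambda> - \<Delta> \<in> regions" using assms by (auto simp: regions_def)
  moreover have "cyl \<Lambda> \<eta> = cyl \<Delta> \<eta> \<inter> cyl (\<Lambda> - \<Delta>) \<eta>"
    using assms by (auto simp: cyl_def)
  moreover have "\<forall>\<Lambda>\<in>regions. \<forall>\<Delta>\<in>regions. \<Delta> \<subseteq> - \<Lambda> \<longrightarrow>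
      (\<forall>\<xi> \<eta>. measure (\<gamma> \<Lambda> \<eta>) (cyl \<Lambda> \<xi> \<inter> cyl \<Delta> \<xi>) = measure (\<gamma> \<Lambda> \<eta>) (cyl \<Lambda> \<xi>) * indicator (cyl \<Delta> \<xi>) \<eta>)"
    using spec unfolding is_specification_def by blast
  ultimately show ?thesis using assms(1) by (metis Compl_disjoint2 Diff_eq Int_lower2)
qed

lemma bind_measure:
  assumes M: "M \<in> prob_measures" and K: "K \<in> measurable borel (prob_algebra borel)" and A: "A \<in> sets borel"
  shows "measure (M \<bind> K) A = (\<integral>\<omega>. measure (K \<omega>) A \<partial>(M :: ('d, 'q) config measure))"
    (is ?eq) and "M \<bind> K \<in> prob_measures"
proof -
  have s: "sets M = sets borel" "space M \<noteq> {}" using prob_measuresD[OF M] by auto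
  have K': "K \<in> measurable M (prob_algebra borel)"
    using K by (subst measurable_cong_sets[OF s(1) refl])
  have K'': "K \<in> measurable M (subprob_algebra borel)"
    using K' by (rule measurable_prob_algebraD)
  interpret M: prob_space M using M by (rule prob_measuresD)
  show "M \<bind> K \<in> prob_measures"
    using prob_space_bind'[OF _ K'] M sets_bind'[OF _ K'] by (simp add: space_prob_algebra)
  show ?eq using M.measure_bind[OF K'' A] .
qed

text \<open>\<open>gibbs_measures\<close> gives the DLR equation for
  \<open>\<gamma> \<Lambda>\<close> on cylinders over \<open>\<Lambda>\<close> itself. The mixture
  agrees with \<open>\<mu>\<close> on events in \<open>\<Lambda>\<close> and, by consistency, is
  preserved by every \<open>\<gamma> \<Delta>\<close> with \<open>\<Delta>\<close> inside
  \<open>\<Lambda>\<close>, so conditioning arguments within \<open>\<Lambda>\<close> are carried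
  out under it.\<close>

definition mix :: "'d site set \<Rightarrow> ('d, 'q) config measure" where
  "mix \<Lambda> = \<mu> \<bind> \<gamma> \<Lambda>"

lemma mix_prob: "\<Lambda> \<in> regions \<Longrightarrow> mix \<Lambda> \<in> prob_measures"
  unfolding mix_def by (rule bind_measure(2)[OF mu_prob kernel_borel, where A = "{}"]) auto

lemma mix_measure:
  "\<Lambda> \<in> regions \<Longrightarrow> A \<in> sets borel \<Longrightarrow> measure (mix \<Lambda>) A = (\<integral>\<omega>. measure (\<gamma> \<Lambda> \<omega>) A \<partial>\<mu>)"
  unfolding mix_def by (rule bind_measure(1)[OF mu_prob kernel_borel])

lemma mix_cyl: "\<Lambda> \<in> regions \<Longrightarrow> measure (mix \<Lambda>) (cyl \<Lambda> \<eta>) = measure \<mu> (cyl \<Lambda> \<eta>)"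
  using gibbs by (simp add: mix_measure gibbs_measures_def)

text \<open>Each cell of the partition over \<open>\<Lambda>\<close> is either contained in
  \<open>cyl B \<eta>\<close> or disjoint from it, so equality on cells can be summed.\<close>

lemma mix_cyl_subset:
  assumes "\<Lambda> \<in> regions" "B \<subseteq> \<Lambda>"
  shows "measure (mix \<Lambda>) (cyl B \<eta>) = measure \<mu> (cyl B \<eta>)"
proof -
  have *: "measure (mix \<Lambda>) (cyl B \<eta> \<inter> cyl \<Lambda> \<zeta>) = measure \<mu> (cyl B \<eta> \<inter> cyl \<Lambda> \<zeta>)" for \<zeta>
  proof -
    have sub: "cyl \<Lambda> \<zeta> \<subseteq> cyl B \<zeta>" by (rule cyl_mono) (rule assms(2))
    show ?thesis
    proof (cases "\<zeta> \<in> cyl B \<eta>")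
      case True
      then have "cyl B \<eta> \<inter> cyl \<Lambda> \<zeta> = cyl \<Lambda> \<zeta>" using sub cyl_cong[OF True] by blast
      then show ?thesis by (simp only: mix_cyl[OF assms(1)])
    next
      case False
      have "cyl B \<eta> \<inter> cyl \<Lambda> \<zeta> = {}"
      proof (rule equals0I)
        fix \<omega> assume "\<omega> \<in> cyl B \<eta> \<inter> cyl \<Lambda> \<zeta>"
        then have "\<forall>x\<in>B. \<zeta> x = \<eta> x" using assms(2) by (metis IntE in_cyl subsetD)
        then show False using False by (simp add: in_cyl)
      qed
      then show ?thesis by simp
    qed
  qed
  have fin: "finite \<Lambda>" using assms(1) by (simp add: regions_def)
  have "measure (mix \<Lambda>) (cyl B \<eta>) = (\<Sum>\<zeta>\<in>patterns \<Lambda>. measure (mix \<Lambda>) (cyl B \<eta> \<inter> cyl \<Lambda> \<zeta>))"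
    using sum_measure_patterns[OF mix_prob[OF assms(1)] fin, of "cyl B \<eta>"] by simp
  also have "\<dots> = (\<Sum>\<zeta>\<in>patterns \<Lambda>. measure \<mu> (cyl B \<eta> \<inter> cyl \<Lambda> \<zeta>))"
    by (simp only: *)
  also have "\<dots> = measure \<mu> (cyl B \<eta>)"
    using sum_measure_patterns[OF mu_prob fin, of "cyl B \<eta>"] by simp
  finally show ?thesis .
qed

lemma mix_kernel:
  assumes "\<Lambda> \<in> regions" "\<Delta> \<in> regions" "\<Delta> \<subseteq> \<Lambda>" "A \<in> sets borel"
  shows "measure (mix \<Lambda>) A = (\<integral>\<omega>. measure (\<gamma> \<Delta> \<omega>) A \<partial>mix \<Lambda>)"
proof -
  have *: "\<gamma> \<Lambda> \<eta> \<bind> \<gamma> \<Delta> = \<gamma> \<Lambda> \<eta>" for \<eta> using spec assms unfolding is_specification_def by auto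
  have s: "sets \<mu> = sets borel" using prob_measuresD[OF mu_prob] by simp
  have K: "\<gamma> \<Lambda> \<in> measurable \<mu> (subprob_algebra borel)"
    by (subst measurable_cong_sets[OF s refl]) (rule measurable_prob_algebraD[OF kernel_borel[OF assms(1)]])
  have "mix \<Lambda> \<bind> \<gamma> \<Delta> = \<mu> \<bind> (\<lambda>\<eta>. \<gamma> \<Lambda> \<eta> \<bind> \<gamma> \<Delta>)"
    unfolding mix_def
    by (rule bind_assoc[OF K measurable_prob_algebraD[OF kernel_borel[OF assms(2)]]])
  then have "mix \<Lambda> \<bind> \<gamma> \<Delta> = mix \<Lambda>" by (simp add: * mix_def)
  then show ?thesis
    using bind_measure(1)[OF mix_prob[OF assms(1)] kernel_borel[OF assms(2)] assms(4)] by simp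
qed

text \<open>Non-nullness speaks of the origin and of the spin of the boundary configuration itself.
  Translation moves it to \<open>x\<close>; since the kernel ignores the boundary spin at
  \<open>x\<close>, that spin can be set to any target.\<close>

lemma single_site_lower_bound:
  obtains \<delta> where "0 < \<delta>" "\<delta> < 1" "\<And>x \<omega> \<eta>. \<delta> \<le> measure (\<gamma> {x} \<omega>) (cyl {x} \<eta>)"
proof -
  obtain \<delta> where \<delta>: "\<delta> > 0" "\<delta> \<le> (INF \<eta>. measure (\<gamma> {0} \<eta>) (cyl {0} \<eta>))"
    using nonnull by (auto simp: non_null_def)
  have r: "{x} \<in> regions" for x :: "'d site" by (simp add: regions_def)
  have 0: "\<delta> \<le> measure (\<gamma> {0} \<eta>) (cyl {0} \<eta>)" for \<eta>
    by (rule order_trans[OF \<delta>(2)]) (auto intro!: cINF_lower bdd_belowI[of _ 0])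
  have *: "\<delta> \<le> measure (\<gamma> {x} \<eta>) (cyl {x} \<eta>)" for x \<eta>
  proof -
    have "translate x {0} = {x}" by (simp add: translate_def)
    moreover have "shift x (shift (- x) \<eta>) = \<eta>" by (simp add: shift_def)
    ultimately have "measure (\<gamma> {x} \<eta>) (cyl {x} \<eta>) = measure (\<gamma> {0} (shift (- x) \<eta>)) (cyl {0} (shift (- x) \<eta>))"
      using spec_inv r unfolding spec_translation_invariant_def by metis
    then show ?thesis using 0 by simp
  qed
  \<comment> \<open>The cap \<open>1/2\<close> makes the bound strictly less than 1, so its
    logarithm is negative.\<close>
  have "min \<delta> (1/2) \<le> measure (\<gamma> {x} \<omega>) (cyl {x} \<eta>)" for x \<omega> \<eta>
  proof -
    define \<omega>' where "\<omega>' = fun_upd \<omega> x (\<eta> x)"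
    have "measure (\<gamma> {x} \<omega>') (cyl {x} \<eta>) = measure (\<gamma> {x} \<omega>) (cyl {x} \<eta>)"
      by (rule kernel_local[OF r]) (auto simp: in_cyl \<omega>'_def)
    moreover have "cyl {x} \<omega>' = cyl {x} \<eta>" by (auto simp: cyl_def \<omega>'_def)
    ultimately show ?thesis using *[of x \<omega>'] by simp
  qed
  then show ?thesis using \<delta> that[of "min \<delta> (1/2)"] by simp
qed

definition site_bound :: real where
  "site_bound = (SOME \<delta>. 0 < \<delta> \<and> \<delta> < 1 \<and> (\<forall>x \<omega> \<eta>. \<delta> \<le> measure (\<gamma> {x} \<omega>) (cyl {x} \<eta>)))"

lemma site_bound: "0 < site_bound" "site_bound < 1" "site_bound \<le> measure (\<gamma> {x} \<omega>) (cyl {x} \<eta>)"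
proof -
  have "\<exists>\<delta>. 0 < \<delta> \<and> \<delta> < 1 \<and> (\<forall>x \<omega> \<eta>. \<delta> \<le> measure (\<gamma> {x} \<omega>) (cyl {x} \<eta>))"
    using single_site_lower_bound by metis
  from someI_ex[OF this]
  show "0 < site_bound" "site_bound < 1" "site_bound \<le> measure (\<gamma> {x} \<omega>) (cyl {x} \<eta>)"
    unfolding site_bound_def by auto
qed

text \<open>On \<open>cyl A \<eta>\<close> the single-site kernel at \<open>x\<close> gives
  \<open>cyl {x} \<eta>\<close> mass at least \<open>site_bound\<close>; integrating this under
  \<open>mix (insert x A)\<close> yields the inequality for \<open>\<mu>\<close>.\<close>

lemma mu_insert:
  assumes "finite A" "x \<notin> A"
  shows "site_bound * measure \<mu> (cyl A \<eta>) \<le> measure \<mu> (cyl (insert x A) \<eta>)"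
proof -
  let ?L = "insert x A"
  have r: "?L \<in> regions" "{x} \<in> regions" using assms by (auto simp: regions_def)
  interpret M: prob_space "mix ?L" using mix_prob[OF r(1)] by (rule prob_measuresD)
  have eq: "measure (\<gamma> {x} \<omega>) (cyl ?L \<eta>) = measure (\<gamma> {x} \<omega>) (cyl {x} \<eta>) * indicator (cyl A \<eta>) \<omega>" for \<omega>
    using kernel_proper[OF r(2), of ?L \<omega> \<eta>] assms by simp
  have "site_bound * measure \<mu> (cyl A \<eta>) = (\<integral>\<omega>. site_bound * indicator (cyl A \<eta>) \<omega> \<partial>mix ?L)"
    by (subst integral_scaled_indicator[OF mix_prob[OF r(1)]]) (auto simp: mix_cyl_subset[OF r(1) subset_insertI])
  also have "\<dots> \<le> (\<integral>\<omega>. measure (\<gamma> {x} \<omega>) (cyl ?L \<eta>) \<partial>mix ?L)"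
  proof (rule integral_mono)
    have pr: "prob_space (\<gamma> {x} \<omega>)" for \<omega> using kernel_prob[OF r(2)] by (rule prob_measuresD)
    show "integrable (mix ?L) (\<lambda>\<omega>. measure (\<gamma> {x} \<omega>) (cyl ?L \<eta>))"
      by (rule integrable_bounded[OF mix_prob[OF r(1)], of _ 1])
         (auto intro: kernel_measurable[OF r(2)] simp: prob_space.prob_le_1[OF pr])
    show "integrable (mix ?L) (\<lambda>\<omega>. site_bound * indicator (cyl A \<eta>) \<omega>)"
      by (rule integrable_scaled_indicator[OF mix_prob[OF r(1)]]) simp
    show "site_bound * indicator (cyl A \<eta>) \<omega> \<le> measure (\<gamma> {x} \<omega>) (cyl ?L \<eta>)" for \<omega>
      unfolding eq using site_bound(3) by (intro mult_right_mono) auto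
  qed
  also have "\<dots> = measure (mix ?L) (cyl ?L \<eta>)"
    using mix_kernel[OF r(1) r(2), of "cyl ?L \<eta>"] by simp
  also have "\<dots> = measure \<mu> (cyl ?L \<eta>)" by (rule mix_cyl[OF r(1)])
  finally show ?thesis .
qed

text \<open>Sites are added one at a time; for a site already present the factor
  \<open>site_bound\<close>, being below 1, only weakens the claim.\<close>

lemma mu_union:
  assumes "finite A" "finite B"
  shows "site_bound ^ card B * measure \<mu> (cyl A \<eta>) \<le> measure \<mu> (cyl (A \<union> B) \<eta>)"
  using assms(2)
proof (induction B)
  case (insert x B)
  have m: "site_bound * measure \<mu> (cyl (A \<union> B) \<eta>) \<le> measure \<mu> (cyl (insert x (A \<union> B)) \<eta>)"
  proof (cases "x \<in> A \<union> B")
    case True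
    then have "insert x (A \<union> B) = A \<union> B" by auto
    then show ?thesis using site_bound by (auto intro: mult_left_le_one_le)
  next
    case False
    then show ?thesis using insert assms by (intro mu_insert) auto
  qed
  have "site_bound ^ card (insert x B) * measure \<mu> (cyl A \<eta>) = site_bound * (site_bound ^ card B * measure \<mu> (cyl A \<eta>))"
    using insert by simp
  also have "\<dots> \<le> site_bound * measure \<mu> (cyl (A \<union> B) \<eta>)"
    using insert site_bound by (intro mult_left_mono) auto
  finally show ?case using m by simp
qed simp

lemma mu_lower: "finite A \<Longrightarrow> site_bound ^ card A \<le> measure \<mu> (cyl A \<eta>)"
  using mu_union[of "{}" A \<eta>] prob_space prob_measuresD(3)[OF mu_prob] by (simp add: cyl_def)

lemma mu_pos: "finite A \<Longrightarrow> 0 < measure \<mu> (cyl A \<eta>)"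
  using mu_lower[of A \<eta>] site_bound(1) by (meson less_le_trans zero_less_power)

lemma mu_le_1: "measure \<mu> A \<le> 1" by simp

text \<open>The \<open>\<mu>\<close>-conditional probability of the spins of \<open>\<eta>\<close>
  in \<open>\<Lambda> \<inter> \<Delta>\<close>, given those in the rest of
  \<open>\<Lambda>\<close>.\<close>

definition ratio :: "'d site set \<Rightarrow> 'd site set \<Rightarrow> ('d, 'q) config \<Rightarrow> real" where
  "ratio \<Delta> \<Lambda> \<eta> = measure \<mu> (cyl \<Lambda> \<eta>) / measure \<mu> (cyl (\<Lambda> - \<Delta>) \<eta>)"

lemma ratio_bounds:
  assumes "finite \<Lambda>" "finite \<Delta>"
  shows "site_bound ^ card \<Delta> \<le> ratio \<Delta> \<Lambda> \<eta>" "ratio \<Delta> \<Lambda> \<eta> \<le> 1"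
proof -
  have p: "0 < measure \<mu> (cyl (\<Lambda> - \<Delta>) \<eta>)" using assms by (intro mu_pos) auto
  have "site_bound ^ card \<Delta> \<le> site_bound ^ card (\<Lambda> \<inter> \<Delta>)"
    using site_bound assms by (intro power_decreasing card_mono) auto
  then have "site_bound ^ card \<Delta> * measure \<mu> (cyl (\<Lambda> - \<Delta>) \<eta>) \<le> site_bound ^ card (\<Lambda> \<inter> \<Delta>) * measure \<mu> (cyl (\<Lambda> - \<Delta>) \<eta>)"
    by (intro mult_right_mono) auto
  also have "\<dots> \<le> measure \<mu> (cyl ((\<Lambda> - \<Delta>) \<union> (\<Lambda> \<inter> \<Delta>)) \<eta>)"
    using assms by (intro mu_union) auto
  also have "(\<Lambda> - \<Delta>) \<union> (\<Lambda> \<inter> \<Delta>) = \<Lambda>" by auto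
  finally show "site_bound ^ card \<Delta> \<le> ratio \<Delta> \<Lambda> \<eta>" using p by (simp add: ratio_def field_simps)
  have "measure \<mu> (cyl \<Lambda> \<eta>) \<le> measure \<mu> (cyl (\<Lambda> - \<Delta>) \<eta>)"
    using prob_measuresD(2)[OF mu_prob] by (intro finite_measure_mono cyl_mono) auto
  then show "ratio \<Delta> \<Lambda> \<eta> \<le> 1" using p by (simp add: ratio_def)
qed

text \<open>Quasilocality restated for arbitrary \<open>\<omega>\<close>: a configuration that
  agrees with \<open>\<eta>\<close> on \<open>\<Lambda> - \<Delta>\<close> is unchanged when
  overwritten there by \<open>\<eta>\<close>.\<close>

lemma quasilocal_uniform:
  assumes \<Delta>: "\<Delta> \<in> regions" and e: "e > 0"
  obtains B where "finite B" "\<And>\<Lambda> \<omega> \<eta>. finite \<Lambda> \<Longrightarrow> B \<subseteq> \<Lambda> \<Longrightarrow> \<omega> \<in> cyl (\<Lambda> - \<Delta>) \<eta> \<Longrightarrow>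
     \<bar>measure (\<gamma> \<Delta> \<omega>) (cyl \<Delta> \<eta>) - measure (\<gamma> \<Delta> \<eta>) (cyl \<Delta> \<eta>)\<bar> \<le> e"
proof -
  define D where "D \<Lambda> \<eta> \<xi> =
    \<bar>measure (\<gamma> \<Delta> (override_on \<xi> \<eta> (\<Lambda> - \<Delta>))) (cyl \<Delta> \<eta>) - measure (\<gamma> \<Delta> \<eta>) (cyl \<Delta> \<eta>)\<bar>" for \<Lambda> and \<eta> \<xi> :: "('d, 'q) config"
  have pr: "prob_space (\<gamma> \<Delta> \<omega>)" for \<omega> using kernel_prob[OF \<Delta>] by (rule prob_measuresD)
  \<comment> \<open>Real suprema dominate their members only for families bounded above; this bound
    makes both suprema below usable.\<close>
  have D1: "D \<Lambda> \<eta> \<xi> \<le> 1" for \<Lambda> \<eta> \<xi>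
    unfolding D_def using prob_space.prob_le_1[OF pr]
    by (smt (verit) measure_nonneg)
  have "((\<lambda>\<Lambda>. SUP \<eta>. SUP \<xi>. D \<Lambda> \<eta> \<xi>) \<longlongrightarrow> 0) (finite_subsets_at_top UNIV)"
    using quasi \<Delta> unfolding quasilocal_def D_def by auto
  then have "\<forall>\<^sub>F \<Lambda> in finite_subsets_at_top UNIV. (SUP \<eta>. SUP \<xi>. D \<Lambda> \<eta> \<xi>) < e"
    using e by (rule order_tendstoD)
  then obtain B where B: "finite B" "\<And>\<Lambda>. finite \<Lambda> \<Longrightarrow> B \<subseteq> \<Lambda> \<Longrightarrow> (SUP \<eta>. SUP \<xi>. D \<Lambda> \<eta> \<xi>) < e"
    unfolding eventually_finite_subsets_at_top by auto
  show ?thesis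
  proof (rule that[OF B(1)])
    fix \<Lambda> and \<omega> \<eta> :: "('d, 'q) config" assume L: "finite \<Lambda>" "B \<subseteq> \<Lambda>" "\<omega> \<in> cyl (\<Lambda> - \<Delta>) \<eta>"
    have "override_on \<omega> \<eta> (\<Lambda> - \<Delta>) = \<omega>"
      using L(3) by (auto simp: override_on_def in_cyl)
    then have "\<bar>measure (\<gamma> \<Delta> \<omega>) (cyl \<Delta> \<eta>) - measure (\<gamma> \<Delta> \<eta>) (cyl \<Delta> \<eta>)\<bar> = D \<Lambda> \<eta> \<omega>"
      by (simp add: D_def)
    also have "\<dots> \<le> (SUP \<xi>. D \<Lambda> \<eta> \<xi>)"
      by (intro cSUP_upper bdd_aboveI2[of _ _ 1] D1) auto
    also have "\<dots> \<le> (SUP \<eta>. SUP \<xi>. D \<Lambda> \<eta> \<xi>)"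
      by (rule cSUP_upper[where f = "\<lambda>\<eta>. SUP \<xi>. D \<Lambda> \<eta> \<xi>"])
         (auto intro!: bdd_aboveI2[of _ _ 1] cSUP_least D1)
    also have "\<dots> \<le> e" using B(2)[OF L(1,2)] by simp
    finally show "\<bar>measure (\<gamma> \<Delta> \<omega>) (cyl \<Delta> \<eta>) - measure (\<gamma> \<Delta> \<eta>) (cyl \<Delta> \<eta>)\<bar> \<le> e" .
  qed
qed

text \<open>By properness the ratio is the average, under \<open>mix \<Lambda>\<close>, of the
  kernel probability over \<open>cyl (\<Lambda> - \<Delta>) \<eta>\<close>; an average of values
  within \<open>e\<close> of \<open>k\<close> is within \<open>e\<close> of
  \<open>k\<close>.\<close>

lemma ratio_near_kernel:
  assumes \<Delta>: "\<Delta> \<in> regions" and \<Lambda>: "finite \<Lambda>" "\<Delta> \<subseteq> \<Lambda>" and e: "0 \<le> e"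
    and near: "\<And>\<omega>. \<omega> \<in> cyl (\<Lambda> - \<Delta>) \<eta> \<Longrightarrow>
      \<bar>measure (\<gamma> \<Delta> \<omega>) (cyl \<Delta> \<eta>) - k\<bar> \<le> e"
  shows "\<bar>ratio \<Delta> \<Lambda> \<eta> - k\<bar> \<le> e"
proof -
  have r: "\<Lambda> \<in> regions" using \<Delta> \<Lambda> by (auto simp: regions_def)
  let ?M = "mix \<Lambda>" and ?C = "cyl (\<Lambda> - \<Delta>) \<eta>"
  interpret M: prob_space ?M using mix_prob[OF r] by (rule prob_measuresD)
  have pr: "prob_space (\<gamma> \<Delta> \<omega>)" for \<omega> using kernel_prob[OF \<Delta>] by (rule prob_measuresD)
  have p: "0 < measure \<mu> ?C" using \<Lambda> by (intro mu_pos) auto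
  have i1: "integrable ?M (\<lambda>\<omega>. measure (\<gamma> \<Delta> \<omega>) (cyl \<Delta> \<eta>) * indicator ?C \<omega>)"
    by (rule integrable_bounded[OF mix_prob[OF r], of _ 1])
       (auto intro!: borel_measurable_times kernel_measurable[OF \<Delta>] mult_le_one simp: prob_space.prob_le_1[OF pr])
  have i2: "integrable ?M (\<lambda>\<omega>. a * indicator ?C \<omega>)" for a :: real
    by (rule integrable_scaled_indicator[OF mix_prob[OF r]]) simp
  have C: "(\<integral>\<omega>. a * indicator ?C \<omega> \<partial>?M) = a * measure \<mu> ?C" for a :: real
    by (subst integral_scaled_indicator[OF mix_prob[OF r]]) (auto simp: mix_cyl_subset[OF r])
  have "measure \<mu> (cyl \<Lambda> \<eta>) = (\<integral>\<omega>. measure (\<gamma> \<Delta> \<omega>) (cyl \<Lambda> \<eta>) \<partial>?M)"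
    using mix_kernel[OF r \<Delta> \<Lambda>(2), of "cyl \<Lambda> \<eta>"] mix_cyl[OF r] by simp
  also have "\<dots> = (\<integral>\<omega>. measure (\<gamma> \<Delta> \<omega>) (cyl \<Delta> \<eta>) * indicator ?C \<omega> \<partial>?M)"
    by (simp add: kernel_proper[OF \<Delta> \<Lambda>])
  finally have eq: "measure \<mu> (cyl \<Lambda> \<eta>) = \<dots>" .
  have "measure \<mu> (cyl \<Lambda> \<eta>) \<le> (\<integral>\<omega>. (k + e) * indicator ?C \<omega> \<partial>?M)"
    unfolding eq using near by (intro integral_mono i1 i2) (fastforce simp: indicator_def abs_le_iff)
  moreover have "(\<integral>\<omega>. (k - e) * indicator ?C \<omega> \<partial>?M) \<le> measure \<mu> (cyl \<Lambda> \<eta>)"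
    unfolding eq using near by (intro integral_mono i1 i2) (fastforce simp: indicator_def abs_le_iff)
  ultimately show ?thesis
    unfolding C ratio_def using p by (simp add: abs_le_iff field_simps)
qed

text \<open>The energy cost in volume \<open>\<Lambda>\<close> of overwriting
  \<open>\<Delta>\<close> by \<open>\<xi>\<close>, with \<open>- ln\<close> of a
  \<open>\<mu>\<close>-probability in the role of an energy.\<close>

definition log_ratio :: "'d site set \<Rightarrow> 'd site set \<Rightarrow> ('d, 'q) config \<Rightarrow> ('d, 'q) config \<Rightarrow> real" where
  "log_ratio \<Delta> \<Lambda> \<xi> \<omega> = ln (measure \<mu> (cyl \<Lambda> \<omega>)) - ln (measure \<mu> (cyl \<Lambda> (override_on \<omega> \<xi> \<Delta>)))"

text \<open>The transition does not touch \<open>\<Lambda> - \<Delta>\<close>, so both conditional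
  probabilities have the same denominator and it cancels. What remains is controlled independently
  of the size of \<open>\<Lambda>\<close>.\<close>

lemma log_ratio_eq:
  assumes "finite \<Lambda>"
  shows "log_ratio \<Delta> \<Lambda> \<xi> \<omega> = ln (ratio \<Delta> \<Lambda> \<omega>) - ln (ratio \<Delta> \<Lambda> (override_on \<omega> \<xi> \<Delta>))"
proof -
  have "cyl (\<Lambda> - \<Delta>) (override_on \<omega> \<xi> \<Delta>) = cyl (\<Lambda> - \<Delta>) \<omega>" by (auto simp: cyl_def)
  moreover have "measure \<mu> (cyl A \<eta>) \<noteq> 0" if "finite A" for A \<eta> using mu_pos[OF that, of \<eta>] by simp
  ultimately show ?thesis using assms by (simp add: log_ratio_def ratio_def ln_div mu_pos)
qed

lemma log_ratio_bound:
  assumes "finite \<Lambda>" "finite \<Delta>"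
  shows "\<bar>log_ratio \<Delta> \<Lambda> \<xi> \<omega>\<bar> \<le> - real (card \<Delta>) * ln site_bound"
proof -
  have b: "real (card \<Delta>) * ln site_bound \<le> ln (ratio \<Delta> \<Lambda> \<eta>) \<and> ln (ratio \<Delta> \<Lambda> \<eta>) \<le> 0" for \<eta>
  proof -
    have p: "0 < site_bound ^ card \<Delta>" using site_bound by simp
    have "ln (site_bound ^ card \<Delta>) \<le> ln (ratio \<Delta> \<Lambda> \<eta>)"
      using ratio_bounds[OF assms, of \<eta>] p by simp
    moreover have "ln (ratio \<Delta> \<Lambda> \<eta>) \<le> ln 1"
      using ratio_bounds[OF assms, of \<eta>] p by (subst ln_le_cancel_iff) auto
    ultimately show ?thesis using site_bound by (simp add: ln_realpow)
  qed
  show ?thesis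
    using b[of \<omega>] b[of "override_on \<omega> \<xi> \<Delta>"] unfolding log_ratio_eq[OF assms(1)] by (auto simp: abs_le_iff)
qed

text \<open>For large volumes every ratio is close to the same kernel probability, and the logarithm
  is Lipschitz on ratios bounded away from 0. Quasilocality thus becomes a Cauchy property, uniform
  in the configuration.\<close>

lemma log_ratio_limit:
  assumes \<Delta>: "\<Delta> \<in> regions" and u: "u > 0"
  obtains B where "finite B" "\<And>\<Lambda> \<Lambda>' \<xi> \<omega>. finite \<Lambda> \<Longrightarrow> finite \<Lambda>' \<Longrightarrow> B \<subseteq> \<Lambda> \<Longrightarrow> B \<subseteq> \<Lambda>' \<Longrightarrow>
     \<bar>log_ratio \<Delta> \<Lambda> \<xi> \<omega> - log_ratio \<Delta> \<Lambda>' \<xi> \<omega>\<bar> \<le> u"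
proof -
  define m where "m = site_bound ^ card \<Delta>"
  have m: "m > 0" using site_bound by (simp add: m_def)
  \<comment> \<open>Two ratios within \<open>e\<close> of the kernel differ by at most
    \<open>2 * e\<close>, their logarithms by \<open>2 * e / m = u / 2\<close>; two such logarithms
    enter \<open>log_ratio\<close>.\<close>
  define e where "e = u * m / 4"
  have e: "e > 0" using u m by (simp add: e_def)
  have fin: "finite \<Delta>" using \<Delta> by (simp add: regions_def)
  obtain B where B: "finite B" "\<And>\<Lambda> \<omega> \<eta>. finite \<Lambda> \<Longrightarrow> B \<subseteq> \<Lambda> \<Longrightarrow> \<omega> \<in> cyl (\<Lambda> - \<Delta>) \<eta> \<Longrightarrow>
     \<bar>measure (\<gamma> \<Delta> \<omega>) (cyl \<Delta> \<eta>) - measure (\<gamma> \<Delta> \<eta>) (cyl \<Delta> \<eta>)\<bar> \<le> e"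
    by (rule quasilocal_uniform[OF \<Delta> e]) blast
  have r: "\<bar>ratio \<Delta> \<Lambda> \<eta> - measure (\<gamma> \<Delta> \<eta>) (cyl \<Delta> \<eta>)\<bar> \<le> e"
    if "finite \<Lambda>" "B \<union> \<Delta> \<subseteq> \<Lambda>" for \<Lambda> \<eta>
    using that e by (intro ratio_near_kernel[OF \<Delta>] B(2)) auto
  have l: "\<bar>ln (ratio \<Delta> \<Lambda> \<eta>) - ln (ratio \<Delta> \<Lambda>' \<eta>)\<bar> \<le> u / 2"
    if "finite \<Lambda>" "B \<union> \<Delta> \<subseteq> \<Lambda>" "finite \<Lambda>'" "B \<union> \<Delta> \<subseteq> \<Lambda>'" for \<Lambda> \<Lambda>' \<eta>
  proof -
    have "\<bar>ln (ratio \<Delta> \<Lambda> \<eta>) - ln (ratio \<Delta> \<Lambda>' \<eta>)\<bar> \<le> \<bar>ratio \<Delta> \<Lambda> \<eta> - ratio \<Delta> \<Lambda>' \<eta>\<bar> / m"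
      using ratio_bounds(1)[OF _ fin] that m unfolding m_def by (intro abs_ln_diff_le) auto
    also have "\<dots> \<le> (2 * e) / m"
      using r[OF that(1,2), of \<eta>] r[OF that(3,4), of \<eta>] m by (intro divide_right_mono) linarith+
    also have "\<dots> = u / 2" using m by (simp add: e_def)
    finally show ?thesis .
  qed
  show ?thesis
  proof (rule that[of "B \<union> \<Delta>"])
    fix \<Lambda> \<Lambda>' \<xi> \<omega> assume L: "finite \<Lambda>" "finite \<Lambda>'" "B \<union> \<Delta> \<subseteq> \<Lambda>" "B \<union> \<Delta> \<subseteq> \<Lambda>'"
    show "\<bar>log_ratio \<Delta> \<Lambda> \<xi> \<omega> - log_ratio \<Delta> \<Lambda>' \<xi> \<omega>\<bar> \<le> u"
      using l[OF L(1,3,2,4), of \<omega>] l[OF L(1,3,2,4), of "override_on \<omega> \<xi> \<Delta>"]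
      unfolding log_ratio_eq[OF L(1)] log_ratio_eq[OF L(2)] by linarith
  qed (use B fin in auto)
qed

end

section \<open>Translation-invariant rates\<close>

lemma in_translate: "x \<in> translate i \<Lambda> \<longleftrightarrow> x - i \<in> \<Lambda>"
proof
  assume "x - i \<in> \<Lambda>"
  then show "x \<in> translate i \<Lambda>" unfolding translate_def by (intro image_eqI[of _ _ "x - i"]) auto
qed (auto simp: translate_def)

lemma translate_0 [simp]: "translate 0 \<Lambda> = \<Lambda>"
  by (auto simp: in_translate)

lemma translate_translate [simp]: "translate i (translate j \<Lambda>) = translate (i + j) \<Lambda>"
  by (auto simp: in_translate algebra_simps)

lemma finite_translate [simp]: "finite (translate i \<Lambda>) \<longleftrightarrow> finite \<Lambda>"
  unfolding translate_def by (rule finite_image_iff) (simp add: inj_on_def)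

lemma card_translate [simp]: "card (translate i \<Lambda>) = card \<Lambda>"
  unfolding translate_def by (rule card_image) (simp add: inj_on_def)

lemma inj_translate: "inj_on (translate j) A"
  by (rule inj_on_inverseI[where g = "translate (- j)"]) simp

lemma translate_regions [simp]: "translate i \<Lambda> \<in> regions \<longleftrightarrow> \<Lambda> \<in> regions"
  by (simp add: regions_def) (simp add: translate_def)

lemma shift_0 [simp]: "shift 0 \<eta> = \<eta>"
  by (simp add: shift_def)

lemma shift_shift [simp]: "shift i (shift j \<eta>) = shift (i + j) \<eta>"
  by (simp add: shift_def fun_eq_iff algebra_simps)

lemma override_on_shift:
  "override_on (shift i \<eta>) (shift i \<xi>) (translate i \<Delta>) = shift i (override_on \<eta> \<xi> \<Delta>)"
  by (auto simp: override_on_def shift_def fun_eq_iff in_translate)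

lemma shift_in_cyl: "shift i \<omega> \<in> cyl (translate i \<Lambda>) (shift i \<eta>) \<longleftrightarrow> \<omega> \<in> cyl \<Lambda> \<eta>"
proof
  assume *: "shift i \<omega> \<in> cyl (translate i \<Lambda>) (shift i \<eta>)"
  show "\<omega> \<in> cyl \<Lambda> \<eta>"
    unfolding in_cyl
  proof
    fix x assume "x \<in> \<Lambda>"
    then have "x + i \<in> translate i \<Lambda>" by (simp add: in_translate)
    with * show "\<omega> x = \<eta> x" by (force simp: in_cyl shift_def)
  qed
qed (auto simp: in_cyl shift_def in_translate)

lemma shift_pattern: "\<xi> \<in> patterns \<Delta> \<Longrightarrow> shift i \<xi> \<in> patterns (translate i \<Delta>)"
  by (auto simp: patterns_def shift_def in_translate PiE_iff extensional_def)

lemma bij_betw_shift_patterns: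
  "bij_betw (shift i) (patterns \<Delta>) (patterns (translate i \<Delta>))"
proof (rule bij_betwI[where g = "shift (- i)"])
  show "shift (- i) \<in> patterns (translate i \<Delta>) \<rightarrow> patterns \<Delta>"
    using shift_pattern[of _ "translate i \<Delta>" "- i"] by (intro funcsetI) simp
qed (use shift_pattern in auto)

lemma restrict_shift: "restrict (shift i \<eta>) (translate i \<Delta>) = shift i (restrict \<eta> \<Delta>)"
  by (auto simp: restrict_def shift_def fun_eq_iff in_translate)

lemma continuous_on_shift: "continuous_on UNIV (shift i :: ('d::finite, 'q) config \<Rightarrow> _)"
  unfolding shift_def by (intro continuous_on_coordinatewise_then_product continuous_on_product_coordinates)

lemma continuous_on_override:
  "continuous_on UNIV (\<lambda>\<omega> :: ('d::finite, 'q) config. override_on \<omega> \<xi> \<Delta>)"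
proof (rule continuous_on_coordinatewise_then_product)
  fix x show "continuous_on UNIV (\<lambda>\<omega> :: ('d::finite, 'q) config. override_on \<omega> \<xi> \<Delta> x)"
    by (cases "x \<in> \<Delta>") (simp_all add: continuous_on_product_coordinates)
qed

lemma invariant_prob: "\<nu> \<in> invariant_measures \<Longrightarrow> \<nu> \<in> prob_measures"
  by (simp add: invariant_measures_def)

lemma integral_shift:
  fixes f :: "('d::finite, 'q::finite) config \<Rightarrow> real"
  assumes "\<nu> \<in> invariant_measures" "f \<in> borel_measurable borel"
  shows "(\<integral>\<omega>. f (shift i \<omega>) \<partial>\<nu>) = (\<integral>\<omega>. f \<omega> \<partial>\<nu>)"
proof -
  have s: "sets \<nu> = sets borel" by (rule prob_measuresD[OF invariant_prob[OF assms(1)]])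
  have m: "shift i \<in> measurable \<nu> borel"
    unfolding measurable_cong_sets[OF s refl] by (rule borel_measurable_continuous_onI[OF continuous_on_shift])
  have "(\<integral>\<omega>. f \<omega> \<partial>distr \<nu> borel (shift i)) = (\<integral>\<omega>. f (shift i \<omega>) \<partial>\<nu>)"
    by (rule integral_distr[OF m assms(2)])
  then show ?thesis using assms(1) by (simp add: invariant_measures_def)
qed

lemma measure_cyl_shift:
  fixes \<nu> :: "('d::finite, 'q::finite) config measure"
  assumes "\<nu> \<in> invariant_measures"
  shows "measure \<nu> (cyl (translate i \<Lambda>) (shift i \<eta>)) = measure \<nu> (cyl \<Lambda> \<eta>)"
proof -
  have s: "sets \<nu> = sets borel" "space \<nu> = UNIV"
    using prob_measuresD[OF invariant_prob[OF assms]] by auto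
  have m: "shift i \<in> measurable \<nu> borel"
    unfolding measurable_cong_sets[OF s(1) refl] by (rule borel_measurable_continuous_onI[OF continuous_on_shift])
  have v: "shift i -` cyl (translate i \<Lambda>) (shift i \<eta>) = cyl \<Lambda> \<eta>"
    using shift_in_cyl by blast
  have "measure \<nu> (cyl (translate i \<Lambda>) (shift i \<eta>)) =
      measure (distr \<nu> borel (shift i)) (cyl (translate i \<Lambda>) (shift i \<eta>))"
    using assms by (simp add: invariant_measures_def)
  also have "\<dots> = measure \<nu> (shift i -` cyl (translate i \<Lambda>) (shift i \<eta>) \<inter> space \<nu>)"
    by (rule measure_distr[OF m]) simp
  finally show ?thesis by (simp only: v s Int_UNIV_right)
qed

section \<open>Rates with finitely many transition types\<close>

locale rates =
  fixes c :: "('d::finite, 'q::finite) rates"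
  assumes rates: "ips_rates c"
    and trans_inv: "rates_translation_invariant c"
    and types: "finitely_many_types c"
    and unif: "uniformly_continuous_rates c"
    and minimal: "positive_minimal_rate c"
begin

text \<open>An inactive region may still carry positive rates, but only for transitions that leave
  the configuration unchanged.\<close>

definition active :: "'d site set set" where
  "active = {\<Delta> \<in> regions. 0 < max_exit_rate c \<Delta>}"

definition active0 :: "'d site set set" where
  "active0 = {\<Delta> \<in> active. 0 \<in> \<Delta>}"

lemma activeD:
  assumes "\<Delta> \<in> active"
  shows "\<Delta> \<in> regions" "finite \<Delta>" "\<Delta> \<noteq> {}" "finite (patterns \<Delta> :: ('d, 'q) config set)"
  using assms by (auto simp: active_def regions_def)

lemma rate_nonneg: "\<Delta> \<in> regions \<Longrightarrow> \<xi> \<in> patterns \<Delta> \<Longrightarrow> 0 \<le> c \<Delta> \<eta> \<xi>"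
  using rates by (simp add: ips_rates_def)

lemma rate_continuous: "\<Delta> \<in> regions \<Longrightarrow> \<xi> \<in> patterns \<Delta> \<Longrightarrow> continuous_on UNIV (\<lambda>\<eta>. c \<Delta> \<eta> \<xi>)"
  using rates by (simp add: ips_rates_def)

lemma rate_shift: "\<Delta> \<in> regions \<Longrightarrow> \<xi> \<in> patterns \<Delta> \<Longrightarrow> c (translate i \<Delta>) (shift i \<eta>) (shift i \<xi>) = c \<Delta> \<eta> \<xi>"
  using trans_inv by (simp add: rates_translation_invariant_def)

lemma inactive_rate:
  assumes "\<Delta> \<in> regions" "\<Delta> \<notin> active" "\<xi> \<in> patterns \<Delta>" "\<xi> \<noteq> restrict \<omega> \<Delta>"
  shows "c \<Delta> \<omega> \<xi> = 0"
proof -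
  have fin: "finite (patterns \<Delta> - {restrict \<omega> \<Delta>})" using assms(1) by (simp add: regions_def)
  have "ennreal (exit_rate c \<Delta> \<omega>) \<le> max_exit_rate c \<Delta>"
    unfolding max_exit_rate_def by (rule SUP_upper) simp
  then have "exit_rate c \<Delta> \<omega> \<le> 0"
    using assms(1,2) by (simp add: active_def ennreal_eq_0_iff)
  moreover have "c \<Delta> \<omega> \<xi> \<le> exit_rate c \<Delta> \<omega>"
    unfolding exit_rate_def using assms rate_nonneg fin
    by (intro member_le_sum[where f = "c \<Delta> \<omega>"]) auto
  ultimately show ?thesis using rate_nonneg[OF assms(1,3), of \<omega>] by linarith
qed

lemma exit_rate_shift:
  assumes "\<Delta> \<in> regions"
  shows "exit_rate c (translate i \<Delta>) (shift i \<eta>) = exit_rate c \<Delta> \<eta>"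
proof -
  have "bij_betw (shift i) (patterns \<Delta> - {restrict \<eta> \<Delta>})
      (patterns (translate i \<Delta>) - {restrict (shift i \<eta>) (translate i \<Delta>)})"
    unfolding restrict_shift
    by (rule bij_betw_DiffI[OF bij_betw_shift_patterns]) (auto simp: bij_betw_def shift_pattern)
  then have "exit_rate c (translate i \<Delta>) (shift i \<eta>) =
      (\<Sum>\<xi>\<in>patterns \<Delta> - {restrict \<eta> \<Delta>}. c (translate i \<Delta>) (shift i \<eta>) (shift i \<xi>))"
    unfolding exit_rate_def by (rule sum.reindex_bij_betw[symmetric])
  also have "\<dots> = exit_rate c \<Delta> \<eta>"
    unfolding exit_rate_def by (intro sum.cong refl rate_shift assms) auto
  finally show ?thesis .
qed

lemma max_exit_rate_le_translate:
  assumes "\<Delta> \<in> regions"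
  shows "max_exit_rate c \<Delta> \<le> max_exit_rate c (translate i \<Delta>)"
  unfolding max_exit_rate_def
proof (rule SUP_least)
  fix \<eta> :: "('d, 'q) config"
  have "ennreal (exit_rate c \<Delta> \<eta>) = ennreal (exit_rate c (translate i \<Delta>) (shift i \<eta>))"
    by (simp add: exit_rate_shift[OF assms])
  also have "\<dots> \<le> (SUP \<eta>. ennreal (exit_rate c (translate i \<Delta>) \<eta>))"
    by (rule SUP_upper) simp
  finally show "ennreal (exit_rate c \<Delta> \<eta>) \<le> (SUP \<eta>. ennreal (exit_rate c (translate i \<Delta>) \<eta>))" .
qed

lemma active_translateI: "\<Delta> \<in> active \<Longrightarrow> translate i \<Delta> \<in> active"
  unfolding active_def using max_exit_rate_le_translate[of \<Delta> i] by (auto intro: less_le_trans)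

lemma active_translate [simp]: "translate i \<Delta> \<in> active \<longleftrightarrow> \<Delta> \<in> active"
  using active_translateI[of "translate i \<Delta>" "- i"] active_translateI[of \<Delta> i] by auto

text \<open>A translate of a finite region contains the origin only if it is shifted by the negative
  of one of its sites, so each type contributes finitely many regions.\<close>

lemma finite_active0: "finite active0"
proof -
  obtain T where T: "finite T" "\<And>\<Delta>. \<Delta> \<in> regions \<Longrightarrow> 0 < max_exit_rate c \<Delta> \<Longrightarrow> \<exists>\<Delta>0\<in>T. \<exists>i. \<Delta> = translate i \<Delta>0"
    using types unfolding finitely_many_types_def by blast
  have "active0 \<subseteq> (\<Union>\<Delta>0\<in>T \<inter> Collect finite. (\<lambda>x. translate (- x) \<Delta>0) ` \<Delta>0)"
  proof
    fix \<Delta> assume "\<Delta> \<in> active0"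
    then have \<Delta>: "\<Delta> \<in> active" "0 \<in> \<Delta>" by (auto simp: active0_def)
    then have "\<exists>\<Delta>0\<in>T. \<exists>i. \<Delta> = translate i \<Delta>0" by (intro T(2)) (auto simp: active_def)
    then obtain \<Delta>0 i where *: "\<Delta>0 \<in> T" "\<Delta> = translate i \<Delta>0" by blast
    have "finite \<Delta>0" using activeD(2)[OF \<Delta>(1)] *(2) by simp
    moreover have "- i \<in> \<Delta>0" using \<Delta>(2) *(2) by (simp add: in_translate)
    then have "\<Delta> \<in> (\<lambda>x. translate (- x) \<Delta>0) ` \<Delta>0" using *(2) by (intro image_eqI[of _ _ "- i"]) auto
    ultimately show "\<Delta> \<in> (\<Union>\<Delta>0\<in>T \<inter> Collect finite. (\<lambda>x. translate (- x) \<Delta>0) ` \<Delta>0)"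
      using *(1) by blast
  qed
  then show ?thesis by (rule finite_subset) (use T(1) in auto)
qed

lemma active_at: "{\<Delta> \<in> active. j \<in> \<Delta>} = translate j ` active0"
proof
  show "{\<Delta> \<in> active. j \<in> \<Delta>} \<subseteq> translate j ` active0"
  proof
    fix \<Delta> assume "\<Delta> \<in> {\<Delta> \<in> active. j \<in> \<Delta>}"
    then have "translate (- j) \<Delta> \<in> active0" by (auto simp: active0_def in_translate)
    then show "\<Delta> \<in> translate j ` active0" by (intro image_eqI[of _ _ "translate (- j) \<Delta>"]) auto
  qed
qed (auto simp: active0_def in_translate)

lemma finite_active_at: "finite {\<Delta> \<in> active. j \<in> \<Delta>}"
  unfolding active_at using finite_active0 by (rule finite_imageI)

text \<open>The regions whose transitions can change a function of the spins in
  \<open>\<Lambda>\<close>; their finiteness makes the generator a finite sum on such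
  functions.\<close>

definition hitting :: "'d site set \<Rightarrow> 'd site set set" where
  "hitting \<Lambda> = {\<Delta> \<in> active. \<Delta> \<inter> \<Lambda> \<noteq> {}}"

lemma finite_hitting: "finite \<Lambda> \<Longrightarrow> finite (hitting \<Lambda>)"
proof -
  assume "finite \<Lambda>"
  moreover have "hitting \<Lambda> = (\<Union>j\<in>\<Lambda>. {\<Delta> \<in> active. j \<in> \<Delta>})" by (auto simp: hitting_def)
  ultimately show ?thesis using finite_active_at by simp
qed

text \<open>Compactness bounds each rate, \<open>active0\<close> with its patterns is a finite
  family, and every active region is a translate of a member of \<open>active0\<close>.\<close>

lemma rate_bound_exists: "\<exists>C\<ge>0. \<forall>\<Delta>\<in>active. \<forall>\<xi>\<in>patterns \<Delta>. \<forall>\<omega>. c \<Delta> \<omega> \<xi> \<le> C"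
proof -
  let ?I = "SIGMA \<Delta>:active0. (patterns \<Delta> :: ('d, 'q) config set)"
  have "\<exists>b. \<forall>\<omega>. c (fst p) \<omega> (snd p) \<le> b" if "p \<in> ?I" for p
  proof -
    have "continuous_on UNIV (\<lambda>\<omega>. c (fst p) \<omega> (snd p))"
      using that by (intro rate_continuous) (auto simp: active0_def active_def)
    then have "bounded (range (\<lambda>\<omega>. c (fst p) \<omega> (snd p)))"
      using continuous_config_bounded by (auto simp: bcontfun_def)
    then show ?thesis unfolding bounded_iff by (auto intro: order_trans[OF abs_ge_self])
  qed
  then obtain b where b: "\<And>p \<omega>. p \<in> ?I \<Longrightarrow> c (fst p) \<omega> (snd p) \<le> b p" by metis
  have fin: "finite ?I" using activeD(4) by (intro finite_SigmaI finite_active0) (simp add: active0_def)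
  define C where "C = (\<Sum>p\<in>?I. \<bar>b p\<bar>)"
  have "c \<Delta> \<omega> \<xi> \<le> C" if \<Delta>: "\<Delta> \<in> active" and \<xi>: "\<xi> \<in> patterns \<Delta>" for \<Delta> \<xi> \<omega>
  proof -
    obtain j where j: "j \<in> \<Delta>" using activeD[OF \<Delta>] by blast
    let ?p = "(translate (- j) \<Delta>, shift (- j) \<xi>)"
    have p: "?p \<in> ?I"
      using \<Delta> j shift_pattern[OF \<xi>, of "- j"] by (auto simp: active0_def in_translate)
    have "c \<Delta> \<omega> \<xi> = c (fst ?p) (shift (- j) \<omega>) (snd ?p)"
      using rate_shift[OF activeD(1)[OF \<Delta>] \<xi>] by simp
    also have "\<dots> \<le> \<bar>b ?p\<bar>" using b[OF p] by (rule order_trans) simp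
    also have "\<dots> \<le> C" unfolding C_def using p fin by (intro member_le_sum) auto
    finally show ?thesis .
  qed
  moreover have "C \<ge> 0" unfolding C_def by (intro sum_nonneg) simp
  ultimately show ?thesis by blast
qed

definition rate_bound :: real where
  "rate_bound = (SOME C. C \<ge> 0 \<and> (\<forall>\<Delta>\<in>active. \<forall>\<xi>\<in>patterns \<Delta>. \<forall>\<omega>. c \<Delta> \<omega> \<xi> \<le> C))"

lemma rate_bound: "0 \<le> rate_bound" "\<Delta> \<in> active \<Longrightarrow> \<xi> \<in> patterns \<Delta> \<Longrightarrow> c \<Delta> \<omega> \<xi> \<le> rate_bound"
  using someI_ex[OF rate_bound_exists] unfolding rate_bound_def by blast+

text \<open>The gap below positive rates turns the uniform bound on differences of rates into a bound on
  quotients, which holds also where the rates vanish.\<close>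

lemma rate_quotient:
  assumes u: "u > 0"
  obtains B where "finite B" "\<And>\<Lambda> \<Delta> \<xi> \<omega> \<omega>'. finite \<Lambda> \<Longrightarrow> B \<subseteq> \<Lambda> \<Longrightarrow> \<Delta> \<in> active0 \<Longrightarrow> \<xi> \<in> patterns \<Delta> \<Longrightarrow>
    \<omega> \<in> cyl \<Lambda> \<omega>' \<Longrightarrow> c \<Delta> \<omega> \<xi> \<le> exp u * c \<Delta> \<omega>' \<xi>"
proof -
  have "\<exists>k>0. \<forall>\<eta> \<xi>. \<xi> \<in> patterns \<Delta> \<longrightarrow> 0 < c \<Delta> \<eta> \<xi> \<longrightarrow> k \<le> c \<Delta> \<eta> \<xi>" if "\<Delta> \<in> active" for \<Delta>
  proof -
    let ?S = "{(\<eta>, \<xi>). \<xi> \<in> patterns \<Delta> \<and> 0 < c \<Delta> \<eta> \<xi>}"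
    let ?k = "INF (\<eta>, \<xi>)\<in>?S. c \<Delta> \<eta> \<xi>"
    have "0 < ?k" using minimal that by (auto simp: positive_minimal_rate_def active_def)
    moreover have "?k \<le> c \<Delta> \<eta> \<xi>" if "\<xi> \<in> patterns \<Delta>" "0 < c \<Delta> \<eta> \<xi>" for \<eta> \<xi>
    proof -
      have "?k \<le> (case (\<eta>, \<xi>) of (\<eta>, \<xi>) \<Rightarrow> c \<Delta> \<eta> \<xi>)"
        by (rule cINF_lower) (use that in \<open>auto intro!: bdd_belowI[of _ 0]\<close>)
      then show ?thesis by simp
    qed
    ultimately show ?thesis by blast
  qed
  then obtain k where k: "\<And>\<Delta>. \<Delta> \<in> active \<Longrightarrow> 0 < k \<Delta>"
    "\<And>\<Delta> \<eta> \<xi>. \<Delta> \<in> active \<Longrightarrow> \<xi> \<in> patterns \<Delta> \<Longrightarrow> 0 < c \<Delta> \<eta> \<xi> \<Longrightarrow> k \<Delta> \<le> c \<Delta> \<eta> \<xi>"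
    by metis
  \<comment> \<open>The inserted 1 keeps the minimum meaningful if there are no active regions at
    the origin.\<close>
  define K where "K = Min (insert 1 (k ` active0))"
  have K: "0 < K" unfolding K_def using finite_active0 k(1) by (subst Min_gr_iff) (auto simp: active0_def)
  have Kk: "K \<le> k \<Delta>" if "\<Delta> \<in> active0" for \<Delta> unfolding K_def using finite_active0 that by (intro Min_le) auto
  \<comment> \<open>\<open>v \<le> 1\<close> keeps \<open>v * K\<close> within the gap, so a rate
    this close to a vanishing rate must vanish too; \<open>v \<le> u\<close> gives
    \<open>1 + v \<le> exp u\<close> for the positive rates.\<close>
  define v where "v = min u 1"
  have v: "0 < v" "v \<le> 1" "v \<le> u" using u by (auto simp: v_def)
  let ?S = "\<lambda>\<Lambda>. SUP \<Delta>\<in>{\<Delta>\<in>regions. 0 \<in> \<Delta>}. SUP \<xi>\<in>patterns \<Delta>. SUP \<eta>. SUP \<sigma>.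
         ennreal \<bar>c \<Delta> (override_on \<sigma> \<eta> \<Lambda>) \<xi> - c \<Delta> \<eta> \<xi>\<bar>"
  have "(?S \<longlongrightarrow> 0) (finite_subsets_at_top UNIV)" using unif by (simp add: uniformly_continuous_rates_def)
  then have "\<forall>\<^sub>F \<Lambda> in finite_subsets_at_top UNIV. ?S \<Lambda> < ennreal (v * K)"
    by (rule order_tendstoD) (use v K in simp)
  then obtain B where B: "finite B" "\<And>\<Lambda>. finite \<Lambda> \<Longrightarrow> B \<subseteq> \<Lambda> \<Longrightarrow> ?S \<Lambda> < ennreal (v * K)"
    unfolding eventually_finite_subsets_at_top by auto
  show ?thesis
  proof (rule that[OF B(1)])
    fix \<Lambda> \<Delta> :: "'d site set" and \<xi> \<omega> \<omega>' :: "('d, 'q) config"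
    assume L: "finite \<Lambda>" "B \<subseteq> \<Lambda>" and \<Delta>0: "\<Delta> \<in> active0" and \<xi>: "\<xi> \<in> patterns \<Delta>" and \<omega>: "\<omega> \<in> cyl \<Lambda> \<omega>'"
    have \<Delta>: "\<Delta> \<in> active" "\<Delta> \<in> regions" "0 \<in> \<Delta>" using \<Delta>0 activeD by (auto simp: active0_def)
    have "override_on \<omega> \<omega>' \<Lambda> = \<omega>" using \<omega> by (auto simp: override_on_def in_cyl)
    then have "ennreal \<bar>c \<Delta> \<omega> \<xi> - c \<Delta> \<omega>' \<xi>\<bar> = ennreal \<bar>c \<Delta> (override_on \<omega> \<omega>' \<Lambda>) \<xi> - c \<Delta> \<omega>' \<xi>\<bar>" by simp
    also have "\<dots> \<le> (SUP \<sigma>. ennreal \<bar>c \<Delta> (override_on \<sigma> \<omega>' \<Lambda>) \<xi> - c \<Delta> \<omega>' \<xi>\<bar>)"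
      by (rule SUP_upper) simp
    also have "\<dots> \<le> (SUP \<eta>. SUP \<sigma>. ennreal \<bar>c \<Delta> (override_on \<sigma> \<eta> \<Lambda>) \<xi> - c \<Delta> \<eta> \<xi>\<bar>)"
      by (rule SUP_upper) simp
    also have "\<dots> \<le> (SUP \<xi>\<in>patterns \<Delta>. SUP \<eta>. SUP \<sigma>. ennreal \<bar>c \<Delta> (override_on \<sigma> \<eta> \<Lambda>) \<xi> - c \<Delta> \<eta> \<xi>\<bar>)"
      by (rule SUP_upper[OF \<xi>])
    also have "\<dots> \<le> ?S \<Lambda>" by (rule SUP_upper) (use \<Delta> in simp)
    also have "\<dots> < ennreal (v * K)" by (rule B(2)[OF L])
    finally have d: "\<bar>c \<Delta> \<omega> \<xi> - c \<Delta> \<omega>' \<xi>\<bar> < v * K" by (simp add: ennreal_less_iff)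
    show "c \<Delta> \<omega> \<xi> \<le> exp u * c \<Delta> \<omega>' \<xi>"
    proof (cases "0 < c \<Delta> \<omega>' \<xi>")
      case True
      then have "K \<le> c \<Delta> \<omega>' \<xi>" using k(2)[OF \<Delta>(1) \<xi> True] Kk[OF \<Delta>0] by simp
      then have "v * K \<le> v * c \<Delta> \<omega>' \<xi>" using v by simp
      then have "c \<Delta> \<omega> \<xi> \<le> (1 + v) * c \<Delta> \<omega>' \<xi>" using d by (simp add: algebra_simps)
      also have "\<dots> \<le> exp u * c \<Delta> \<omega>' \<xi>"
        using True v(3) exp_ge_add_one_self[of u] by (intro mult_right_mono) linarith+
      finally show ?thesis .
    next
      case False
      then have 0: "c \<Delta> \<omega>' \<xi> = 0" using rate_nonneg[OF \<Delta>(2) \<xi>, of \<omega>'] by simp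
      have "v * K \<le> K" using v K by simp
      then have "c \<Delta> \<omega> \<xi> < k \<Delta>" using d 0 Kk[OF \<Delta>0] by simp
      then have "\<not> 0 < c \<Delta> \<omega> \<xi>" using k(2)[OF \<Delta>(1) \<xi>] by fastforce
      then show ?thesis using 0 by simp
    qed
  qed
qed

end

section \<open>Local entropy gains\<close>

text \<open>Dependence on the spins in \<open>\<Lambda>\<close> alone is expressed throughout by
  invariance under \<open>restrict\<close>, which lets a local function be evaluated at
  patterns.\<close>

lemma local_expand:
  fixes g :: "('d::finite, 'q::finite) config \<Rightarrow> real"
  assumes "finite \<Lambda>" "\<And>\<omega>. g (restrict \<omega> \<Lambda>) = g \<omega>"
  shows "g \<omega> = (\<Sum>\<eta>\<in>patterns \<Lambda>. g \<eta> * indicator (cyl \<Lambda> \<eta>) \<omega>)"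
  using sum_patterns_indicator[OF assms(1), of g \<omega>] assms(2) by simp

lemma local_continuous:
  fixes g :: "('d::finite, 'q::finite) config \<Rightarrow> real"
  assumes "finite \<Lambda>" "\<And>\<omega>. g (restrict \<omega> \<Lambda>) = g \<omega>"
  shows "continuous_on UNIV g"
proof -
  have "continuous_on UNIV (\<lambda>\<omega>. \<Sum>\<eta>\<in>patterns \<Lambda>. g \<eta> * indicator (cyl \<Lambda> \<eta>) \<omega>)"
    by (intro continuous_on_sum continuous_on_mult continuous_on_const continuous_on_indicator_clopen
        open_cyl closed_cyl assms(1))
  moreover have "(\<lambda>\<omega>. \<Sum>\<eta>\<in>patterns \<Lambda>. g \<eta> * indicator (cyl \<Lambda> \<eta>) \<omega>) = g"
    using local_expand[where g = g, OF assms] by (intro ext) (rule sym)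
  ultimately show ?thesis by (rule back_subst)
qed

lemma integrable_continuous:
  fixes f :: "('d::finite, 'q::finite) config \<Rightarrow> real"
  assumes "\<nu> \<in> prob_measures" "continuous_on UNIV f"
  shows "integrable \<nu> f"
  using integrable_bcontfun[OF assms(1), of "Bcontfun f"] by (simp add: apply_Bcontfun_continuous[OF assms(2)])

lemma integral_local:
  fixes f g :: "('d::finite, 'q::finite) config \<Rightarrow> real"
  assumes \<nu>: "\<nu> \<in> prob_measures" and f: "continuous_on UNIV f"
    and \<Lambda>: "finite \<Lambda>" and g: "\<And>\<omega>. g (restrict \<omega> \<Lambda>) = g \<omega>"
  shows "(\<integral>\<omega>. f \<omega> * g \<omega> \<partial>\<nu>) = (\<Sum>\<eta>\<in>patterns \<Lambda>. g \<eta> * (\<integral>\<omega>. f \<omega> * indicator (cyl \<Lambda> \<eta>) \<omega> \<partial>\<nu>))"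
proof -
  have i: "integrable \<nu> (\<lambda>\<omega>. f \<omega> * indicator (cyl \<Lambda> \<eta>) \<omega>)" for \<eta>
    by (intro integrable_continuous[OF \<nu>] continuous_on_mult f continuous_on_indicator_clopen open_cyl closed_cyl \<Lambda>)
  have "f \<omega> * g \<omega> = (\<Sum>\<eta>\<in>patterns \<Lambda>. g \<eta> * (f \<omega> * indicator (cyl \<Lambda> \<eta>) \<omega>))" for \<omega>
    by (subst local_expand[where g = g, OF \<Lambda> g, of \<omega>]) (simp add: sum_distrib_left mult_ac del: sum_mult_indicator)
  then have "(\<integral>\<omega>. f \<omega> * g \<omega> \<partial>\<nu>) = (\<integral>\<omega>. (\<Sum>\<eta>\<in>patterns \<Lambda>. g \<eta> * (f \<omega> * indicator (cyl \<Lambda> \<eta>) \<omega>)) \<partial>\<nu>)"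
    by (intro Bochner_Integration.integral_cong refl)
  also have "\<dots> = (\<Sum>\<eta>\<in>patterns \<Lambda>. \<integral>\<omega>. g \<eta> * (f \<omega> * indicator (cyl \<Lambda> \<eta>) \<omega>) \<partial>\<nu>)"
    by (rule Bochner_Integration.integral_sum) (intro integrable_mult_right i)
  finally show ?thesis by simp
qed

text \<open>Overwriting \<open>\<Delta>\<close> merges no two of these fine patterns: they coincide
  on \<open>\<Lambda>0\<close>, which contains \<open>\<Delta>\<close>. The resulting cells are
  disjoint parts of one coarse cell.\<close>

lemma sum_cyl_override_le:
  fixes \<nu> :: "('d::finite, 'q::finite) config measure"
  assumes \<nu>: "\<nu> \<in> prob_measures" and \<Lambda>: "finite \<Lambda>" "\<Lambda>0 \<subseteq> \<Lambda>" "\<Delta> \<subseteq> \<Lambda>0"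
  shows "(\<Sum>\<eta>\<in>{\<eta> \<in> patterns \<Lambda>. restrict \<eta> \<Lambda>0 = \<zeta>}. measure \<nu> (cyl \<Lambda> (override_on \<eta> \<xi> \<Delta>)))
    \<le> measure \<nu> (cyl \<Lambda>0 (override_on \<zeta> \<xi> \<Delta>))"
proof -
  interpret prob_space \<nu> by (rule prob_measuresD[OF \<nu>])
  let ?S = "{\<eta> \<in> patterns \<Lambda>. restrict \<eta> \<Lambda>0 = \<zeta>}"
  have "disjoint_family_on (\<lambda>\<eta>. cyl \<Lambda> (override_on \<eta> \<xi> \<Delta>)) ?S"
    unfolding disjoint_family_on_def
  proof (intro ballI impI equals0I)
    fix \<eta> \<eta>' \<omega>
    assume S: "\<eta> \<in> ?S" "\<eta>' \<in> ?S" and ne: "\<eta> \<noteq> \<eta>'"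
      and \<omega>: "\<omega> \<in> cyl \<Lambda> (override_on \<eta> \<xi> \<Delta>) \<inter> cyl \<Lambda> (override_on \<eta>' \<xi> \<Delta>)"
    have *: "override_on \<eta> \<xi> \<Delta> x = override_on \<eta>' \<xi> \<Delta> x" if "x \<in> \<Lambda>" for x
    proof -
      have "\<omega> x = override_on \<eta> \<xi> \<Delta> x" "\<omega> x = override_on \<eta>' \<xi> \<Delta> x"
        using \<omega> that unfolding in_cyl Int_iff by blast+
      then show ?thesis by (rule trans[OF sym])
    qed
    have "\<eta> x = \<eta>' x" if "x \<in> \<Lambda>" for x
    proof (cases "x \<in> \<Delta>")
      case True
      then have "x \<in> \<Lambda>0" using \<Lambda> by auto
      moreover have "restrict \<eta> \<Lambda>0 x = restrict \<eta>' \<Lambda>0 x" using S by simp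
      ultimately show ?thesis by simp
    next
      case False then show ?thesis using *[OF that] by simp
    qed
    then have "\<eta> = \<eta>'" using S by (intro PiE_ext[of \<eta> \<Lambda> "\<lambda>_. UNIV" \<eta>']) (auto simp: patterns_def)
    with ne show False ..
  qed
  moreover have "finite ?S" using \<Lambda>(1) by simp
  moreover have "(\<lambda>\<eta>. cyl \<Lambda> (override_on \<eta> \<xi> \<Delta>)) ` ?S \<subseteq> events"
    unfolding prob_measuresD(2)[OF \<nu>] by (intro image_subsetI cyl_borel)
  ultimately have "(\<Sum>\<eta>\<in>?S. measure \<nu> (cyl \<Lambda> (override_on \<eta> \<xi> \<Delta>))) = measure \<nu> (\<Union>\<eta>\<in>?S. cyl \<Lambda> (override_on \<eta> \<xi> \<Delta>))"
    by (intro finite_measure_finite_Union[symmetric])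
  also have "\<dots> \<le> measure \<nu> (cyl \<Lambda>0 (override_on \<zeta> \<xi> \<Delta>))"
  proof (rule finite_measure_mono)
    show "cyl \<Lambda>0 (override_on \<zeta> \<xi> \<Delta>) \<in> events" unfolding prob_measuresD(2)[OF \<nu>] by (rule cyl_borel)
    show "(\<Union>\<eta>\<in>?S. cyl \<Lambda> (override_on \<eta> \<xi> \<Delta>)) \<subseteq> cyl \<Lambda>0 (override_on \<zeta> \<xi> \<Delta>)"
    proof (rule UN_least)
      fix \<eta> assume "\<eta> \<in> ?S"
      then have \<zeta>: "\<zeta> = restrict \<eta> \<Lambda>0" by simp
      have "cyl \<Lambda>0 (override_on \<zeta> \<xi> \<Delta>) = cyl \<Lambda>0 (override_on \<eta> \<xi> \<Delta>)"
        unfolding \<zeta> by (simp add: cyl_def override_on_def)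
      then show "cyl \<Lambda> (override_on \<eta> \<xi> \<Delta>) \<subseteq> cyl \<Lambda>0 (override_on \<zeta> \<xi> \<Delta>)"
        using cyl_mono[OF \<Lambda>(2)] by blast
    qed
  qed
  finally show ?thesis .
qed

text \<open>Without a fixed coarse pattern cells may coincide after overwriting, but each pattern
  off \<open>\<Delta>\<close> has at most one preimage for every pattern on \<open>\<Delta>\<close>.
  The bound does not grow with \<open>\<Lambda>\<close>.\<close>

lemma sum_cyl_override_le_card:
  fixes \<nu> :: "('d::finite, 'q::finite) config measure"
  assumes \<nu>: "\<nu> \<in> prob_measures" and \<Lambda>: "finite \<Lambda>" and \<Delta>: "finite \<Delta>"
  shows "(\<Sum>\<eta>\<in>patterns \<Lambda>. measure \<nu> (cyl \<Lambda> (override_on \<eta> \<xi> \<Delta>)))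
    \<le> real (card (patterns \<Delta> :: ('d, 'q) config set))"
proof -
  interpret prob_space \<nu> by (rule prob_measuresD[OF \<nu>])
  let ?R = "\<Lambda> - \<Delta>" and ?P = "patterns :: 'd site set \<Rightarrow> ('d, 'q) config set"
  have "(\<Sum>\<eta>\<in>?P \<Lambda>. measure \<nu> (cyl \<Lambda> (override_on \<eta> \<xi> \<Delta>))) \<le> (\<Sum>\<eta>\<in>?P \<Lambda>. measure \<nu> (cyl ?R \<eta>))"
  proof (intro sum_mono finite_measure_mono)
    show "cyl \<Lambda> (override_on \<eta> \<xi> \<Delta>) \<subseteq> cyl ?R \<eta>" for \<eta> by (auto simp: in_cyl override_on_def)
    show "cyl ?R \<eta> \<in> events" for \<eta> unfolding prob_measuresD(2)[OF \<nu>] by (rule cyl_borel)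
  qed
  also have "\<dots> = (\<Sum>\<zeta>\<in>?P ?R. \<Sum>\<eta>\<in>{\<eta> \<in> ?P \<Lambda>. restrict \<eta> ?R = \<zeta>}. measure \<nu> (cyl ?R \<eta>))"
    using \<Lambda> by (intro sum.group[symmetric]) auto
  also have "\<dots> \<le> (\<Sum>\<zeta>\<in>?P ?R. real (card (?P \<Delta>)) * measure \<nu> (cyl ?R \<zeta>))"
  proof (rule sum_mono)
    fix \<zeta>
    let ?S = "{\<eta> \<in> ?P \<Lambda>. restrict \<eta> ?R = \<zeta>}"
    have "(\<Sum>\<eta>\<in>?S. measure \<nu> (cyl ?R \<eta>)) = (\<Sum>\<eta>\<in>?S. measure \<nu> (cyl ?R \<zeta>))"
    proof (intro sum.cong refl)
      fix \<eta> assume "\<eta> \<in> ?S"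
      then have "cyl ?R \<zeta> = cyl ?R \<eta>" using cyl_restrict by blast
      then show "measure \<nu> (cyl ?R \<eta>) = measure \<nu> (cyl ?R \<zeta>)" by simp
    qed
    also have "\<dots> = real (card ?S) * measure \<nu> (cyl ?R \<zeta>)" by simp
    also have "card ?S \<le> card (?P \<Delta>)"
    proof (rule card_inj_on_le[where f = "\<lambda>\<eta>. restrict \<eta> \<Delta>"])
      show "inj_on (\<lambda>\<eta>. restrict \<eta> \<Delta>) ?S"
      proof (rule inj_onI)
        fix \<eta> \<eta>' assume S: "\<eta> \<in> ?S" "\<eta>' \<in> ?S" and eq: "restrict \<eta> \<Delta> = restrict \<eta>' \<Delta>"
        have "\<eta> x = \<eta>' x" if "x \<in> \<Lambda>" for x
        proof (cases "x \<in> \<Delta>")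
          case True
          then show ?thesis using fun_cong[OF eq, of x] by simp
        next
          case False
          moreover have "restrict \<eta> ?R x = restrict \<eta>' ?R x" using S by simp
          ultimately show ?thesis using that by simp
        qed
        then show "\<eta> = \<eta>'" using S by (intro PiE_ext[of \<eta> \<Lambda> "\<lambda>_. UNIV" \<eta>']) (auto simp: patterns_def)
      qed
    qed (use \<Delta> in auto)
    then have "real (card ?S) * measure \<nu> (cyl ?R \<zeta>) \<le> real (card (?P \<Delta>)) * measure \<nu> (cyl ?R \<zeta>)"
      by (intro mult_right_mono) auto
    finally show "(\<Sum>\<eta>\<in>?S. measure \<nu> (cyl ?R \<eta>)) \<le> real (card (?P \<Delta>)) * measure \<nu> (cyl ?R \<zeta>)" .
  qed
  also have "\<dots> = real (card (?P \<Delta>)) * measure \<nu> UNIV"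
    using sum_measure_patterns[OF \<nu>, of ?R UNIV] \<Lambda> by (simp flip: sum_distrib_left)
  also have "\<dots> = real (card (?P \<Delta>))" using prob_space prob_measuresD(3)[OF \<nu>] by simp
  finally show ?thesis .
qed

section \<open>Entropy gains of single transitions\<close>

locale gibbs_ips = gibbs \<gamma> \<mu> + rates c
  for \<gamma> :: "('d::finite, 'q::finite) kernels" and \<mu> :: "('d, 'q) config measure"
    and c :: "('d, 'q) rates" +
  assumes mu_invariant: "\<mu> \<in> invariant_measures"
begin

text \<open>The regularised log density of \<open>\<nu>\<close> with respect to \<open>\<mu>\<close>
  on \<open>\<Lambda>\<close>. Only \<open>\<nu>\<close> is regularised, as \<open>\<mu>\<close>
  charges every cylinder over a finite region.\<close>

definition potential :: "'d site set \<Rightarrow> real \<Rightarrow> ('d, 'q) config measure \<Rightarrow> ('d, 'q) config \<Rightarrow> real" where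
  "potential \<Lambda> \<epsilon> \<nu> \<omega> = ln (measure \<nu> (cyl \<Lambda> \<omega>) + \<epsilon>) - ln (measure \<mu> (cyl \<Lambda> \<omega>))"

text \<open>The contribution of the transition to the time derivative of the regularised relative
  entropy in \<open>\<Lambda>\<close>; its limit as \<open>\<epsilon>\<close> tends to 0 is the
  corresponding term of the approximating loss.\<close>

definition gain ::
  "'d site set \<Rightarrow> real \<Rightarrow> 'd site set \<Rightarrow> ('d, 'q) config \<Rightarrow> ('d, 'q) config measure \<Rightarrow> real" where
  "gain \<Lambda> \<epsilon> \<Delta> \<xi> \<nu> =
     (\<integral>\<omega>. c \<Delta> \<omega> \<xi> * (potential \<Lambda> \<epsilon> \<nu> (override_on \<omega> \<xi> \<Delta>) - potential \<Lambda> \<epsilon> \<nu> \<omega>) \<partial>\<nu>)"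

text \<open>The flow out of a cell by one transition; divided by the probability of the cell it is
  the mean rate there.\<close>

definition weight ::
  "'d site set \<Rightarrow> 'd site set \<Rightarrow> ('d, 'q) config \<Rightarrow> ('d, 'q) config measure \<Rightarrow> ('d, 'q) config \<Rightarrow> real" where
  "weight \<Lambda> \<Delta> \<xi> \<nu> \<eta> = (\<integral>\<omega>. c \<Delta> \<omega> \<xi> * indicator (cyl \<Lambda> \<eta>) \<omega> \<partial>\<nu>)"

lemma cyl_override_restrict: "cyl \<Lambda> (override_on (restrict \<omega> \<Lambda>) \<xi> \<Delta>) = cyl \<Lambda> (override_on \<omega> \<xi> \<Delta>)"
  by (auto simp: cyl_def override_on_def)

lemma potential_restrict [simp]: "potential \<Lambda> \<epsilon> \<nu> (restrict \<omega> \<Lambda>) = potential \<Lambda> \<epsilon> \<nu> \<omega>"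
  "potential \<Lambda> \<epsilon> \<nu> (override_on (restrict \<omega> \<Lambda>) \<xi> \<Delta>) = potential \<Lambda> \<epsilon> \<nu> (override_on \<omega> \<xi> \<Delta>)"
  by (simp_all add: potential_def cyl_override_restrict)

lemma potential_continuous:
  assumes "finite \<Lambda>"
  shows "continuous_on UNIV (potential \<Lambda> \<epsilon> \<nu>)"
    "continuous_on UNIV (\<lambda>\<omega>. potential \<Lambda> \<epsilon> \<nu> (override_on \<omega> \<xi> \<Delta>))"
  by (rule local_continuous[OF assms], simp)+

lemma gain_eq_sum:
  assumes "\<nu> \<in> prob_measures" "\<Delta> \<in> regions" "\<xi> \<in> patterns \<Delta>" "finite \<Lambda>"
  shows "gain \<Lambda> \<epsilon> \<Delta> \<xi> \<nu> = (\<Sum>\<eta>\<in>patterns \<Lambda>.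
    (potential \<Lambda> \<epsilon> \<nu> (override_on \<eta> \<xi> \<Delta>) - potential \<Lambda> \<epsilon> \<nu> \<eta>) * weight \<Lambda> \<Delta> \<xi> \<nu> \<eta>)"
  unfolding gain_def weight_def using assms by (intro integral_local rate_continuous) auto

lemma rate_integrable:
  assumes "\<nu> \<in> prob_measures" "\<Delta> \<in> regions" "\<xi> \<in> patterns \<Delta>" "continuous_on UNIV g"
  shows "integrable \<nu> (\<lambda>\<omega>. c \<Delta> \<omega> \<xi> * g \<omega>)"
  using assms by (intro integrable_continuous continuous_on_mult rate_continuous)

lemma rate_indicator_integrable:
  assumes "\<nu> \<in> prob_measures" "\<Delta> \<in> regions" "\<xi> \<in> patterns \<Delta>" "finite \<Lambda>"
  shows "integrable \<nu> (\<lambda>\<omega>. c \<Delta> \<omega> \<xi> * indicator (cyl \<Lambda> \<eta>) \<omega>)"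
  using assms by (intro rate_integrable continuous_on_indicator_clopen open_cyl closed_cyl)

lemma weight_nonneg: "\<Delta> \<in> regions \<Longrightarrow> \<xi> \<in> patterns \<Delta> \<Longrightarrow> 0 \<le> weight \<Lambda> \<Delta> \<xi> \<nu> \<eta>"
  unfolding weight_def by (intro Bochner_Integration.integral_nonneg mult_nonneg_nonneg rate_nonneg) auto

lemma weight_le:
  assumes "\<nu> \<in> prob_measures" "\<Delta> \<in> active" "\<xi> \<in> patterns \<Delta>" "finite \<Lambda>"
  shows "weight \<Lambda> \<Delta> \<xi> \<nu> \<eta> \<le> rate_bound * measure \<nu> (cyl \<Lambda> \<eta>)"
proof -
  have "weight \<Lambda> \<Delta> \<xi> \<nu> \<eta> \<le> (\<integral>\<omega>. rate_bound * indicator (cyl \<Lambda> \<eta>) \<omega> \<partial>\<nu>)"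
    unfolding weight_def
    by (intro integral_mono rate_indicator_integrable integrable_scaled_indicator assms activeD(1) cyl_borel
        mult_right_mono rate_bound(2)) simp
  then show ?thesis by (simp add: integral_scaled_indicator[OF assms(1)] del: integral_mult_right_zero)
qed

lemma rate_integral:
  assumes "\<nu> \<in> prob_measures" "\<Delta> \<in> active" "\<xi> \<in> patterns \<Delta>"
  shows "0 \<le> (\<integral>\<omega>. c \<Delta> \<omega> \<xi> \<partial>\<nu>)" "(\<integral>\<omega>. c \<Delta> \<omega> \<xi> \<partial>\<nu>) \<le> rate_bound" "integrable \<nu> (\<lambda>\<omega>. c \<Delta> \<omega> \<xi>)"
proof -
  interpret N: prob_space \<nu> by (rule prob_measuresD[OF assms(1)])
  show "0 \<le> (\<integral>\<omega>. c \<Delta> \<omega> \<xi> \<partial>\<nu>)"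
    using assms by (intro Bochner_Integration.integral_nonneg rate_nonneg activeD)
  show i: "integrable \<nu> (\<lambda>\<omega>. c \<Delta> \<omega> \<xi>)"
    using rate_integrable[OF assms(1) activeD(1)[OF assms(2)] assms(3), of "\<lambda>_. 1"] by simp
  have "(\<integral>\<omega>. c \<Delta> \<omega> \<xi> \<partial>\<nu>) \<le> (\<integral>\<omega>. rate_bound \<partial>\<nu>)"
    using assms rate_bound(2) by (intro integral_mono i) auto
  then show "(\<integral>\<omega>. c \<Delta> \<omega> \<xi> \<partial>\<nu>) \<le> rate_bound" using N.prob_space by simp
qed

lemma sum_weight:
  assumes "\<nu> \<in> prob_measures" "\<Delta> \<in> regions" "\<xi> \<in> patterns \<Delta>" "finite \<Lambda>"
  shows "(\<Sum>\<eta>\<in>patterns \<Lambda>. weight \<Lambda> \<Delta> \<xi> \<nu> \<eta>) = (\<integral>\<omega>. c \<Delta> \<omega> \<xi> \<partial>\<nu>)"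
  using integral_local[OF assms(1) rate_continuous[OF assms(2,3)] assms(4), of "\<lambda>_. 1"]
  by (simp add: weight_def)

text \<open>The mean rate on a fine cell exceeds the rate at any point of the coarse cell by at most
  the factor \<open>exp u\<close>. Integrating over that point gives the comparison of mean rates,
  in product form because cells may be null.\<close>

lemma weight_mult_le:
  assumes \<nu>: "\<nu> \<in> prob_measures" and \<Delta>: "\<Delta> \<in> regions" "\<xi> \<in> patterns \<Delta>"
    and \<Lambda>: "finite \<Lambda>" "\<Lambda>0 \<subseteq> \<Lambda>"
    and q: "\<And>\<omega> \<omega>'. \<omega> \<in> cyl \<Lambda>0 \<omega>' \<Longrightarrow> c \<Delta> \<omega> \<xi> \<le> exp u * c \<Delta> \<omega>' \<xi>"
  shows "weight \<Lambda> \<Delta> \<xi> \<nu> \<eta> * measure \<nu> (cyl \<Lambda>0 \<eta>) \<le> exp u * measure \<nu> (cyl \<Lambda> \<eta>) * weight \<Lambda>0 \<Delta> \<xi> \<nu> \<eta>"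
proof -
  have fin0: "finite \<Lambda>0" using \<Lambda> finite_subset by blast
  have w: "weight \<Lambda> \<Delta> \<xi> \<nu> \<eta> \<le> exp u * c \<Delta> \<omega>' \<xi> * measure \<nu> (cyl \<Lambda> \<eta>)" if "\<omega>' \<in> cyl \<Lambda>0 \<eta>" for \<omega>'
  proof -
    have "weight \<Lambda> \<Delta> \<xi> \<nu> \<eta> \<le> (\<integral>\<omega>. (exp u * c \<Delta> \<omega>' \<xi>) * indicator (cyl \<Lambda> \<eta>) \<omega> \<partial>\<nu>)"
      unfolding weight_def
    proof (intro integral_mono rate_indicator_integrable integrable_scaled_indicator \<nu> \<Delta> \<Lambda> cyl_borel)
      fix \<omega>
      show "c \<Delta> \<omega> \<xi> * indicator (cyl \<Lambda> \<eta>) \<omega> \<le> (exp u * c \<Delta> \<omega>' \<xi>) * indicator (cyl \<Lambda> \<eta>) \<omega>"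
      proof (cases "\<omega> \<in> cyl \<Lambda> \<eta>")
        case True
        then have "\<omega> \<in> cyl \<Lambda>0 \<omega>'" using \<Lambda>(2) that by (auto simp: in_cyl)
        from q[OF this] True show ?thesis by simp
      qed simp
    qed
    then show ?thesis by (simp only: integral_scaled_indicator[OF \<nu> cyl_borel])
  qed
  have "weight \<Lambda> \<Delta> \<xi> \<nu> \<eta> * measure \<nu> (cyl \<Lambda>0 \<eta>) = (\<integral>\<omega>'. weight \<Lambda> \<Delta> \<xi> \<nu> \<eta> * indicator (cyl \<Lambda>0 \<eta>) \<omega>' \<partial>\<nu>)"
    by (simp only: integral_scaled_indicator[OF \<nu> cyl_borel])
  also have "\<dots> \<le> (\<integral>\<omega>'. (exp u * measure \<nu> (cyl \<Lambda> \<eta>)) * (c \<Delta> \<omega>' \<xi> * indicator (cyl \<Lambda>0 \<eta>) \<omega>') \<partial>\<nu>)"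
  proof (rule integral_mono)
    show "integrable \<nu> (\<lambda>\<omega>'. weight \<Lambda> \<Delta> \<xi> \<nu> \<eta> * indicator (cyl \<Lambda>0 \<eta>) \<omega>')"
      by (intro integrable_scaled_indicator \<nu> cyl_borel)
    show "integrable \<nu> (\<lambda>\<omega>'. (exp u * measure \<nu> (cyl \<Lambda> \<eta>)) * (c \<Delta> \<omega>' \<xi> * indicator (cyl \<Lambda>0 \<eta>) \<omega>'))"
      by (intro integrable_mult_right rate_indicator_integrable \<nu> \<Delta> fin0)
    fix \<omega>'
    show "weight \<Lambda> \<Delta> \<xi> \<nu> \<eta> * indicator (cyl \<Lambda>0 \<eta>) \<omega>'
        \<le> (exp u * measure \<nu> (cyl \<Lambda> \<eta>)) * (c \<Delta> \<omega>' \<xi> * indicator (cyl \<Lambda>0 \<eta>) \<omega>')"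
      using w[of \<omega>'] by (cases "\<omega>' \<in> cyl \<Lambda>0 \<eta>") (simp_all add: mult_ac)
  qed
  also have "\<dots> = exp u * measure \<nu> (cyl \<Lambda> \<eta>) * weight \<Lambda>0 \<Delta> \<xi> \<nu> \<eta>" by (simp add: weight_def)
  finally show ?thesis .
qed

lemma potential_diff:
  assumes "finite \<Lambda>" "0 < \<epsilon>"
  shows "potential \<Lambda> \<epsilon> \<nu> (override_on \<omega> \<xi> \<Delta>) - potential \<Lambda> \<epsilon> \<nu> \<omega> =
    ln ((measure \<nu> (cyl \<Lambda> (override_on \<omega> \<xi> \<Delta>)) + \<epsilon>) / (measure \<nu> (cyl \<Lambda> \<omega>) + \<epsilon>)) + log_ratio \<Delta> \<Lambda> \<xi> \<omega>"
proof -
  have "0 < measure \<nu> A + \<epsilon>" for A using assms(2) by (simp add: add_nonneg_pos)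
  moreover have "measure \<nu> A + \<epsilon> \<noteq> 0" for A using calculation[of A] by simp
  ultimately show ?thesis by (simp add: potential_def log_ratio_def ln_div)
qed

text \<open>Refining a partition lowers the loss up to the oscillation of the rates: the log sum
  inequality, applied with weights that are only nearly proportional to the cell probabilities.\<close>

lemma gain_refine:
  assumes \<nu>: "\<nu> \<in> prob_measures" and \<Delta>: "\<Delta> \<in> active" "\<xi> \<in> patterns \<Delta>"
    and \<Lambda>: "finite \<Lambda>" "\<Lambda>0 \<subseteq> \<Lambda>" "\<Delta> \<subseteq> \<Lambda>0"
    and \<epsilon>: "0 < \<epsilon>" "0 < \<epsilon>0" "\<epsilon> * real (card (patterns \<Lambda> :: ('d, 'q) config set)) \<le> \<epsilon>0"
    and u: "0 \<le> u"
    and q: "\<And>\<omega> \<omega>'. \<omega> \<in> cyl \<Lambda>0 \<omega>' \<Longrightarrow> c \<Delta> \<omega> \<xi> \<le> exp u * c \<Delta> \<omega>' \<xi>"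
    and l: "\<And>\<omega>. \<bar>log_ratio \<Delta> \<Lambda> \<xi> \<omega> - log_ratio \<Delta> \<Lambda>0 \<xi> \<omega>\<bar> \<le> u"
  shows "gain \<Lambda> \<epsilon> \<Delta> \<xi> \<nu> \<le> gain \<Lambda>0 \<epsilon>0 \<Delta> \<xi> \<nu> +
    rate_bound * (2 * u + real (card (patterns \<Lambda>0 :: ('d, 'q) config set)) * \<epsilon>0)"
proof -
  let ?N0 = "real (card (patterns \<Lambda>0 :: ('d, 'q) config set))"
  have fin0: "finite \<Lambda>0" using \<Lambda> finite_subset by blast
  note reg = activeD(1)[OF \<Delta>(1)]
  \<comment> \<open>Lower case refers to the fine cell and upper case to the coarse one;
    \<open>y\<close> and \<open>Y\<close> belong to the cells after the transition.\<close>
  define x y X Y where "x \<omega> = measure \<nu> (cyl \<Lambda> \<omega>)" and "y \<omega> = measure \<nu> (cyl \<Lambda> (override_on \<omega> \<xi> \<Delta>))"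
    and "X \<omega> = measure \<nu> (cyl \<Lambda>0 \<omega>)" and "Y \<omega> = measure \<nu> (cyl \<Lambda>0 (override_on \<omega> \<xi> \<Delta>))" for \<omega>
  note defs = x_def y_def X_def Y_def
  have nn: "0 \<le> x \<omega>" "0 \<le> y \<omega>" "0 \<le> X \<omega>" "0 \<le> Y \<omega>" for \<omega> by (simp_all add: defs)
  \<comment> \<open>The fine likelihood ratio of the transition divided by the coarse one. Its
    logarithm is the change of the \<open>\<nu>\<close>-part of the integrand under
    refinement.\<close>
  define s where "s \<omega> = (y \<omega> + \<epsilon>) * (X \<omega> + \<epsilon>0) / ((x \<omega> + \<epsilon>) * (Y \<omega> + \<epsilon>0))" for \<omega>
  have pos: "0 < x \<omega> + \<epsilon>" "0 < y \<omega> + \<epsilon>" "0 < X \<omega> + \<epsilon>0" "0 < Y \<omega> + \<epsilon>0" for \<omega>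
    using nn[of \<omega>] \<epsilon> by linarith+
  have s_pos: "0 < s \<omega>" for \<omega> unfolding s_def using pos[of \<omega>] by simp
  have s_local: "s (restrict \<omega> \<Lambda>) = s \<omega>" for \<omega>
  proof -
    have "cyl \<Lambda>0 (restrict \<omega> \<Lambda>) = cyl \<Lambda>0 \<omega>" using \<Lambda>(2) by (auto simp: cyl_def)
    moreover have "cyl \<Lambda>0 (override_on (restrict \<omega> \<Lambda>) \<xi> \<Delta>) = cyl \<Lambda>0 (override_on \<omega> \<xi> \<Delta>)"
      using \<Lambda>(2) by (auto simp: cyl_def override_on_def)
    ultimately show ?thesis by (simp add: s_def defs cyl_override_restrict)
  qed
  have s_cont: "continuous_on UNIV s" by (rule local_continuous[where g = s, OF \<Lambda>(1) s_local])
  let ?w = "weight \<Lambda> \<Delta> \<xi> \<nu>" and ?W = "weight \<Lambda>0 \<Delta> \<xi> \<nu>"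
  \<comment> \<open>An upper bound for \<open>?w (X + \<epsilon>0) / (x + \<epsilon>)\<close> that
    depends on the coarse cell only: the first summand comes from the near constancy of the rate,
    the second pays for adding \<open>\<epsilon>0\<close> to \<open>X\<close>.\<close>
  define A where "A \<zeta> = exp u * ?W \<zeta> + rate_bound * \<epsilon>0" for \<zeta>
  have A_nonneg: "0 \<le> A \<zeta>" for \<zeta>
    unfolding A_def using weight_nonneg[OF reg \<Delta>(2)] rate_bound(1) \<epsilon> by (intro add_nonneg_nonneg mult_nonneg_nonneg) auto
  have "(\<integral>\<omega>. c \<Delta> \<omega> \<xi> * s \<omega> \<partial>\<nu>) = (\<Sum>\<eta>\<in>patterns \<Lambda>. s \<eta> * ?w \<eta>)"
    unfolding weight_def by (rule integral_local[OF \<nu> rate_continuous[OF reg \<Delta>(2)] \<Lambda>(1), of s, OF s_local])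
  also have "\<dots> \<le> (\<Sum>\<eta>\<in>patterns \<Lambda>. A \<eta> * (y \<eta> + \<epsilon>) / (Y \<eta> + \<epsilon>0))"
  proof (rule sum_mono)
    fix \<eta>
    have "?w \<eta> * X \<eta> \<le> exp u * x \<eta> * ?W \<eta>"
      unfolding defs by (rule weight_mult_le[OF \<nu> reg \<Delta>(2) \<Lambda>(1,2) q])
    also have "\<dots> \<le> exp u * ?W \<eta> * (x \<eta> + \<epsilon>)"
      using weight_nonneg[OF reg \<Delta>(2), of \<Lambda>0 \<nu> \<eta>] \<epsilon> by (simp add: algebra_simps)
    finally have 1: "?w \<eta> * X \<eta> \<le> exp u * ?W \<eta> * (x \<eta> + \<epsilon>)" .
    have "?w \<eta> \<le> rate_bound * x \<eta>" unfolding defs by (rule weight_le[OF \<nu> \<Delta> \<Lambda>(1)])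
    also have "\<dots> \<le> rate_bound * (x \<eta> + \<epsilon>)" using rate_bound(1) \<epsilon> by (intro mult_left_mono) auto
    finally have "?w \<eta> * \<epsilon>0 \<le> rate_bound * (x \<eta> + \<epsilon>) * \<epsilon>0" using \<epsilon> by (intro mult_right_mono) auto
    with 1 have "?w \<eta> * (X \<eta> + \<epsilon>0) \<le> A \<eta> * (x \<eta> + \<epsilon>)" by (simp add: A_def algebra_simps)
    then have "?w \<eta> * (X \<eta> + \<epsilon>0) / (x \<eta> + \<epsilon>) \<le> A \<eta>" using pos(1)[of \<eta>] by (simp add: pos_divide_le_eq)
    then have "?w \<eta> * (X \<eta> + \<epsilon>0) / (x \<eta> + \<epsilon>) * ((y \<eta> + \<epsilon>) / (Y \<eta> + \<epsilon>0)) \<le> A \<eta> * ((y \<eta> + \<epsilon>) / (Y \<eta> + \<epsilon>0))"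
      using pos(2,4)[of \<eta>] by (intro mult_right_mono) auto
    then show "s \<eta> * ?w \<eta> \<le> A \<eta> * (y \<eta> + \<epsilon>) / (Y \<eta> + \<epsilon>0)"
      by (simp add: s_def mult_ac)
  qed
  also have "\<dots> = (\<Sum>\<zeta>\<in>patterns \<Lambda>0. \<Sum>\<eta>\<in>{\<eta> \<in> patterns \<Lambda>. restrict \<eta> \<Lambda>0 = \<zeta>}. A \<eta> * (y \<eta> + \<epsilon>) / (Y \<eta> + \<epsilon>0))"
    using \<Lambda>(1) fin0 by (intro sum.group[symmetric]) auto
  also have "\<dots> \<le> (\<Sum>\<zeta>\<in>patterns \<Lambda>0. A \<zeta>)"
  proof (rule sum_mono)
    fix \<zeta> :: "('d, 'q) config"
    let ?S = "{\<eta> \<in> patterns \<Lambda>. restrict \<eta> \<Lambda>0 = \<zeta>}"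
    have eq: "A \<eta> = A \<zeta>" "Y \<eta> = Y \<zeta>" if "\<eta> \<in> ?S" for \<eta>
    proof -
      have \<zeta>: "\<zeta> = restrict \<eta> \<Lambda>0" using that by simp
      show "A \<eta> = A \<zeta>" unfolding \<zeta> A_def weight_def by simp
      show "Y \<eta> = Y \<zeta>" unfolding \<zeta> Y_def cyl_override_restrict ..
    qed
    have "(\<Sum>\<eta>\<in>?S. A \<eta> * (y \<eta> + \<epsilon>) / (Y \<eta> + \<epsilon>0)) = (\<Sum>\<eta>\<in>?S. A \<zeta> / (Y \<zeta> + \<epsilon>0) * (y \<eta> + \<epsilon>))"
      by (intro sum.cong refl) (simp only: eq times_divide_eq_left)
    also have "\<dots> = A \<zeta> / (Y \<zeta> + \<epsilon>0) * ((\<Sum>\<eta>\<in>?S. y \<eta>) + \<epsilon> * real (card ?S))"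
      by (simp only: sum_distrib_left[symmetric] sum.distrib sum_constant mult.commute[of \<epsilon>])
    \<comment> \<open>Here the coupling of \<open>\<epsilon>\<close> to the number of fine patterns
      is needed: the fine target cells have total mass at most \<open>Y \<zeta>\<close>, and their
      regularising masses total at most \<open>\<epsilon>0\<close>.\<close>
    also have "\<dots> \<le> A \<zeta> / (Y \<zeta> + \<epsilon>0) * (Y \<zeta> + \<epsilon>0)"
    proof (intro mult_left_mono add_mono)
      show "(\<Sum>\<eta>\<in>?S. y \<eta>) \<le> Y \<zeta>" unfolding defs by (rule sum_cyl_override_le[OF \<nu> \<Lambda>])
      have "card ?S \<le> card (patterns \<Lambda> :: ('d, 'q) config set)" using \<Lambda>(1) by (intro card_mono) auto
      then have "\<epsilon> * real (card ?S) \<le> \<epsilon> * real (card (patterns \<Lambda> :: ('d, 'q) config set))" using \<epsilon> by simp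
      then show "\<epsilon> * real (card ?S) \<le> \<epsilon>0" using \<epsilon>(3) by (rule order_trans)
      show "0 \<le> A \<zeta> / (Y \<zeta> + \<epsilon>0)" using A_nonneg pos(4)[of \<zeta>] by simp
    qed
    also have "\<dots> = A \<zeta>" using pos(4)[of \<zeta>] by simp
    finally show "(\<Sum>\<eta>\<in>?S. A \<eta> * (y \<eta> + \<epsilon>) / (Y \<eta> + \<epsilon>0)) \<le> A \<zeta>" .
  qed
  also have "\<dots> = exp u * (\<integral>\<omega>. c \<Delta> \<omega> \<xi> \<partial>\<nu>) + ?N0 * rate_bound * \<epsilon>0"
    by (simp add: A_def sum.distrib sum_distrib_left[symmetric] sum_weight[OF \<nu> reg \<Delta>(2) fin0])
  finally have cs: "(\<integral>\<omega>. c \<Delta> \<omega> \<xi> * s \<omega> \<partial>\<nu>) \<le> exp u * (\<integral>\<omega>. c \<Delta> \<omega> \<xi> \<partial>\<nu>) + ?N0 * rate_bound * \<epsilon>0" .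
  let ?d = "\<lambda>\<Lambda> \<epsilon> \<omega>. potential \<Lambda> \<epsilon> \<nu> (override_on \<omega> \<xi> \<Delta>) - potential \<Lambda> \<epsilon> \<nu> \<omega>"
  have d_cont: "continuous_on UNIV (?d \<Lambda> \<epsilon>)" "continuous_on UNIV (?d \<Lambda>0 \<epsilon>0)"
    by (intro continuous_on_diff potential_continuous \<Lambda>(1) fin0)+
  \<comment> \<open>\<open>ln z \<le> z - 1\<close> is applied at
    \<open>z = exp (- u) * s \<omega>\<close>. This factor cancels the \<open>exp u\<close> in
    \<open>cs\<close>, so that the leading term is absorbed by \<open>- 1\<close>; one
    \<open>u\<close> arises here and one from \<open>log_ratio\<close>.\<close>
  have d: "?d \<Lambda> \<epsilon> \<omega> - ?d \<Lambda>0 \<epsilon>0 \<omega> \<le> exp (- u) * s \<omega> + (2 * u - 1)" for \<omega>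
  proof -
    have "?d \<Lambda> \<epsilon> \<omega> - ?d \<Lambda>0 \<epsilon>0 \<omega> \<le> ln ((y \<omega> + \<epsilon>) / (x \<omega> + \<epsilon>)) - ln ((Y \<omega> + \<epsilon>0) / (X \<omega> + \<epsilon>0)) + u"
      using l[of \<omega>] unfolding potential_diff[OF \<Lambda>(1) \<epsilon>(1)] potential_diff[OF fin0 \<epsilon>(2)] defs by linarith
    also have "ln ((y \<omega> + \<epsilon>) / (x \<omega> + \<epsilon>)) - ln ((Y \<omega> + \<epsilon>0) / (X \<omega> + \<epsilon>0)) = ln (s \<omega>)"
      using pos[of \<omega>] by (simp add: s_def ln_div ln_mult)
    also have "ln (s \<omega>) = ln (exp (- u) * s \<omega>) + u" using s_pos[of \<omega>] by (simp add: ln_mult)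
    also have "ln (exp (- u) * s \<omega>) \<le> exp (- u) * s \<omega> - 1" using s_pos[of \<omega>] by (intro ln_le_minus_one) simp
    finally show ?thesis by simp
  qed
  have "gain \<Lambda> \<epsilon> \<Delta> \<xi> \<nu> - gain \<Lambda>0 \<epsilon>0 \<Delta> \<xi> \<nu> = (\<integral>\<omega>. c \<Delta> \<omega> \<xi> * (?d \<Lambda> \<epsilon> \<omega> - ?d \<Lambda>0 \<epsilon>0 \<omega>) \<partial>\<nu>)"
    unfolding gain_def right_diff_distrib[of _ "?d \<Lambda> \<epsilon> _"]
    by (rule Bochner_Integration.integral_diff[symmetric]) (intro rate_integrable[OF \<nu> reg \<Delta>(2)] d_cont)+
  also have "\<dots> \<le> (\<integral>\<omega>. c \<Delta> \<omega> \<xi> * (exp (- u) * s \<omega> + (2 * u - 1)) \<partial>\<nu>)"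
    by (intro integral_mono rate_integrable[OF \<nu> reg \<Delta>(2)] continuous_intros d_cont s_cont mult_left_mono d
        rate_nonneg[OF reg \<Delta>(2)])
  also have "\<dots> = exp (- u) * (\<integral>\<omega>. c \<Delta> \<omega> \<xi> * s \<omega> \<partial>\<nu>) + (2 * u - 1) * (\<integral>\<omega>. c \<Delta> \<omega> \<xi> \<partial>\<nu>)"
  proof -
    have "(\<integral>\<omega>. c \<Delta> \<omega> \<xi> * (exp (- u) * s \<omega> + (2 * u - 1)) \<partial>\<nu>) =
        (\<integral>\<omega>. exp (- u) * (c \<Delta> \<omega> \<xi> * s \<omega>) + (2 * u - 1) * c \<Delta> \<omega> \<xi> \<partial>\<nu>)"
      by (intro Bochner_Integration.integral_cong refl) (simp add: algebra_simps)
    also have "\<dots> = (\<integral>\<omega>. exp (- u) * (c \<Delta> \<omega> \<xi> * s \<omega>) \<partial>\<nu>) + (\<integral>\<omega>. (2 * u - 1) * c \<Delta> \<omega> \<xi> \<partial>\<nu>)"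
      by (intro Bochner_Integration.integral_add integrable_mult_right rate_integrable[OF \<nu> reg \<Delta>(2) s_cont] rate_integral(3)[OF \<nu> \<Delta>])
    finally show ?thesis by simp
  qed
  also have "\<dots> \<le> exp (- u) * (exp u * (\<integral>\<omega>. c \<Delta> \<omega> \<xi> \<partial>\<nu>) + ?N0 * rate_bound * \<epsilon>0) + (2 * u - 1) * (\<integral>\<omega>. c \<Delta> \<omega> \<xi> \<partial>\<nu>)"
    by (intro add_right_mono mult_left_mono cs) simp
  also have "\<dots> = 2 * u * (\<integral>\<omega>. c \<Delta> \<omega> \<xi> \<partial>\<nu>) + exp (- u) * (?N0 * rate_bound * \<epsilon>0)"
  proof -
    have "exp (- u) * exp u = 1" by (simp add: exp_minus)
    then have "exp (- u) * (exp u * I) = I" for I by (simp add: mult.assoc[symmetric])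
    then show ?thesis by (simp add: distrib_left left_diff_distrib)
  qed
  also have "\<dots> \<le> 2 * u * rate_bound + 1 * (?N0 * rate_bound * \<epsilon>0)"
    using rate_integral(2)[OF \<nu> \<Delta>] u \<epsilon> rate_bound(1) by (intro add_mono mult_left_mono mult_right_mono) auto
  finally show ?thesis by (simp add: algebra_simps)
qed

text \<open>A bound free of the volume, the measure and \<open>\<epsilon>\<close>, for sites near
  the boundary where gains cannot be compared by refinement. The bound
  \<open>ln r \<le> r - 1\<close> replaces the source cell by the target cell, and target masses sum
  to at most the number of patterns on \<open>\<Delta>\<close>.\<close>

lemma gain_upper:
  assumes \<nu>: "\<nu> \<in> prob_measures" and \<Delta>: "\<Delta> \<in> active" "\<xi> \<in> patterns \<Delta>" and \<Lambda>: "finite \<Lambda>"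
    and \<epsilon>: "0 < \<epsilon>" "\<epsilon> * real (card (patterns \<Lambda> :: ('d, 'q) config set)) \<le> 1"
  shows "gain \<Lambda> \<epsilon> \<Delta> \<xi> \<nu> \<le>
    rate_bound * (real (card (patterns \<Delta> :: ('d, 'q) config set)) + 1 - real (card \<Delta>) * ln site_bound)"
proof -
  note reg = activeD(1)[OF \<Delta>(1)] and fin = activeD(2)[OF \<Delta>(1)]
  let ?x = "\<lambda>\<omega>. measure \<nu> (cyl \<Lambda> \<omega>)" and ?y = "\<lambda>\<omega>. measure \<nu> (cyl \<Lambda> (override_on \<omega> \<xi> \<Delta>))"
  let ?K = "- real (card \<Delta>) * ln site_bound"
  have K: "0 \<le> ?K" using site_bound by (simp add: mult_nonneg_nonpos)
  have pos: "0 < ?x \<omega> + \<epsilon>" "0 < ?y \<omega> + \<epsilon>" for \<omega> using \<epsilon> by (simp_all add: add_nonneg_pos)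
  define r where "r \<omega> = (?y \<omega> + \<epsilon>) / (?x \<omega> + \<epsilon>)" for \<omega>
  have r_local: "r (restrict \<omega> \<Lambda>) = r \<omega>" for \<omega> by (simp add: r_def cyl_override_restrict)
  have r_cont: "continuous_on UNIV r" by (rule local_continuous[where g = r, OF \<Lambda> r_local])
  have "gain \<Lambda> \<epsilon> \<Delta> \<xi> \<nu> \<le> (\<integral>\<omega>. c \<Delta> \<omega> \<xi> * (r \<omega> + ?K) \<partial>\<nu>)"
    unfolding gain_def
  proof (intro integral_mono rate_integrable[OF \<nu> reg \<Delta>(2)] continuous_intros potential_continuous r_cont \<Lambda>
      mult_left_mono rate_nonneg[OF reg \<Delta>(2)])
    fix \<omega>
    have "ln (r \<omega>) \<le> r \<omega> - 1" using pos[of \<omega>] unfolding r_def by (intro ln_le_minus_one) simp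
    moreover have "log_ratio \<Delta> \<Lambda> \<xi> \<omega> \<le> ?K" using log_ratio_bound[OF \<Lambda> fin, of \<xi> \<omega>] by linarith
    ultimately show "potential \<Lambda> \<epsilon> \<nu> (override_on \<omega> \<xi> \<Delta>) - potential \<Lambda> \<epsilon> \<nu> \<omega> \<le> r \<omega> + ?K"
      unfolding potential_diff[OF \<Lambda> \<epsilon>(1)] r_def by linarith
  qed
  also have "\<dots> = (\<integral>\<omega>. c \<Delta> \<omega> \<xi> * r \<omega> \<partial>\<nu>) + (\<integral>\<omega>. c \<Delta> \<omega> \<xi> * ?K \<partial>\<nu>)"
    unfolding distrib_left
    by (rule Bochner_Integration.integral_add) (intro rate_integrable[OF \<nu> reg \<Delta>(2)] r_cont continuous_on_const)+
  also have "(\<integral>\<omega>. c \<Delta> \<omega> \<xi> * ?K \<partial>\<nu>) = (\<integral>\<omega>. c \<Delta> \<omega> \<xi> \<partial>\<nu>) * ?K" by (rule integral_mult_left_zero)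
  also have "(\<integral>\<omega>. c \<Delta> \<omega> \<xi> \<partial>\<nu>) * ?K \<le> rate_bound * ?K"
    using rate_integral(2)[OF \<nu> \<Delta>] K by (intro mult_right_mono)
  also have "(\<integral>\<omega>. c \<Delta> \<omega> \<xi> * r \<omega> \<partial>\<nu>) = (\<Sum>\<eta>\<in>patterns \<Lambda>. r \<eta> * weight \<Lambda> \<Delta> \<xi> \<nu> \<eta>)"
    unfolding weight_def by (rule integral_local[OF \<nu> rate_continuous[OF reg \<Delta>(2)] \<Lambda>, of r, OF r_local])
  also have "\<dots> \<le> (\<Sum>\<eta>\<in>patterns \<Lambda>. rate_bound * (?y \<eta> + \<epsilon>))"
  proof (rule sum_mono)
    fix \<eta>
    have "weight \<Lambda> \<Delta> \<xi> \<nu> \<eta> \<le> rate_bound * ?x \<eta>" by (rule weight_le[OF \<nu> \<Delta> \<Lambda>])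
    also have "\<dots> \<le> rate_bound * (?x \<eta> + \<epsilon>)" using rate_bound(1) \<epsilon> by (intro mult_left_mono) auto
    finally have "r \<eta> * weight \<Lambda> \<Delta> \<xi> \<nu> \<eta> \<le> r \<eta> * (rate_bound * (?x \<eta> + \<epsilon>))"
      using pos[of \<eta>] by (intro mult_left_mono) (auto simp: r_def)
    then show "r \<eta> * weight \<Lambda> \<Delta> \<xi> \<nu> \<eta> \<le> rate_bound * (?y \<eta> + \<epsilon>)"
      using pos(1)[of \<eta>] by (simp add: r_def mult_ac)
  qed
  also have "\<dots> = rate_bound * ((\<Sum>\<eta>\<in>patterns \<Lambda>. ?y \<eta>) + \<epsilon> * real (card (patterns \<Lambda> :: ('d, 'q) config set)))"
    by (simp add: sum_distrib_left[symmetric] sum.distrib mult.commute)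
  also have "\<dots> \<le> rate_bound * (real (card (patterns \<Delta> :: ('d, 'q) config set)) + 1)"
    using sum_cyl_override_le_card[OF \<nu> \<Lambda> fin] \<epsilon>(2) rate_bound(1) by (intro mult_left_mono add_mono) auto
  finally show ?thesis by (simp add: algebra_simps)
qed

text \<open>For fixed \<open>\<Lambda>\<close> the gain is built from finitely many integrals of
  continuous functions, and \<open>\<epsilon> > 0\<close> keeps the logarithms away from their
  singularity.\<close>

lemma gain_tendsto:
  assumes \<nu>: "\<nu> \<in> prob_measures" and \<rho>: "\<forall>\<^sub>F x in F. \<rho> x \<in> prob_measures"
    and lim: "\<And>f :: ('d, 'q) config \<Rightarrow>\<^sub>C real. ((\<lambda>x. \<integral>\<omega>. apply_bcontfun f \<omega> \<partial>\<rho> x) \<longlongrightarrow> (\<integral>\<omega>. apply_bcontfun f \<omega> \<partial>\<nu>)) F"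
    and \<Delta>: "\<Delta> \<in> regions" "\<xi> \<in> patterns \<Delta>" and \<Lambda>: "finite \<Lambda>" and \<epsilon>: "0 < \<epsilon>"
  shows "((\<lambda>x. gain \<Lambda> \<epsilon> \<Delta> \<xi> (\<rho> x)) \<longlongrightarrow> gain \<Lambda> \<epsilon> \<Delta> \<xi> \<nu>) F"
proof -
  have lim': "((\<lambda>x. \<integral>\<omega>. f \<omega> \<partial>\<rho> x) \<longlongrightarrow> (\<integral>\<omega>. f \<omega> \<partial>\<nu>)) F" if "continuous_on UNIV f" for f :: "_ \<Rightarrow> real"
    using lim[of "Bcontfun f"] by (simp add: apply_Bcontfun_continuous[OF that])
  have ind: "continuous_on UNIV (indicator (cyl \<Lambda> \<eta>) :: _ \<Rightarrow> real)" for \<eta> :: "('d, 'q) config"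
    using \<Lambda> by (intro continuous_on_indicator_clopen open_cyl closed_cyl)
  have w: "((\<lambda>x. weight \<Lambda> \<Delta> \<xi> (\<rho> x) \<eta>) \<longlongrightarrow> weight \<Lambda> \<Delta> \<xi> \<nu> \<eta>) F" for \<eta>
    unfolding weight_def by (intro lim' continuous_on_mult rate_continuous[OF \<Delta>] ind)
  have m: "((\<lambda>x. measure (\<rho> x) (cyl \<Lambda> \<eta>)) \<longlongrightarrow> measure \<nu> (cyl \<Lambda> \<eta>)) F" for \<eta>
  proof -
    have "\<forall>\<^sub>F x in F. (\<integral>\<omega>. indicator (cyl \<Lambda> \<eta>) \<omega> \<partial>\<rho> x) = measure (\<rho> x) (cyl \<Lambda> \<eta>)"
      using \<rho> by eventually_elim (use integral_scaled_indicator[OF _ cyl_borel, of _ 1] in simp)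
    moreover have "(\<integral>\<omega>. indicator (cyl \<Lambda> \<eta>) \<omega> \<partial>\<nu>) = measure \<nu> (cyl \<Lambda> \<eta>)"
      using integral_scaled_indicator[OF \<nu> cyl_borel, of 1] by simp
    ultimately show ?thesis using lim'[OF ind[of \<eta>]] by (simp add: tendsto_cong)
  qed
  have ne: "measure \<nu> A + \<epsilon> \<noteq> 0" for A using \<epsilon> measure_nonneg[of \<nu> A] by linarith
  have "((\<lambda>x. \<Sum>\<eta>\<in>patterns \<Lambda>. (potential \<Lambda> \<epsilon> (\<rho> x) (override_on \<eta> \<xi> \<Delta>) - potential \<Lambda> \<epsilon> (\<rho> x) \<eta>) *
      weight \<Lambda> \<Delta> \<xi> (\<rho> x) \<eta>) \<longlongrightarrow> gain \<Lambda> \<epsilon> \<Delta> \<xi> \<nu>) F"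
    unfolding gain_eq_sum[OF \<nu> \<Delta> \<Lambda>] potential_def
    by (intro tendsto_sum tendsto_mult tendsto_diff tendsto_ln tendsto_add tendsto_const m w ne)
  moreover have "\<forall>\<^sub>F x in F. gain \<Lambda> \<epsilon> \<Delta> \<xi> (\<rho> x) =
      (\<Sum>\<eta>\<in>patterns \<Lambda>. (potential \<Lambda> \<epsilon> (\<rho> x) (override_on \<eta> \<xi> \<Delta>) - potential \<Lambda> \<epsilon> (\<rho> x) \<eta>) *
      weight \<Lambda> \<Delta> \<xi> (\<rho> x) \<eta>)"
    using \<rho> by eventually_elim (rule gain_eq_sum[OF _ \<Delta> \<Lambda>])
  ultimately show ?thesis by (simp add: tendsto_cong)
qed

lemma gain_shift:
  assumes \<nu>: "\<nu> \<in> invariant_measures" and \<Delta>: "\<Delta> \<in> regions" "\<xi> \<in> patterns \<Delta>" and \<Lambda>: "finite \<Lambda>"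
  shows "gain (translate i \<Lambda>) \<epsilon> (translate i \<Delta>) (shift i \<xi>) \<nu> = gain \<Lambda> \<epsilon> \<Delta> \<xi> \<nu>"
proof -
  let ?L = "translate i \<Lambda>" and ?D = "translate i \<Delta>" and ?x = "shift i \<xi>"
  let ?f = "\<lambda>\<omega>. c ?D \<omega> ?x * (potential ?L \<epsilon> \<nu> (override_on \<omega> ?x ?D) - potential ?L \<epsilon> \<nu> \<omega>)"
  have "continuous_on UNIV ?f"
    using \<Delta> shift_pattern \<Lambda> by (intro continuous_intros rate_continuous potential_continuous) auto
  then have "(\<integral>\<omega>. ?f \<omega> \<partial>\<nu>) = (\<integral>\<omega>. ?f (shift i \<omega>) \<partial>\<nu>)"
    by (intro integral_shift[OF \<nu>, symmetric] borel_measurable_continuous_onI)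
  also have "(\<lambda>\<omega>. ?f (shift i \<omega>)) = (\<lambda>\<omega>. c \<Delta> \<omega> \<xi> * (potential \<Lambda> \<epsilon> \<nu> (override_on \<omega> \<xi> \<Delta>) - potential \<Lambda> \<epsilon> \<nu> \<omega>))"
    by (simp add: rate_shift[OF \<Delta>] override_on_shift potential_def measure_cyl_shift[OF \<nu>] measure_cyl_shift[OF mu_invariant])
  finally show ?thesis by (simp add: gain_def)
qed

end

section \<open>The time derivative of the relative entropy\<close>

context gibbs_ips
begin

text \<open>A region that misses \<open>\<Lambda>\<close> does not change \<open>g\<close>, and an
  inactive region has only trivial transitions.\<close>

lemma pregenerator_local:
  assumes \<Lambda>: "finite \<Lambda>" and g: "\<And>\<omega>. g (restrict \<omega> \<Lambda>) = g \<omega>"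
  shows "pregenerator c g \<omega> =
    (\<Sum>\<Delta>\<in>hitting \<Lambda>. \<Sum>\<xi>\<in>patterns \<Delta>. c \<Delta> \<omega> \<xi> * (g (override_on \<omega> \<xi> \<Delta>) - g \<omega>))"
proof -
  let ?h = "\<lambda>\<Delta>. \<Sum>\<xi>\<in>patterns \<Delta>. c \<Delta> \<omega> \<xi> * (g (override_on \<omega> \<xi> \<Delta>) - g \<omega>)"
  have 0: "?h \<Delta> = 0" if \<Delta>: "\<Delta> \<in> regions - hitting \<Lambda>" for \<Delta>
  proof (rule sum.neutral, rule ballI)
    fix \<xi> :: "('d, 'q) config" assume \<xi>: "\<xi> \<in> patterns \<Delta>"
    have "g (override_on \<omega> \<xi> \<Delta>) = g \<omega> \<or> c \<Delta> \<omega> \<xi> = 0"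
    proof (cases "\<Delta> \<in> active")
      case True
      then have "\<Delta> \<inter> \<Lambda> = {}" using \<Delta> by (auto simp: hitting_def)
      then have "restrict (override_on \<omega> \<xi> \<Delta>) \<Lambda> = restrict \<omega> \<Lambda>"
        by (auto simp: restrict_def override_on_def fun_eq_iff)
      then have "g (override_on \<omega> \<xi> \<Delta>) = g \<omega>" using g by metis
      then show ?thesis ..
    next
      case False
      show ?thesis
      proof (cases "\<xi> = restrict \<omega> \<Delta>")
        case True
        then have "override_on \<omega> \<xi> \<Delta> = \<omega>" by (simp add: override_on_def fun_eq_iff)
        then show ?thesis by simp
      next
        case ne: False
        then show ?thesis using inactive_rate[OF _ False \<xi> ne] \<Delta> by simp
      qed
    qed
    then show "c \<Delta> \<omega> \<xi> * (g (override_on \<omega> \<xi> \<Delta>) - g \<omega>) = 0" by auto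
  qed
  have "pregenerator c g \<omega> = infsum ?h (hitting \<Lambda>)"
    unfolding pregenerator_def
    by (rule infsum_cong_neutral) (use 0 in \<open>auto simp: hitting_def active_def\<close>)
  then show ?thesis using finite_hitting[OF \<Lambda>] by simp
qed

text \<open>Oscillations of a cylinder indicator vanish off \<open>\<Lambda>\<close>, so it lies in
  Liggett's domain, and the graph of the semigroup generator contains its pair by the closure
  condition.\<close>

lemma cyl_fun_generator:
  assumes P: "has_semigroup c P" and \<Lambda>: "finite \<Lambda>"
  shows "(cyl_fun \<Lambda> \<eta>, Bcontfun (pregenerator c (indicator (cyl \<Lambda> \<eta>)))) \<in> generator_graph P"
    and "continuous_on UNIV (pregenerator c (indicator (cyl \<Lambda> \<eta>)))"
proof -
  let ?f = "indicator (cyl \<Lambda> \<eta>) :: ('d, 'q) config \<Rightarrow> real"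
  have loc: "?f (restrict \<omega> \<Lambda>) = ?f \<omega>" for \<omega>
    by (simp add: indicator_def in_cyl)
  have cf: "continuous_on UNIV ?f" using \<Lambda> by (intro continuous_on_indicator_clopen open_cyl closed_cyl)
  have eq: "pregenerator c ?f =
      (\<lambda>\<omega>. \<Sum>\<Delta>\<in>hitting \<Lambda>. \<Sum>\<xi>\<in>patterns \<Delta>. c \<Delta> \<omega> \<xi> * (?f (override_on \<omega> \<xi> \<Delta>) - ?f \<omega>))"
    by (intro ext pregenerator_local \<Lambda> loc)
  show cont: "continuous_on UNIV (pregenerator c ?f)"
    unfolding eq
  proof (intro continuous_on_sum continuous_on_mult continuous_on_diff cf)
    fix \<Delta> and \<xi> :: "('d, 'q) config" assume \<Delta>: "\<Delta> \<in> hitting \<Lambda>" "\<xi> \<in> patterns \<Delta>"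
    then show "continuous_on UNIV (\<lambda>\<omega>. c \<Delta> \<omega> \<xi>)"
      by (intro rate_continuous) (auto simp: hitting_def active_def)
    show "continuous_on UNIV (\<lambda>\<omega>. ?f (override_on \<omega> \<xi> \<Delta>))"
      by (rule continuous_on_compose2[OF cf continuous_on_override]) simp
  qed
  have osc: "oscillation ?f x = 0" if "x \<notin> \<Lambda>" for x
  proof -
    have "ennreal \<bar>?f \<omega> - ?f \<zeta>\<bar> = 0" if "\<forall>y. y \<noteq> x \<longrightarrow> \<omega> y = \<zeta> y" for \<omega> \<zeta>
    proof -
      have "restrict \<omega> \<Lambda> = restrict \<zeta> \<Lambda>" using that \<open>x \<notin> \<Lambda>\<close> by (auto simp: restrict_def fun_eq_iff)
      then have "?f \<omega> = ?f \<zeta>" using loc by metis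
      then show ?thesis by simp
    qed
    then have "oscillation ?f x \<le> 0" unfolding oscillation_def by (intro SUP_least) auto
    then show ?thesis by simp
  qed
  have osc1: "oscillation ?f x \<le> 1" for x
    unfolding oscillation_def by (intro SUP_least) (auto simp: indicator_def)
  have "(\<Sum>\<^sub>\<infinity>x\<in>UNIV. oscillation ?f x) = (\<Sum>\<^sub>\<infinity>x\<in>\<Lambda>. oscillation ?f x)"
    by (rule infsum_cong_neutral) (use osc in auto)
  also have "\<dots> = (\<Sum>x\<in>\<Lambda>. oscillation ?f x)" using \<Lambda> by simp
  also have "\<dots> \<le> (\<Sum>x\<in>\<Lambda>. 1)" by (intro sum_mono osc1)
  also have "\<dots> < \<infinity>" by (simp add: of_nat_less_top)
  finally have "cyl_fun \<Lambda> \<eta> \<in> smooth_functions" using \<Lambda> by (simp add: smooth_functions_def)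
  then have "(cyl_fun \<Lambda> \<eta>, Bcontfun (pregenerator c ?f)) \<in>
     {(f, g). f \<in> smooth_functions \<and> apply_bcontfun g = pregenerator c (apply_bcontfun f)}"
    using \<Lambda> by (simp add: apply_Bcontfun_continuous[OF cont])
  moreover have "generator_graph P = closure
     {(f, g). f \<in> smooth_functions \<and> apply_bcontfun g = pregenerator c (apply_bcontfun f)}"
    using P by (simp add: has_semigroup_def)
  ultimately show "(cyl_fun \<Lambda> \<eta>, Bcontfun (pregenerator c ?f)) \<in> generator_graph P"
    using subsetD[OF closure_subset] by (simp only:)
qed

text \<open>Only the factor attached to the logarithm of \<open>\<nu>\<close> is regularised: the
  derivative of each summand in the cell probability is then exactly
  \<open>potential + 1\<close>.\<close>

definition rel_entropy :: "'d site set \<Rightarrow> real \<Rightarrow> ('d, 'q) config measure \<Rightarrow> real" where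
  "rel_entropy \<Lambda> \<epsilon> \<nu> = (\<Sum>\<eta>\<in>patterns \<Lambda>. (measure \<nu> (cyl \<Lambda> \<eta>) + \<epsilon>) * ln (measure \<nu> (cyl \<Lambda> \<eta>) + \<epsilon>) -
     measure \<nu> (cyl \<Lambda> \<eta>) * ln (measure \<mu> (cyl \<Lambda> \<eta>)))"

definition total_gain :: "'d site set \<Rightarrow> real \<Rightarrow> ('d, 'q) config measure \<Rightarrow> real" where
  "total_gain \<Lambda> \<epsilon> \<nu> = (\<Sum>\<Delta>\<in>hitting \<Lambda>. \<Sum>\<xi>\<in>patterns \<Delta>. gain \<Lambda> \<epsilon> \<Delta> \<xi> \<nu>)"

text \<open>Summing over patterns replaces each indicator by the value of
  \<open>potential + 1\<close> at the configuration, before and after a transition; the constant 1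
  cancels in the difference.\<close>

lemma sum_pregenerator_eq_total_gain:
  assumes \<nu>: "\<nu> \<in> prob_measures" and \<Lambda>: "finite \<Lambda>"
  shows "(\<Sum>\<eta>\<in>patterns \<Lambda>. (potential \<Lambda> \<epsilon> \<nu> \<eta> + 1) * (\<integral>\<omega>. pregenerator c (indicator (cyl \<Lambda> \<eta>)) \<omega> \<partial>\<nu>))
    = total_gain \<Lambda> \<epsilon> \<nu>"
proof -
  let ?p = "\<lambda>\<omega>. potential \<Lambda> \<epsilon> \<nu> \<omega> + 1"
  let ?f = "\<lambda>\<eta>. indicator (cyl \<Lambda> \<eta>) :: ('d, 'q) config \<Rightarrow> real"
  let ?t = "\<lambda>\<Delta> \<xi> \<eta> \<omega>. c \<Delta> \<omega> \<xi> * (?f \<eta> (override_on \<omega> \<xi> \<Delta>) - ?f \<eta> \<omega>)"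
  have cf: "continuous_on UNIV (?f \<eta>)" for \<eta>
    using \<Lambda> by (intro continuous_on_indicator_clopen open_cyl closed_cyl)
  have reg: "\<Delta> \<in> regions" if "\<Delta> \<in> hitting \<Lambda>" for \<Delta> using that by (simp add: hitting_def active_def)
  have int: "integrable \<nu> (?t \<Delta> \<xi> \<eta>)" if "\<Delta> \<in> hitting \<Lambda>" "\<xi> \<in> patterns \<Delta>" for \<Delta> \<xi> \<eta>
    by (intro rate_integrable \<nu> reg that continuous_on_diff cf continuous_on_compose2[OF cf continuous_on_override]) simp
  have loc: "?f \<eta> (restrict \<omega> \<Lambda>) = ?f \<eta> \<omega>" for \<eta> \<omega> by (simp add: indicator_def in_cyl)
  have L: "(\<integral>\<omega>. pregenerator c (?f \<eta>) \<omega> \<partial>\<nu>) = (\<Sum>\<Delta>\<in>hitting \<Lambda>. \<Sum>\<xi>\<in>patterns \<Delta>. \<integral>\<omega>. ?t \<Delta> \<xi> \<eta> \<omega> \<partial>\<nu>)" for \<eta>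
  proof -
    have "(\<integral>\<omega>. pregenerator c (?f \<eta>) \<omega> \<partial>\<nu>) = (\<integral>\<omega>. (\<Sum>\<Delta>\<in>hitting \<Lambda>. \<Sum>\<xi>\<in>patterns \<Delta>. ?t \<Delta> \<xi> \<eta> \<omega>) \<partial>\<nu>)"
      by (intro Bochner_Integration.integral_cong refl pregenerator_local[of \<Lambda> "?f \<eta>"] \<Lambda> loc)
    also have "\<dots> = (\<Sum>\<Delta>\<in>hitting \<Lambda>. \<integral>\<omega>. (\<Sum>\<xi>\<in>patterns \<Delta>. ?t \<Delta> \<xi> \<eta> \<omega>) \<partial>\<nu>)"
      by (intro Bochner_Integration.integral_sum Bochner_Integration.integrable_sum int)
    also have "\<dots> = (\<Sum>\<Delta>\<in>hitting \<Lambda>. \<Sum>\<xi>\<in>patterns \<Delta>. \<integral>\<omega>. ?t \<Delta> \<xi> \<eta> \<omega> \<partial>\<nu>)"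
      by (intro sum.cong refl Bochner_Integration.integral_sum int)
    finally show ?thesis .
  qed
  have one: "(\<Sum>\<eta>\<in>patterns \<Lambda>. ?p \<eta> * (\<integral>\<omega>. ?t \<Delta> \<xi> \<eta> \<omega> \<partial>\<nu>)) = gain \<Lambda> \<epsilon> \<Delta> \<xi> \<nu>"
    if \<Delta>: "\<Delta> \<in> hitting \<Lambda>" "\<xi> \<in> patterns \<Delta>" for \<Delta> \<xi>
  proof -
    have "(\<Sum>\<eta>\<in>patterns \<Lambda>. ?p \<eta> * (\<integral>\<omega>. ?t \<Delta> \<xi> \<eta> \<omega> \<partial>\<nu>)) = (\<Sum>\<eta>\<in>patterns \<Lambda>. \<integral>\<omega>. ?p \<eta> * ?t \<Delta> \<xi> \<eta> \<omega> \<partial>\<nu>)"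
      by (simp only: integral_mult_right_zero)
    also have "\<dots> = (\<integral>\<omega>. (\<Sum>\<eta>\<in>patterns \<Lambda>. ?p \<eta> * ?t \<Delta> \<xi> \<eta> \<omega>) \<partial>\<nu>)"
      by (rule Bochner_Integration.integral_sum[symmetric]) (intro integrable_mult_right int \<Delta>)
    also have "\<dots> = gain \<Lambda> \<epsilon> \<Delta> \<xi> \<nu>"
      unfolding gain_def
    proof (intro Bochner_Integration.integral_cong refl)
      fix \<omega>
      have s: "(\<Sum>\<eta>\<in>patterns \<Lambda>. ?p \<eta> * ?f \<eta> \<omega>) = ?p \<omega>" for \<omega>
        using sum_patterns_indicator[OF \<Lambda>, of ?p \<omega>] by (simp only: potential_restrict)
      have "(\<Sum>\<eta>\<in>patterns \<Lambda>. ?p \<eta> * ?t \<Delta> \<xi> \<eta> \<omega>) =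
          c \<Delta> \<omega> \<xi> * ((\<Sum>\<eta>\<in>patterns \<Lambda>. ?p \<eta> * ?f \<eta> (override_on \<omega> \<xi> \<Delta>)) - (\<Sum>\<eta>\<in>patterns \<Lambda>. ?p \<eta> * ?f \<eta> \<omega>))"
        unfolding sum_subtractf[symmetric] sum_distrib_left
        by (intro sum.cong refl) (simp add: algebra_simps)
      then show "(\<Sum>\<eta>\<in>patterns \<Lambda>. ?p \<eta> * ?t \<Delta> \<xi> \<eta> \<omega>) =
          c \<Delta> \<omega> \<xi> * (potential \<Lambda> \<epsilon> \<nu> (override_on \<omega> \<xi> \<Delta>) - potential \<Lambda> \<epsilon> \<nu> \<omega>)"
        unfolding s by simp
    qed
    finally show ?thesis .
  qed
  have "(\<Sum>\<eta>\<in>patterns \<Lambda>. ?p \<eta> * (\<integral>\<omega>. pregenerator c (?f \<eta>) \<omega> \<partial>\<nu>)) =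
      (\<Sum>\<Delta>\<in>hitting \<Lambda>. \<Sum>\<xi>\<in>patterns \<Delta>. \<Sum>\<eta>\<in>patterns \<Lambda>. ?p \<eta> * (\<integral>\<omega>. ?t \<Delta> \<xi> \<eta> \<omega> \<partial>\<nu>))"
    unfolding L sum_distrib_left
    by (subst sum.swap) (intro sum.cong refl sum.swap)
  also have "\<dots> = total_gain \<Lambda> \<epsilon> \<nu>" unfolding total_gain_def by (intro sum.cong refl one)
  finally show ?thesis .
qed

lemma rel_entropy_derivative:
  assumes P: "has_semigroup c P" and \<Lambda>: "finite \<Lambda>" and \<nu>: "\<nu> \<in> prob_measures"
    and \<epsilon>: "0 < \<epsilon>" and r: "0 \<le> r"
  shows "((\<lambda>t. rel_entropy \<Lambda> \<epsilon> (evolve P t \<nu>)) has_real_derivative total_gain \<Lambda> \<epsilon> (evolve P r \<nu>)) (at r within {0..})"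
proof -
  have F: "feller_semigroup P" using P by (simp add: has_semigroup_def)
  let ?x = "\<lambda>\<eta> t. measure (evolve P t \<nu>) (cyl \<Lambda> \<eta>)"
  let ?L = "\<lambda>\<eta>. \<integral>\<omega>. pregenerator c (indicator (cyl \<Lambda> \<eta>)) \<omega> \<partial>evolve P r \<nu>"
  have x: "(?x \<eta> has_real_derivative ?L \<eta>) (at r within {0..})" for \<eta>
  proof -
    have "((\<lambda>t. \<integral>\<omega>. apply_bcontfun (cyl_fun \<Lambda> \<eta>) \<omega> \<partial>evolve P t \<nu>) has_real_derivative ?L \<eta>) (at r within {0..})"
      using evolve_derivative[OF F \<nu> r cyl_fun_generator(1)[OF P \<Lambda>, of \<eta>]]
      by (simp only: apply_Bcontfun_continuous[OF cyl_fun_generator(2)[OF P \<Lambda>]])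
    then show ?thesis
    proof (rule has_field_derivative_transform_within[OF _ zero_less_one])
      fix t :: real assume "t \<in> {0..}"
      then have "evolve P t \<nu> \<in> prob_measures" using evolve_prob[OF F _ \<nu>] by simp
      then show "(\<integral>\<omega>. apply_bcontfun (cyl_fun \<Lambda> \<eta>) \<omega> \<partial>evolve P t \<nu>) = ?x \<eta> t"
        using integral_scaled_indicator[OF _ cyl_borel, of _ 1] \<Lambda> by simp
    qed (use r in simp)
  qed
  have pos: "0 < ?x \<eta> r + \<epsilon>" for \<eta> using \<epsilon> by (simp add: add_nonneg_pos)
  have "((\<lambda>t. rel_entropy \<Lambda> \<epsilon> (evolve P t \<nu>)) has_real_derivative
     (\<Sum>\<eta>\<in>patterns \<Lambda>. (potential \<Lambda> \<epsilon> (evolve P r \<nu>) \<eta> + 1) * ?L \<eta>)) (at r within {0..})"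
    unfolding rel_entropy_def
  proof (rule DERIV_sum)
    fix \<eta> :: "('d, 'q) config"
    let ?k = "ln (measure \<mu> (cyl \<Lambda> \<eta>))"
    have "((\<lambda>z. (z + \<epsilon>) * ln (z + \<epsilon>) - z * ?k) has_real_derivative ln (?x \<eta> r + \<epsilon>) + 1 - ?k) (at (?x \<eta> r))"
      using pos[of \<eta>] by (auto intro!: derivative_eq_intros)
    from DERIV_chain2[OF this x]
    show "((\<lambda>t. (?x \<eta> t + \<epsilon>) * ln (?x \<eta> t + \<epsilon>) - ?x \<eta> t * ?k) has_real_derivative
        (potential \<Lambda> \<epsilon> (evolve P r \<nu>) \<eta> + 1) * ?L \<eta>) (at r within {0..})"
      by (simp add: potential_def algebra_simps)
  qed
  then show ?thesis
    by (simp only: sum_pregenerator_eq_total_gain[OF evolve_prob[OF F r \<nu>] \<Lambda>])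
qed

text \<open>The upper bound uses \<open>ln (x + \<epsilon>) \<le> 1\<close> and the lower bound on
  \<open>\<mu>\<close>. The lower bound is Gibbs' inequality for the regularised masses; the
  leftover \<open>\<epsilon> * ln\<close> terms are absorbed because the total regularising mass is
  at most 1.\<close>

lemma rel_entropy_bounds:
  assumes \<Lambda>: "finite \<Lambda>" and \<nu>: "\<nu> \<in> prob_measures"
    and \<epsilon>: "0 < \<epsilon>" "\<epsilon> * real (card (patterns \<Lambda> :: ('d, 'q) config set)) \<le> 1"
  shows "rel_entropy \<Lambda> \<epsilon> \<nu> \<le> 2 - real (card \<Lambda>) * ln site_bound" "real (card \<Lambda>) * ln site_bound \<le> rel_entropy \<Lambda> \<epsilon> \<nu>"
proof -
  interpret N: prob_space \<nu> by (rule prob_measuresD[OF \<nu>])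
  let ?P = "patterns \<Lambda> :: ('d, 'q) config set"
  let ?x = "\<lambda>\<eta>. measure \<nu> (cyl \<Lambda> \<eta>)" and ?m = "\<lambda>\<eta>. measure \<mu> (cyl \<Lambda> \<eta>)"
  let ?k = "real (card \<Lambda>) * ln site_bound"
  have total: "(\<Sum>\<eta>\<in>patterns \<Lambda>. measure M (cyl \<Lambda> \<eta>)) = 1" if "M \<in> prob_measures" for M :: "('d, 'q) config measure"
    using sum_measure_patterns[OF that \<Lambda>, of UNIV] prob_space.prob_space[OF prob_measuresD(1)[OF that]]
      prob_measuresD(3)[OF that] by simp
  have m: "?k \<le> ln (?m \<eta>)" "ln (?m \<eta>) \<le> 0" "0 < ?m \<eta>" for \<eta>
  proof -
    show p: "0 < ?m \<eta>" by (rule mu_pos[OF \<Lambda>])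
    have "ln (site_bound ^ card \<Lambda>) \<le> ln (?m \<eta>)"
      using mu_lower[OF \<Lambda>, of \<eta>] site_bound(1) by (intro ln_mono) auto
    then show "?k \<le> ln (?m \<eta>)" using site_bound(1) by (simp add: ln_realpow)
    show "ln (?m \<eta>) \<le> 0" using p mu_le_1 by simp
  qed
  have "card ?P > 0" using \<Lambda> by (simp add: card_gt_0_iff)
  then have "\<epsilon> * 1 \<le> \<epsilon> * real (card ?P)" using \<epsilon>(1) by (intro mult_left_mono) auto
  then have \<epsilon>1: "\<epsilon> \<le> 1" using \<epsilon>(2) by simp
  have "rel_entropy \<Lambda> \<epsilon> \<nu> \<le> (\<Sum>\<eta>\<in>?P. (?x \<eta> + \<epsilon>) - ?x \<eta> * ?k)"
    unfolding rel_entropy_def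
  proof (rule sum_mono)
    fix \<eta>
    have p: "0 < ?x \<eta> + \<epsilon>" using \<epsilon> by (simp add: add_nonneg_pos)
    have "ln (?x \<eta> + \<epsilon>) \<le> ?x \<eta> + \<epsilon> - 1" using p by (rule ln_le_minus_one)
    also have "\<dots> \<le> 1" using \<epsilon>1 N.prob_le_1[of "cyl \<Lambda> \<eta>"] by linarith
    finally have "(?x \<eta> + \<epsilon>) * ln (?x \<eta> + \<epsilon>) \<le> (?x \<eta> + \<epsilon>) * 1" using p by (intro mult_left_mono) auto
    moreover have "?x \<eta> * ?k \<le> ?x \<eta> * ln (?m \<eta>)" using m by (intro mult_left_mono) auto
    ultimately show "(?x \<eta> + \<epsilon>) * ln (?x \<eta> + \<epsilon>) - ?x \<eta> * ln (?m \<eta>) \<le> (?x \<eta> + \<epsilon>) - ?x \<eta> * ?k" by simp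
  qed
  also have "\<dots> = 1 + \<epsilon> * real (card ?P) - ?k"
    by (simp only: sum_subtractf sum.distrib sum_distrib_right[symmetric] total[OF \<nu>] sum_constant mult.commute[of \<epsilon>] mult_1)
  finally show "rel_entropy \<Lambda> \<epsilon> \<nu> \<le> 2 - ?k" using \<epsilon>(2) by simp
  have "\<epsilon> * real (card ?P) + \<epsilon> * real (card ?P) * ?k = (\<Sum>\<eta>\<in>?P. (?x \<eta> + \<epsilon> - ?m \<eta>) + \<epsilon> * ?k)"
    by (simp only: sum_subtractf sum.distrib total[OF \<nu>] total[OF mu_prob] sum_constant) (simp add: algebra_simps)
  also have "\<dots> \<le> rel_entropy \<Lambda> \<epsilon> \<nu>"
    unfolding rel_entropy_def
  proof (rule sum_mono)
    fix \<eta>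
    define z where "z = ?x \<eta> + \<epsilon>"
    have z: "0 < z" using \<epsilon> by (simp add: z_def add_nonneg_pos)
    have "ln (?m \<eta> / z) \<le> ?m \<eta> / z - 1" using z m(3)[of \<eta>] by (intro ln_le_minus_one) simp
    then have "ln (?m \<eta>) - ln z \<le> ?m \<eta> / z - 1" using z m(3)[of \<eta>] by (simp add: ln_div)
    then have "z * (ln (?m \<eta>) - ln z) \<le> z * (?m \<eta> / z - 1)" using z by (intro mult_left_mono) auto
    then have "z - ?m \<eta> \<le> z * ln z - z * ln (?m \<eta>)" using z by (simp add: right_diff_distrib)
    moreover have "\<epsilon> * ?k \<le> \<epsilon> * ln (?m \<eta>)" using m \<epsilon> by (intro mult_left_mono) auto
    ultimately show "(?x \<eta> + \<epsilon> - ?m \<eta>) + \<epsilon> * ?k \<le> (?x \<eta> + \<epsilon>) * ln (?x \<eta> + \<epsilon>) - ?x \<eta> * ln (?m \<eta>)"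
      by (simp add: z_def algebra_simps)
  qed
  finally have "\<epsilon> * real (card ?P) + \<epsilon> * real (card ?P) * ?k \<le> rel_entropy \<Lambda> \<epsilon> \<nu>" .
  moreover have "1 * ?k \<le> \<epsilon> * real (card ?P) * ?k"
    using \<epsilon>(2) site_bound by (intro mult_right_mono_neg) (auto simp: mult_nonneg_nonpos)
  moreover have "0 \<le> \<epsilon> * real (card ?P)" using \<epsilon> by simp
  ultimately show "?k \<le> rel_entropy \<Lambda> \<epsilon> \<nu>" by linarith
qed

end

section \<open>The approximating loss as a limit of gains\<close>

lemma lattice_cube_eq: "(lattice_cube m :: ('d::finite) site set) = vec_lambda ` (\<Pi>\<^sub>E k\<in>UNIV. {- m..m})"
proof
  show "(lattice_cube m :: 'd site set) \<subseteq> vec_lambda ` (\<Pi>\<^sub>E k\<in>UNIV. {- m..m})"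
  proof
    fix x :: "'d site" assume "x \<in> lattice_cube m"
    then have "vec_nth x \<in> (\<Pi>\<^sub>E k\<in>UNIV. {- m..m})" by (auto simp: lattice_cube_def)
    then show "x \<in> vec_lambda ` (\<Pi>\<^sub>E k\<in>UNIV. {- m..m})" by (intro image_eqI[of _ _ "vec_nth x"]) simp_all
  qed
qed (auto simp: lattice_cube_def PiE_iff)

lemma finite_lattice_cube [simp]: "finite (lattice_cube m)"
  unfolding lattice_cube_eq by (intro finite_imageI finite_PiE) auto

lemma card_lattice_cube: "card (lattice_cube m :: ('d::finite) site set) = nat (2 * m + 1) ^ CARD('d)"
proof -
  have "inj_on vec_lambda (\<Pi>\<^sub>E k\<in>(UNIV :: 'd set). {- m..m})"
    by (rule inj_onI) (metis vec_lambda_inverse UNIV_I)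
  then show ?thesis unfolding lattice_cube_eq by (simp add: card_image card_PiE)
qed

lemma finite_Lam [simp]: "finite (Lam n)" and finite_Lam_inner [simp]: "finite (Lam_inner n)"
  by (simp_all add: Lam_def Lam_inner_def)

lemma lattice_cube_mono:
  assumes "m \<le> m'"
  shows "lattice_cube m \<subseteq> lattice_cube m'"
proof
  fix x :: "(int, 'a) vec" assume x: "x \<in> lattice_cube m"
  have "- m' \<le> x $ k \<and> x $ k \<le> m'" for k
  proof -
    have "- m \<le> x $ k \<and> x $ k \<le> m" using x by (simp add: lattice_cube_def)
    with assms show ?thesis by linarith
  qed
  then show "x \<in> lattice_cube m'" by (simp add: lattice_cube_def)
qed

lemma finite_subset_lattice_cube:
  assumes "finite (A :: ('d::finite) site set)"
  obtains R :: nat where "A \<subseteq> lattice_cube (int R)"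
proof -
  define R where "R = nat (\<Sum>x\<in>A. \<Sum>k\<in>UNIV. \<bar>x $ k\<bar>)"
  have nonneg: "0 \<le> (\<Sum>x\<in>A. \<Sum>k\<in>UNIV. \<bar>x $ k\<bar>)" by (intro sum_nonneg) auto
  have "\<bar>x $ k\<bar> \<le> int R" if "x \<in> A" for x k
  proof -
    have "\<bar>x $ k\<bar> \<le> (\<Sum>k\<in>UNIV. \<bar>x $ k\<bar>)" by (rule member_le_sum) auto
    also have "\<dots> \<le> (\<Sum>x\<in>A. \<Sum>k\<in>UNIV. \<bar>x $ k\<bar>)"
      using assms that by (intro member_le_sum[where f = "\<lambda>x. \<Sum>k\<in>UNIV. \<bar>x $ k\<bar>"]) (auto intro: sum_nonneg)
    finally show ?thesis unfolding R_def using nonneg by simp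
  qed
  then have "A \<subseteq> lattice_cube (int R)"
    unfolding lattice_cube_def abs_le_iff by (smt (verit) mem_Collect_eq subsetI)
  then show ?thesis by (rule that)
qed

lemma lattice_cube_add:
  assumes "x \<in> lattice_cube a" "y \<in> lattice_cube b"
  shows "x + y \<in> lattice_cube (a + b)"
  unfolding lattice_cube_def
proof (intro CollectI allI)
  fix k
  have "- a \<le> x $ k \<and> x $ k \<le> a" "- b \<le> y $ k \<and> y $ k \<le> b" using assms by (auto simp: lattice_cube_def)
  then show "- (a + b) \<le> (x + y) $ k \<and> (x + y) $ k \<le> a + b" by simp
qed

lemma card_Lam: "real (card (Lam n :: ('d::finite) site set)) = (2 * 2 ^ n - 1) ^ CARD('d)"
proof -
  have "(1 :: int) \<le> 2 ^ n" by simp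
  then show ?thesis by (simp add: Lam_def card_lattice_cube)
qed

lemma card_Lam_pos: "0 < real (card (Lam n :: ('d::finite) site set))"
proof -
  have "(1 :: real) \<le> 2 ^ n" by simp
  then have "(0 :: real) < 2 * 2 ^ n - 1" by linarith
  then show ?thesis unfolding card_Lam by (rule zero_less_power)
qed

text \<open>Serves twice, for the inner cubes of the approximating loss and for the sites whose
  neighbourhood of a fixed size lies within a large cube: both omit a vanishing fraction of
  sites.\<close>

lemma lattice_cube_Lam_ratio:
  assumes "(\<lambda>n. real_of_int (f n) / 2 ^ n) \<longlonglongrightarrow> 1"
  shows "(\<lambda>n. real (card (lattice_cube (f n) :: ('d::finite) site set)) / real (card (Lam n :: 'd site set))) \<longlonglongrightarrow> 1"
proof -
  have p: "(\<lambda>n. 1 / 2 ^ n :: real) \<longlonglongrightarrow> 0" by (rule LIMSEQ_divide_realpow_zero) simp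
  have "(\<lambda>n. ((2 * (real_of_int (f n) / 2 ^ n) + 1 / 2 ^ n) / (2 - 1 / 2 ^ n)) ^ CARD('d)) \<longlonglongrightarrow> ((2 * 1 + 0) / (2 - 0)) ^ CARD('d)"
    by (intro tendsto_intros assms p) simp
  then have lim: "(\<lambda>n. ((2 * (real_of_int (f n) / 2 ^ n) + 1 / 2 ^ n) / (2 - 1 / 2 ^ n)) ^ CARD('d)) \<longlonglongrightarrow> 1" by simp
  have "\<forall>\<^sub>F n in sequentially. 0 < real_of_int (f n) / 2 ^ n"
    using assms by (rule order_tendstoD) simp
  then have "\<forall>\<^sub>F n in sequentially. ((2 * (real_of_int (f n) / 2 ^ n) + 1 / 2 ^ n) / (2 - 1 / 2 ^ n)) ^ CARD('d)
     = real (card (lattice_cube (f n) :: 'd site set)) / real (card (Lam n :: 'd site set))"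
  proof eventually_elim
    fix n assume "0 < real_of_int (f n) / 2 ^ n"
    then have f: "0 < f n" by (simp add: zero_less_divide_iff)
    have e1: "real (card (lattice_cube (f n) :: 'd site set)) = (2 * real_of_int (f n) + 1) ^ CARD('d)"
      using f by (simp add: card_lattice_cube)
    have "(2 * (real_of_int (f n) / 2 ^ n) + 1 / 2 ^ n) / (2 - 1 / 2 ^ n) = (2 * real_of_int (f n) + 1) / (2 * 2 ^ n - 1)"
    proof -
      have "(2 * (real_of_int (f n) / 2 ^ n) + 1 / 2 ^ n) = (2 * real_of_int (f n) + 1) / 2 ^ n"
        "(2 - 1 / 2 ^ n :: real) = (2 * 2 ^ n - 1) / 2 ^ n" by (simp_all add: add_divide_distrib diff_divide_distrib)
      then show ?thesis by simp
    qed
    then show "((2 * (real_of_int (f n) / 2 ^ n) + 1 / 2 ^ n) / (2 - 1 / 2 ^ n)) ^ CARD('d)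
     = real (card (lattice_cube (f n) :: 'd site set)) / real (card (Lam n :: 'd site set))"
      unfolding e1 card_Lam by (simp add: power_divide)
  qed
  then show ?thesis using lim by (rule Lim_transform_eventually[rotated])
qed

text \<open>Extended addition fails to be continuous only where opposite infinities meet. Excluding
  \<open>\<infinity>\<close> avoids this; negating the summands turns the exclusion into that of
  \<open>- \<infinity>\<close>, for which continuity of addition is stated.\<close>

lemma tendsto_sum_ereal_not_PInfty:
  fixes f :: "'i \<Rightarrow> 'x \<Rightarrow> ereal"
  assumes "finite I" "\<And>i. i \<in> I \<Longrightarrow> (f i \<longlongrightarrow> l i) F" "\<And>i. i \<in> I \<Longrightarrow> l i \<noteq> \<infinity>"
    and "\<And>i x. i \<in> I \<Longrightarrow> f i x \<noteq> \<infinity>"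
  shows "((\<lambda>x. \<Sum>i\<in>I. f i x) \<longlongrightarrow> (\<Sum>i\<in>I. l i)) F \<and> (\<Sum>i\<in>I. l i) \<noteq> \<infinity>"
proof -
  have not_inf: "(\<Sum>i\<in>J. g i) \<noteq> \<infinity>" if "J \<subseteq> I" "\<And>i. i \<in> J \<Longrightarrow> g i \<noteq> \<infinity>" for J and g :: "'i \<Rightarrow> ereal"
    using that by (auto simp: sum_Pinfty)
  have minus: "- (- a + - b) = a + b" if "a \<noteq> \<infinity>" "b \<noteq> \<infinity>" for a b :: ereal
    using that by (cases a; cases b) auto
  have "((\<lambda>x. \<Sum>i\<in>J. f i x) \<longlongrightarrow> (\<Sum>i\<in>J. l i)) F" if "finite J" "J \<subseteq> I" for J
    using that
  proof (induction J rule: finite_induct)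
    case (insert i J)
    then have i: "i \<in> I" and J: "J \<subseteq> I" by auto
    have "((\<lambda>x. - (- f i x + - (\<Sum>i\<in>J. f i x))) \<longlongrightarrow> - (- l i + - (\<Sum>i\<in>J. l i))) F"
    proof (intro tendsto_uminus_ereal tendsto_add_ereal_nonneg)
      show "(f i \<longlongrightarrow> l i) F" by (rule assms(2)[OF i])
      show "((\<lambda>x. \<Sum>i\<in>J. f i x) \<longlongrightarrow> (\<Sum>i\<in>J. l i)) F" by (rule insert.IH[OF J])
      show "- l i \<noteq> - \<infinity>" using assms(3)[OF i] by simp
      have "(\<Sum>i\<in>J. l i) \<noteq> \<infinity>" using J assms(3) by (intro not_inf) auto
      then show "- (\<Sum>i\<in>J. l i) \<noteq> - \<infinity>" by simp
    qed
    moreover have "- (- f i x + - (\<Sum>i\<in>J. f i x)) = (\<Sum>i\<in>insert i J. f i x)" for x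
    proof -
      have "(\<Sum>i\<in>J. f i x) \<noteq> \<infinity>" using J assms(4) by (intro not_inf) blast+
      then show ?thesis using insert.hyps minus[OF assms(4)[OF i]] by simp
    qed
    moreover have "- (- l i + - (\<Sum>i\<in>J. l i)) = (\<Sum>i\<in>insert i J. l i)"
    proof -
      have "(\<Sum>i\<in>J. l i) \<noteq> \<infinity>" using J assms(3) by (intro not_inf) blast+
      then show ?thesis using insert.hyps minus[OF assms(3)[OF i]] by simp
    qed
    ultimately show ?case by simp
  qed simp
  then show ?thesis using assms(1,3) not_inf by blast
qed

section \<open>Regularised gains and the loss integrand\<close>

context gibbs_ips
begin

text \<open>Only finitely many cells can be null, so their union is null. Conditional probabilities
  given null events thus matter on a null set only.\<close>

lemma AE_cyl_pos:
  assumes \<nu>: "\<nu> \<in> prob_measures" and \<Lambda>: "finite \<Lambda>"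
  shows "AE \<omega> in \<nu>. 0 < measure \<nu> (cyl \<Lambda> \<omega>)"
proof -
  interpret N: prob_space \<nu> by (rule prob_measuresD[OF \<nu>])
  have s: "cyl \<Lambda> \<eta> \<in> N.events" for \<eta> unfolding prob_measuresD(2)[OF \<nu>] by (rule cyl_borel)
  have "AE \<omega> in \<nu>. \<forall>\<eta>\<in>{\<eta> \<in> patterns \<Lambda>. measure \<nu> (cyl \<Lambda> \<eta>) = 0}. \<omega> \<notin> cyl \<Lambda> \<eta>"
  proof (rule AE_finite_allI)
    show "finite {\<eta> \<in> patterns \<Lambda>. measure \<nu> (cyl \<Lambda> \<eta>) = 0}" using \<Lambda> by simp
    fix \<eta> assume "\<eta> \<in> {\<eta> \<in> patterns \<Lambda>. measure \<nu> (cyl \<Lambda> \<eta>) = 0}"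
    then have "cyl \<Lambda> \<eta> \<in> null_sets \<nu>" using s N.emeasure_eq_measure by (auto simp: null_sets_def)
    then show "AE \<omega> in \<nu>. \<omega> \<notin> cyl \<Lambda> \<eta>" by (rule AE_not_in)
  qed
  then show ?thesis
  proof eventually_elim
    fix \<omega> assume *: "\<forall>\<eta>\<in>{\<eta> \<in> patterns \<Lambda>. measure \<nu> (cyl \<Lambda> \<eta>) = 0}. \<omega> \<notin> cyl \<Lambda> \<eta>"
    have "measure \<nu> (cyl \<Lambda> \<omega>) \<noteq> 0"
    proof
      assume "measure \<nu> (cyl \<Lambda> \<omega>) = 0"
      then have "restrict \<omega> \<Lambda> \<in> {\<eta> \<in> patterns \<Lambda>. measure \<nu> (cyl \<Lambda> \<eta>) = 0}" by simp
      with * have "\<omega> \<notin> cyl \<Lambda> (restrict \<omega> \<Lambda>)" by blast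
      then show False by simp
    qed
    then show "0 < measure \<nu> (cyl \<Lambda> \<omega>)" using measure_nonneg[of \<nu> "cyl \<Lambda> \<omega>"] by linarith
  qed
qed

definition loss_ratio :: "'d site set \<Rightarrow> 'd site set \<Rightarrow> ('d, 'q) config \<Rightarrow> ('d, 'q) config measure \<Rightarrow> ('d, 'q) config \<Rightarrow> real" where
  "loss_ratio \<Lambda> \<Delta> \<xi> \<nu> \<omega> = (cond_cyl \<nu> (\<Delta> \<inter> \<Lambda>) \<xi> (\<Lambda> - \<Delta>) \<omega> * cond_cyl \<mu> (\<Delta> \<inter> \<Lambda>) \<omega> (\<Lambda> - \<Delta>) \<omega>) /
     (cond_cyl \<nu> (\<Delta> \<inter> \<Lambda>) \<omega> (\<Lambda> - \<Delta>) \<omega> * cond_cyl \<mu> (\<Delta> \<inter> \<Lambda>) \<xi> (\<Lambda> - \<Delta>) \<omega>)"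

lemma loss_integrand_eq:
  "loss_integrand c \<nu> \<mu> n \<Delta> \<xi> \<omega> =
    (if 0 < c \<Delta> \<omega> \<xi> then ereal (c \<Delta> \<omega> \<xi>) * elog (loss_ratio (Lam n) \<Delta> \<xi> \<nu> \<omega>) else 0)"
  by (simp add: loss_integrand_def loss_ratio_def)

text \<open>All four conditional probabilities have conditioning events over
  \<open>\<Lambda> - \<Delta>\<close>, and the common denominators cancel within
  \<open>\<nu>\<close> and within \<open>\<mu>\<close>.\<close>

lemma loss_ratio_eq:
  assumes \<nu>: "\<nu> \<in> prob_measures" and \<Lambda>: "finite \<Lambda>" and x: "0 < measure \<nu> (cyl \<Lambda> \<omega>)"
  shows "loss_ratio \<Lambda> \<Delta> \<xi> \<nu> \<omega> = measure \<nu> (cyl \<Lambda> (override_on \<omega> \<xi> \<Delta>)) * measure \<mu> (cyl \<Lambda> \<omega>) /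
    (measure \<nu> (cyl \<Lambda> \<omega>) * measure \<mu> (cyl \<Lambda> (override_on \<omega> \<xi> \<Delta>)))"
proof -
  interpret N: prob_space \<nu> by (rule prob_measuresD[OF \<nu>])
  let ?R = "\<Lambda> - \<Delta>"
  have 1: "cyl (\<Delta> \<inter> \<Lambda>) \<xi> \<inter> cyl ?R \<omega> = cyl \<Lambda> (override_on \<omega> \<xi> \<Delta>)"
  proof -
    have "\<zeta> \<in> cyl (\<Delta> \<inter> \<Lambda>) \<xi> \<inter> cyl ?R \<omega> \<longleftrightarrow> \<zeta> \<in> cyl \<Lambda> (override_on \<omega> \<xi> \<Delta>)" for \<zeta>
      unfolding Int_iff in_cyl override_on_def by (metis Diff_iff IntD1 IntD2 IntI)
    then show ?thesis by blast
  qed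
  have 2: "cyl (\<Delta> \<inter> \<Lambda>) \<omega> \<inter> cyl ?R \<omega> = cyl \<Lambda> \<omega>"
    unfolding cyl_Un[symmetric] by (rule arg_cong[where f = "\<lambda>A. cyl A \<omega>"]) blast
  have "measure \<nu> (cyl \<Lambda> \<omega>) \<le> measure \<nu> (cyl ?R \<omega>)"
  proof (rule N.finite_measure_mono[OF cyl_mono])
    show "cyl ?R \<omega> \<in> N.events" unfolding prob_measuresD(2)[OF \<nu>] by (rule cyl_borel)
  qed blast
  then have b: "measure \<nu> (cyl ?R \<omega>) \<noteq> 0" using x by simp
  have m: "measure \<mu> (cyl A \<eta>) \<noteq> 0" if "finite A" for A \<eta> using mu_pos[OF that, of \<eta>] by simp
  show ?thesis unfolding loss_ratio_def cond_cyl_def 1 2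
    using b m[of \<Lambda>] m[of ?R] x \<Lambda> by (simp add: field_simps)
qed

lemma ln_loss_ratio:
  assumes \<nu>: "\<nu> \<in> prob_measures" and \<Lambda>: "finite \<Lambda>" and x: "0 < measure \<nu> (cyl \<Lambda> \<omega>)"
    and y: "0 < measure \<nu> (cyl \<Lambda> (override_on \<omega> \<xi> \<Delta>))"
  shows "0 < loss_ratio \<Lambda> \<Delta> \<xi> \<nu> \<omega>"
    and "ln (loss_ratio \<Lambda> \<Delta> \<xi> \<nu> \<omega>) = potential \<Lambda> 0 \<nu> (override_on \<omega> \<xi> \<Delta>) - potential \<Lambda> 0 \<nu> \<omega>"
  unfolding loss_ratio_eq[OF \<nu> \<Lambda> x] potential_def
  using x y mu_pos[OF \<Lambda>, of \<omega>] mu_pos[OF \<Lambda>, of "override_on \<omega> \<xi> \<Delta>"]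
  by (simp_all add: ln_div ln_mult)

text \<open>Transitions in an inactive region either have rate 0 or are trivial; a trivial
  transition has loss ratio 1 on every cell of positive probability.\<close>

lemma eintegral_loss_inactive:
  assumes \<nu>: "\<nu> \<in> prob_measures" and \<Delta>: "\<Delta> \<in> regions" "\<Delta> \<notin> active" "\<xi> \<in> patterns \<Delta>"
  shows "eintegral \<nu> (loss_integrand c \<nu> \<mu> n \<Delta> \<xi>) = 0"
proof -
  have "AE \<omega> in \<nu>. loss_integrand c \<nu> \<mu> n \<Delta> \<xi> \<omega> = 0"
    using AE_cyl_pos[OF \<nu> finite_Lam, of n]
  proof eventually_elim
    fix \<omega> assume x: "0 < measure \<nu> (cyl (Lam n) \<omega>)"
    show "loss_integrand c \<nu> \<mu> n \<Delta> \<xi> \<omega> = 0"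
    proof (cases "\<xi> = restrict \<omega> \<Delta>")
      case True
      then have "override_on \<omega> \<xi> \<Delta> = \<omega>" by (simp add: override_on_def fun_eq_iff)
      then have "loss_ratio (Lam n) \<Delta> \<xi> \<nu> \<omega> = 1"
        using x mu_pos[OF finite_Lam, of n \<omega>] by (simp add: loss_ratio_eq[OF \<nu> finite_Lam x])
      then show ?thesis by (simp add: loss_integrand_eq elog_def)
    next
      case False
      then show ?thesis using inactive_rate[OF \<Delta> False] by (simp add: loss_integrand_eq)
    qed
  qed
  then have "(\<integral>\<^sup>+\<omega>. e2ennreal (loss_integrand c \<nu> \<mu> n \<Delta> \<xi> \<omega>) \<partial>\<nu>) = (\<integral>\<^sup>+\<omega>. 0 \<partial>\<nu>)"
    "(\<integral>\<^sup>+\<omega>. e2ennreal (- loss_integrand c \<nu> \<mu> n \<Delta> \<xi> \<omega>) \<partial>\<nu>) = (\<integral>\<^sup>+\<omega>. 0 \<partial>\<nu>)"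
    by (intro nn_integral_cong_AE; eventually_elim; simp add: e2ennreal_neg)+
  then show ?thesis by (simp add: eintegral_def zero_ennreal.rep_eq)
qed

text \<open>Both sides are \<open>- \<infinity>\<close> if transitions of positive weight lead to a null pattern.\<close>

lemma gain_tendsto_eintegral_loss:
  assumes \<nu>: "\<nu> \<in> prob_measures" and \<Delta>: "\<Delta> \<in> active" "\<xi> \<in> patterns \<Delta>"
  shows "((\<lambda>\<epsilon>. ereal (gain (Lam n) \<epsilon> \<Delta> \<xi> \<nu>)) \<longlongrightarrow> eintegral \<nu> (loss_integrand c \<nu> \<mu> n \<Delta> \<xi>)) (at_right 0)"
    (is ?lim) and "eintegral \<nu> (loss_integrand c \<nu> \<mu> n \<Delta> \<xi>) \<noteq> \<infinity>" (is ?fin)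
proof -
  interpret N: prob_space \<nu> by (rule prob_measuresD[OF \<nu>])
  let ?\<Lambda> = "Lam n :: 'd site set"
  have \<Lambda>: "finite ?\<Lambda>" by simp
  note reg = activeD(1)[OF \<Delta>(1)]
  let ?f = "loss_integrand c \<nu> \<mu> n \<Delta> \<xi>"
  let ?w = "weight ?\<Lambda> \<Delta> \<xi> \<nu>"
  let ?x = "\<lambda>\<omega>. measure \<nu> (cyl ?\<Lambda> \<omega>)" and ?y = "\<lambda>\<omega>. measure \<nu> (cyl ?\<Lambda> (override_on \<omega> \<xi> \<Delta>))"
  let ?d = "\<lambda>\<epsilon> \<omega>. potential ?\<Lambda> \<epsilon> \<nu> (override_on \<omega> \<xi> \<Delta>) - potential ?\<Lambda> \<epsilon> \<nu> \<omega>"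
  have gain: "gain ?\<Lambda> \<epsilon> \<Delta> \<xi> \<nu> = (\<Sum>\<eta>\<in>patterns ?\<Lambda>. ?d \<epsilon> \<eta> * ?w \<eta>)" for \<epsilon>
    by (rule gain_eq_sum[OF \<nu> reg \<Delta>(2) \<Lambda>])
  have w_restrict: "?w (restrict \<omega> ?\<Lambda>) = ?w \<omega>" for \<omega> by (simp add: weight_def)
  have wx: "0 < ?x \<eta>" if "0 < ?w \<eta>" for \<eta>
  proof (rule ccontr)
    assume "\<not> 0 < ?x \<eta>"
    then have "?x \<eta> = 0" using measure_nonneg[of \<nu> "cyl ?\<Lambda> \<eta>"] by linarith
    then show False using weight_le[OF \<nu> \<Delta> \<Lambda>, of \<eta>] that by simp
  qed
  \<comment> \<open>A nonnegative function with vanishing integral over a cell vanishes almost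
    everywhere there, so positive rates occur, up to a null set, only in cells of positive
    weight.\<close>
  have AE_w: "AE \<omega> in \<nu>. 0 < c \<Delta> \<omega> \<xi> \<longrightarrow> 0 < ?w \<omega>"
  proof -
    have "AE \<omega> in \<nu>. \<forall>\<eta>\<in>{\<eta> \<in> patterns ?\<Lambda>. ?w \<eta> = 0}. c \<Delta> \<omega> \<xi> * indicator (cyl ?\<Lambda> \<eta>) \<omega> = 0"
    proof (rule AE_finite_allI)
      fix \<eta> assume "\<eta> \<in> {\<eta> \<in> patterns ?\<Lambda>. ?w \<eta> = 0}"
      then have "(\<integral>\<omega>. c \<Delta> \<omega> \<xi> * indicator (cyl ?\<Lambda> \<eta>) \<omega> \<partial>\<nu>) = 0" by (simp add: weight_def)
      then show "AE \<omega> in \<nu>. c \<Delta> \<omega> \<xi> * indicator (cyl ?\<Lambda> \<eta>) \<omega> = 0"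
        by (subst (asm) integral_nonneg_eq_0_iff_AE[OF rate_indicator_integrable[OF \<nu> reg \<Delta>(2) \<Lambda>]])
           (simp_all add: rate_nonneg[OF reg \<Delta>(2)])
    qed (use \<Lambda> in simp)
    then show ?thesis
    proof eventually_elim
      fix \<omega> assume *: "\<forall>\<eta>\<in>{\<eta> \<in> patterns ?\<Lambda>. ?w \<eta> = 0}. c \<Delta> \<omega> \<xi> * indicator (cyl ?\<Lambda> \<eta>) \<omega> = 0"
      have "c \<Delta> \<omega> \<xi> = 0" if "?w \<omega> = 0"
      proof -
        have "restrict \<omega> ?\<Lambda> \<in> {\<eta> \<in> patterns ?\<Lambda>. ?w \<eta> = 0}" using that w_restrict by simp
        from bspec[OF * this] show ?thesis by simp
      qed
      then show "0 < c \<Delta> \<omega> \<xi> \<longrightarrow> 0 < ?w \<omega>" using weight_nonneg[OF reg \<Delta>(2), of ?\<Lambda> \<nu> \<omega>] by (auto simp: less_le)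
    qed
  qed
  have "?lim \<and> ?fin"
  \<comment> \<open>The dichotomy behind finiteness: either every cell with positive flow has a
    target of positive probability, or some flow leads into a null cell.\<close>
  proof (cases "\<exists>\<eta>\<in>patterns ?\<Lambda>. 0 < ?w \<eta> \<and> ?y \<eta> = 0")
    case False
    then have y: "0 < ?y \<eta>" if "\<eta> \<in> patterns ?\<Lambda>" "0 < ?w \<eta>" for \<eta>
      using that measure_nonneg[of \<nu> "cyl ?\<Lambda> (override_on \<eta> \<xi> \<Delta>)"] by (auto simp: less_le)
    have y': "0 < ?y \<omega>" if "0 < ?w \<omega>" for \<omega>
      using y[of "restrict \<omega> ?\<Lambda>"] that by (simp add: w_restrict cyl_override_restrict)
    let ?g = "\<lambda>\<omega>. c \<Delta> \<omega> \<xi> * ?d 0 \<omega>"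
    have AE_g: "AE \<omega> in \<nu>. ?f \<omega> = ereal (?g \<omega>)"
      using AE_w
    proof eventually_elim
      fix \<omega> assume w: "0 < c \<Delta> \<omega> \<xi> \<longrightarrow> 0 < ?w \<omega>"
      show "?f \<omega> = ereal (?g \<omega>)"
      proof (cases "0 < c \<Delta> \<omega> \<xi>")
        case True
        with w have "0 < ?w \<omega>" by simp
        from ln_loss_ratio[OF \<nu> \<Lambda> wx[OF this] y'[OF this]] show ?thesis
          using True by (simp add: loss_integrand_eq elog_def)
      next
        case False
        then have "c \<Delta> \<omega> \<xi> = 0" using rate_nonneg[OF reg \<Delta>(2), of \<omega>] by simp
        then show ?thesis by (simp add: loss_integrand_eq zero_ereal_def)
      qed
    qed
    have int: "integrable \<nu> ?g"
      by (intro rate_integrable[OF \<nu> reg \<Delta>(2)] continuous_on_diff potential_continuous \<Lambda>)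
    have "(\<integral>\<^sup>+\<omega>. e2ennreal (?f \<omega>) \<partial>\<nu>) = (\<integral>\<^sup>+\<omega>. ennreal (?g \<omega>) \<partial>\<nu>)"
    proof (rule nn_integral_cong_AE)
      show "AE \<omega> in \<nu>. e2ennreal (?f \<omega>) = ennreal (?g \<omega>)" using AE_g by eventually_elim simp
    qed
    moreover have "(\<integral>\<^sup>+\<omega>. e2ennreal (- ?f \<omega>) \<partial>\<nu>) = (\<integral>\<^sup>+\<omega>. ennreal (- ?g \<omega>) \<partial>\<nu>)"
    proof (rule nn_integral_cong_AE)
      show "AE \<omega> in \<nu>. e2ennreal (- ?f \<omega>) = ennreal (- ?g \<omega>)" using AE_g by eventually_elim simp
    qed
    moreover obtain r q where "(\<integral>\<^sup>+\<omega>. ennreal (?g \<omega>) \<partial>\<nu>) = ennreal r" "(\<integral>\<^sup>+\<omega>. ennreal (- ?g \<omega>) \<partial>\<nu>) = ennreal q"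
      "0 \<le> r" "0 \<le> q" "(\<integral>\<omega>. ?g \<omega> \<partial>\<nu>) = r - q"
      using int by (rule integrableE)
    ultimately have ei: "eintegral \<nu> ?f = ereal (\<integral>\<omega>. ?g \<omega> \<partial>\<nu>)"
      by (simp add: eintegral_def enn2ereal_ennreal)
    have "(\<integral>\<omega>. ?g \<omega> \<partial>\<nu>) = gain ?\<Lambda> 0 \<Delta> \<xi> \<nu>" by (simp add: gain_def)
    moreover have "((\<lambda>\<epsilon>. gain ?\<Lambda> \<epsilon> \<Delta> \<xi> \<nu>) \<longlongrightarrow> gain ?\<Lambda> 0 \<Delta> \<xi> \<nu>) (at_right 0)"
      unfolding gain
    proof (rule tendsto_sum)
      fix \<eta> :: "('d, 'q) config" assume \<eta>: "\<eta> \<in> patterns ?\<Lambda>"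
      show "((\<lambda>\<epsilon>. ?d \<epsilon> \<eta> * ?w \<eta>) \<longlongrightarrow> ?d 0 \<eta> * ?w \<eta>) (at_right 0)"
      \<comment> \<open>A cell of weight 0 contributes nothing for any \<open>\<epsilon>\<close>,
        whatever value \<open>ln 0\<close> has; in the other cells both probabilities are positive
        and the logarithms are continuous at 0.\<close>
      proof (cases "?w \<eta> = 0")
        case False
        then have "0 < ?w \<eta>" using weight_nonneg[OF reg \<Delta>(2), of ?\<Lambda> \<nu> \<eta>] by simp
        from wx[OF this] y[OF \<eta> this] show ?thesis
          unfolding potential_def by (intro tendsto_intros) auto
      qed simp
    qed
    ultimately show ?thesis unfolding ei by simp
  next
    case True
    then obtain \<eta>0 where \<eta>0: "\<eta>0 \<in> patterns ?\<Lambda>" "0 < ?w \<eta>0" "?y \<eta>0 = 0" by blast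
    define K where "K = rate_bound * (\<Sum>\<eta>\<in>patterns ?\<Lambda>. \<bar>?d 0 \<eta>\<bar>)"
    have K: "0 \<le> K" unfolding K_def using rate_bound(1) by (intro mult_nonneg_nonneg sum_nonneg) auto
    have "(\<integral>\<^sup>+\<omega>. e2ennreal (?f \<omega>) \<partial>\<nu>) \<le> (\<integral>\<^sup>+\<omega>. ennreal K \<partial>\<nu>)"
      using AE_w
    proof (intro nn_integral_mono_AE, eventually_elim)
      fix \<omega> assume w: "0 < c \<Delta> \<omega> \<xi> \<longrightarrow> 0 < ?w \<omega>"
      have "?f \<omega> \<le> ereal K"
      proof (cases "0 < c \<Delta> \<omega> \<xi>")
        case c: True
        with w have x: "0 < ?x \<omega>" using wx by blast
        show ?thesis
        proof (cases "0 < ?y \<omega>")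
          case True
          have "\<bar>?d 0 \<omega>\<bar> = \<bar>?d 0 (restrict \<omega> ?\<Lambda>)\<bar>" by simp
          also have "\<dots> \<le> (\<Sum>\<eta>\<in>patterns ?\<Lambda>. \<bar>?d 0 \<eta>\<bar>)"
            using \<Lambda> by (intro member_le_sum[where f = "\<lambda>\<eta>. \<bar>?d 0 \<eta>\<bar>"]) auto
          finally have "c \<Delta> \<omega> \<xi> * \<bar>?d 0 \<omega>\<bar> \<le> K"
            unfolding K_def using rate_bound c \<Delta> by (intro mult_mono) auto
          moreover have "c \<Delta> \<omega> \<xi> * ?d 0 \<omega> \<le> c \<Delta> \<omega> \<xi> * \<bar>?d 0 \<omega>\<bar>" using c by (intro mult_left_mono) auto
          ultimately have "c \<Delta> \<omega> \<xi> * ?d 0 \<omega> \<le> K" by linarith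
          then show ?thesis
            using ln_loss_ratio[OF \<nu> \<Lambda> x True] c by (simp add: loss_integrand_eq elog_def)
        next
          case False
          then have "?y \<omega> = 0" using measure_nonneg[of \<nu> "cyl ?\<Lambda> (override_on \<omega> \<xi> \<Delta>)"] by linarith
          then have "loss_ratio ?\<Lambda> \<Delta> \<xi> \<nu> \<omega> = 0" by (simp add: loss_ratio_eq[OF \<nu> \<Lambda> x])
          then show ?thesis using c by (simp add: loss_integrand_eq elog_def)
        qed
      qed (use K in \<open>simp add: loss_integrand_eq\<close>)
      then show "e2ennreal (?f \<omega>) \<le> ennreal K" using e2ennreal_mono by fastforce
    qed
    also have "\<dots> < \<infinity>" using N.emeasure_space_1 by (simp add: less_top)
    finally have pos: "(\<integral>\<^sup>+\<omega>. e2ennreal (?f \<omega>) \<partial>\<nu>) < \<infinity>" .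
    \<comment> \<open>On this event of positive probability the transition has positive rate and a
      null target, so the integrand is \<open>- \<infinity>\<close>.\<close>
    let ?S = "{\<omega>. 0 < c \<Delta> \<omega> \<xi>} \<inter> cyl ?\<Lambda> \<eta>0"
    have S: "?S \<in> sets \<nu>"
      unfolding prob_measuresD(2)[OF \<nu>]
      by (intro sets.Int cyl_borel borel_open open_Collect_less continuous_on_const rate_continuous[OF reg \<Delta>(2)])
    have "emeasure \<nu> ?S \<noteq> 0"
    proof
      assume "emeasure \<nu> ?S = 0"
      then have "AE \<omega> in \<nu>. \<omega> \<notin> ?S" using S by (intro AE_not_in) (simp add: null_sets_def)
      then have "AE \<omega> in \<nu>. c \<Delta> \<omega> \<xi> * indicator (cyl ?\<Lambda> \<eta>0) \<omega> = 0"
      proof eventually_elim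
        fix \<omega> assume "\<omega> \<notin> ?S"
        then show "c \<Delta> \<omega> \<xi> * indicator (cyl ?\<Lambda> \<eta>0) \<omega> = 0"
          using rate_nonneg[OF reg \<Delta>(2), of \<omega>] by (cases "\<omega> \<in> cyl ?\<Lambda> \<eta>0") auto
      qed
      then have "?w \<eta>0 = 0" unfolding weight_def by (rule integral_eq_zero_AE)
      then show False using \<eta>0(2) by simp
    qed
    then have "top = top * emeasure \<nu> ?S" by (simp add: ennreal_top_mult)
    also have "\<dots> = (\<integral>\<^sup>+\<omega>. top * indicator ?S \<omega> \<partial>\<nu>)" using S by (rule nn_integral_cmult_indicator[symmetric])
    also have "\<dots> \<le> (\<integral>\<^sup>+\<omega>. e2ennreal (- ?f \<omega>) \<partial>\<nu>)"
    proof (rule nn_integral_mono)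
      fix \<omega>
      have "e2ennreal (- ?f \<omega>) = top" if "\<omega> \<in> ?S"
      proof -
        have c: "0 < c \<Delta> \<omega> \<xi>" and cyl: "cyl ?\<Lambda> \<omega> = cyl ?\<Lambda> \<eta>0" using that cyl_cong by auto
        have "restrict \<omega> ?\<Lambda> = \<eta>0" using that in_cyl_pattern[OF \<eta>0(1), of \<omega>] by simp
        then have "?y \<omega> = 0" using \<eta>0(3) cyl_override_restrict by metis
        moreover have "0 < ?x \<omega>" using wx[OF \<eta>0(2)] cyl by simp
        ultimately have "loss_ratio ?\<Lambda> \<Delta> \<xi> \<nu> \<omega> = 0" by (simp add: loss_ratio_eq[OF \<nu> \<Lambda>])
        then have "?f \<omega> = - \<infinity>" using c by (simp add: loss_integrand_eq elog_def)
        then show ?thesis by simp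
      qed
      then show "top * indicator ?S \<omega> \<le> e2ennreal (- ?f \<omega>)" by (cases "\<omega> \<in> ?S") auto
    qed
    finally have neg: "(\<integral>\<^sup>+\<omega>. e2ennreal (- ?f \<omega>) \<partial>\<nu>) = top" by (simp add: top_unique)
    obtain r where "(\<integral>\<^sup>+\<omega>. e2ennreal (?f \<omega>) \<partial>\<nu>) = ennreal r" "0 \<le> r"
      using pos by (cases "\<integral>\<^sup>+\<omega>. e2ennreal (?f \<omega>) \<partial>\<nu>") auto
    then have ei: "eintegral \<nu> ?f = - \<infinity>"
      by (simp add: eintegral_def neg enn2ereal_ennreal top_ereal_def)
    define k where "k = - real (card \<Delta>) * ln site_bound"
    \<comment> \<open>Bounds all terms except that of \<open>\<eta>0\<close>, uniformly for
      \<open>\<epsilon> < 1\<close>: a target mass plus \<open>\<epsilon>\<close> is at most 2, and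
      the energy cost is at most \<open>k\<close>.\<close>
    define M where "M = (\<Sum>\<eta>\<in>patterns ?\<Lambda> - {\<eta>0}. rate_bound * (2 + k))"
    have term_le: "?d \<epsilon> \<eta> * ?w \<eta> \<le> rate_bound * (2 + k)" if \<epsilon>: "0 < \<epsilon>" "\<epsilon> < 1" for \<epsilon> \<eta>
    proof -
      have k: "0 \<le> k" unfolding k_def using site_bound by (simp add: mult_nonneg_nonpos)
      have p: "0 < ?x \<eta> + \<epsilon>" "0 < ?y \<eta> + \<epsilon>" using \<epsilon> by (simp_all add: add_nonneg_pos)
      have "ln ((?y \<eta> + \<epsilon>) / (?x \<eta> + \<epsilon>)) \<le> (?y \<eta> + \<epsilon>) / (?x \<eta> + \<epsilon>) - 1"
        using p by (intro ln_le_minus_one) simp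
      moreover have "log_ratio \<Delta> ?\<Lambda> \<xi> \<eta> \<le> k" using log_ratio_bound[OF \<Lambda> activeD(2)[OF \<Delta>(1)], of \<xi> \<eta>] unfolding k_def by linarith
      ultimately have "?d \<epsilon> \<eta> \<le> (?y \<eta> + \<epsilon>) / (?x \<eta> + \<epsilon>) + k"
        unfolding potential_diff[OF \<Lambda> \<epsilon>(1)] by linarith
      then have "?d \<epsilon> \<eta> * ?w \<eta> \<le> ((?y \<eta> + \<epsilon>) / (?x \<eta> + \<epsilon>) + k) * ?w \<eta>"
        by (intro mult_right_mono weight_nonneg[OF reg \<Delta>(2)])
      also have "\<dots> \<le> ((?y \<eta> + \<epsilon>) / (?x \<eta> + \<epsilon>) + k) * (rate_bound * ?x \<eta>)"
        using weight_le[OF \<nu> \<Delta> \<Lambda>, of \<eta>] p k by (intro mult_left_mono add_nonneg_nonneg) auto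
      also have "\<dots> = rate_bound * ((?y \<eta> + \<epsilon>) * (?x \<eta> / (?x \<eta> + \<epsilon>)) + k * ?x \<eta>)"
        by (simp add: algebra_simps)
      also have "\<dots> \<le> rate_bound * (2 * 1 + k * 1)"
      proof (intro mult_left_mono[OF _ rate_bound(1)] add_mono mult_mono mult_left_mono k)
        show "?x \<eta> / (?x \<eta> + \<epsilon>) \<le> 1" using p \<epsilon> by simp
        show "?y \<eta> + \<epsilon> \<le> 2" using \<epsilon> N.prob_le_1[of "cyl ?\<Lambda> (override_on \<eta> \<xi> \<Delta>)"] by linarith
      qed (use p in auto)
      finally show ?thesis by simp
    qed
    \<comment> \<open>The term of \<open>\<eta>0\<close> contains
      \<open>?w \<eta>0 * ln \<epsilon>\<close> with a positive coefficient, and everything else is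
      bounded above near 0.\<close>
    have "filterlim (\<lambda>\<epsilon>. gain ?\<Lambda> \<epsilon> \<Delta> \<xi> \<nu>) at_bot (at_right 0)"
    proof (rule filterlim_at_bot_mono)
      let ?C = "ln (measure \<mu> (cyl ?\<Lambda> \<eta>0)) - ln (measure \<mu> (cyl ?\<Lambda> (override_on \<eta>0 \<xi> \<Delta>)))"
      have "filterlim (\<lambda>\<epsilon>::real. ln \<epsilon>) at_bot (at_right 0)" by (rule ln_at_0)
      moreover have x0: "?x \<eta>0 + 0 \<noteq> 0" using wx[OF \<eta>0(2)] by simp
      then have "((\<lambda>\<epsilon>. (?C - ln (?x \<eta>0 + \<epsilon>)) * ?w \<eta>0 + M) \<longlongrightarrow> (?C - ln (?x \<eta>0 + 0)) * ?w \<eta>0 + M) (at_right 0)"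
        by (intro tendsto_intros)
      ultimately show "filterlim (\<lambda>\<epsilon>. ((?C - ln (?x \<eta>0 + \<epsilon>)) * ?w \<eta>0 + M) + ?w \<eta>0 * ln \<epsilon>) at_bot (at_right 0)"
        using \<eta>0(2) filterlim_tendsto_pos_mult_at_bot[OF tendsto_const] by (subst filterlim_tendsto_add_at_bot_iff) auto
      have "\<forall>\<^sub>F \<epsilon>::real in at_right 0. \<epsilon> < 1 \<and> 0 < \<epsilon>"
        by (rule eventually_conj[OF order_tendstoD(2)[OF tendsto_ident_at] eventually_at_right_less]) simp
      then show "\<forall>\<^sub>F \<epsilon> in at_right 0. gain ?\<Lambda> \<epsilon> \<Delta> \<xi> \<nu> \<le> ((?C - ln (?x \<eta>0 + \<epsilon>)) * ?w \<eta>0 + M) + ?w \<eta>0 * ln \<epsilon>"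
      proof eventually_elim
        fix \<epsilon> :: real assume \<epsilon>: "\<epsilon> < 1 \<and> 0 < \<epsilon>"
        have "gain ?\<Lambda> \<epsilon> \<Delta> \<xi> \<nu> = ?d \<epsilon> \<eta>0 * ?w \<eta>0 + (\<Sum>\<eta>\<in>patterns ?\<Lambda> - {\<eta>0}. ?d \<epsilon> \<eta> * ?w \<eta>)"
          unfolding gain using \<eta>0(1) \<Lambda> by (intro sum.remove) auto
        also have "\<dots> \<le> ?d \<epsilon> \<eta>0 * ?w \<eta>0 + M"
          unfolding M_def using \<epsilon> by (intro add_left_mono sum_mono term_le) auto
        also have "?d \<epsilon> \<eta>0 * ?w \<eta>0 = (?C - ln (?x \<eta>0 + \<epsilon>)) * ?w \<eta>0 + ?w \<eta>0 * ln \<epsilon>"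
          by (simp add: potential_def \<eta>0(3) algebra_simps)
        finally show "gain ?\<Lambda> \<epsilon> \<Delta> \<xi> \<nu> \<le> ((?C - ln (?x \<eta>0 + \<epsilon>)) * ?w \<eta>0 + M) + ?w \<eta>0 * ln \<epsilon>" by simp
      qed
    qed
    then have "((\<lambda>\<epsilon>. ereal (gain ?\<Lambda> \<epsilon> \<Delta> \<xi> \<nu>)) \<longlongrightarrow> - \<infinity>) (at_right 0)"
      unfolding tendsto_MInfty filterlim_at_bot_dense by simp
    then show ?thesis unfolding ei by simp
  qed
  then show ?lim ?fin by auto
qed

text \<open>Each transition region shares its gain equally among its sites in
  \<open>\<Lambda>\<close>, as in \<open>approx_loss\<close>.\<close>

definition site_gain :: "'d site set \<Rightarrow> real \<Rightarrow> ('d, 'q) config measure \<Rightarrow> 'd site \<Rightarrow> real" where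
  "site_gain \<Lambda> \<epsilon> \<nu> j = (\<Sum>\<Delta>\<in>{\<Delta> \<in> active. j \<in> \<Delta>}. 1 / real (card (\<Delta> \<inter> \<Lambda>)) * (\<Sum>\<xi>\<in>patterns \<Delta>. gain \<Lambda> \<epsilon> \<Delta> \<xi> \<nu>))"

text \<open>Connects the extended-real loss with the real gains: only active regions contribute, no
  term is \<open>\<infinity>\<close>, and so the limit passes through all finite sums even when
  terms tend to \<open>- \<infinity>\<close>.\<close>

lemma site_gain_tendsto_approx_loss:
  assumes \<nu>: "\<nu> \<in> prob_measures"
  shows "((\<lambda>\<epsilon>. ereal (\<Sum>i\<in>Lam_inner n. site_gain (Lam n) \<epsilon> \<nu> i)) \<longlongrightarrow> approx_loss c n \<nu> \<mu>) (at_right 0)"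
proof -
  let ?e = "\<lambda>\<Delta> \<xi>. eintegral \<nu> (loss_integrand c \<nu> \<mu> n \<Delta> \<xi>)"
  let ?k = "\<lambda>\<Delta>. ereal (1 / real (card (\<Delta> \<inter> Lam n)))"
  let ?A = "\<lambda>i. {\<Delta> \<in> active. i \<in> \<Delta>}"
  have eq: "approx_loss c n \<nu> \<mu> = (\<Sum>i\<in>Lam_inner n. \<Sum>\<Delta>\<in>?A i. ?k \<Delta> * (\<Sum>\<xi>\<in>patterns \<Delta>. ?e \<Delta> \<xi>))"
    unfolding approx_loss_def
  proof (intro sum.cong refl)
    fix i :: "'d site"
    have "(\<Sum>\<^sub>\<infinity>\<Delta>\<in>{\<Delta> \<in> regions. i \<in> \<Delta>}. ?k \<Delta> * (\<Sum>\<xi>\<in>patterns \<Delta>. ?e \<Delta> \<xi>)) =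
        (\<Sum>\<^sub>\<infinity>\<Delta>\<in>?A i. ?k \<Delta> * (\<Sum>\<xi>\<in>patterns \<Delta>. ?e \<Delta> \<xi>))"
    proof (rule infsum_cong_neutral)
      fix \<Delta> assume \<Delta>: "\<Delta> \<in> {\<Delta> \<in> regions. i \<in> \<Delta>} - ?A i"
      have "(\<Sum>\<xi>\<in>patterns \<Delta>. ?e \<Delta> \<xi>) = 0"
        by (rule sum.neutral, rule ballI, rule eintegral_loss_inactive[OF \<nu>]) (use \<Delta> in auto)
      then show "?k \<Delta> * (\<Sum>\<xi>\<in>patterns \<Delta>. ?e \<Delta> \<xi>) = 0" by simp
    qed (auto dest: activeD)
    also have "\<dots> = (\<Sum>\<Delta>\<in>?A i. ?k \<Delta> * (\<Sum>\<xi>\<in>patterns \<Delta>. ?e \<Delta> \<xi>))"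
      by (rule infsum_finite[OF finite_active_at])
    finally show "(\<Sum>\<^sub>\<infinity>\<Delta>\<in>{\<Delta> \<in> regions. i \<in> \<Delta>}. ?k \<Delta> * (\<Sum>\<xi>\<in>patterns \<Delta>. ?e \<Delta> \<xi>)) =
        (\<Sum>\<Delta>\<in>?A i. ?k \<Delta> * (\<Sum>\<xi>\<in>patterns \<Delta>. ?e \<Delta> \<xi>))" .
  qed
  have "((\<lambda>\<epsilon>. \<Sum>i\<in>Lam_inner n. \<Sum>\<Delta>\<in>?A i. ?k \<Delta> * (\<Sum>\<xi>\<in>patterns \<Delta>. ereal (gain (Lam n) \<epsilon> \<Delta> \<xi> \<nu>)))
      \<longlongrightarrow> approx_loss c n \<nu> \<mu>) (at_right 0)"
    unfolding eq
  proof (rule tendsto_sum_ereal_not_PInfty[THEN conjunct1])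
    fix i :: "'d site"
    have 1: "((\<lambda>\<epsilon>. \<Sum>\<xi>\<in>patterns \<Delta>. ereal (gain (Lam n) \<epsilon> \<Delta> \<xi> \<nu>)) \<longlongrightarrow> (\<Sum>\<xi>\<in>patterns \<Delta>. ?e \<Delta> \<xi>)) (at_right 0)
        \<and> (\<Sum>\<xi>\<in>patterns \<Delta>. ?e \<Delta> \<xi>) \<noteq> \<infinity>" if "\<Delta> \<in> active" for \<Delta>
      by (rule tendsto_sum_ereal_not_PInfty) (use gain_tendsto_eintegral_loss[OF \<nu> that] activeD(4)[OF that] in simp_all)
    have 2: "((\<lambda>\<epsilon>. ?k \<Delta> * (\<Sum>\<xi>\<in>patterns \<Delta>. ereal (gain (Lam n) \<epsilon> \<Delta> \<xi> \<nu>))) \<longlongrightarrow> ?k \<Delta> * (\<Sum>\<xi>\<in>patterns \<Delta>. ?e \<Delta> \<xi>)) (at_right 0)"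
      if "\<Delta> \<in> active" for \<Delta>
      using 1[OF that] by (intro tendsto_cmult_ereal) auto
    have 3: "?k \<Delta> * (\<Sum>\<xi>\<in>patterns \<Delta>. ?e \<Delta> \<xi>) \<noteq> \<infinity>" if "\<Delta> \<in> active" for \<Delta>
      using 1[OF that] by (cases "\<Sum>\<xi>\<in>patterns \<Delta>. ?e \<Delta> \<xi>") (auto simp: ereal_mult_eq_PInfty)
    have "((\<lambda>\<epsilon>. \<Sum>\<Delta>\<in>?A i. ?k \<Delta> * (\<Sum>\<xi>\<in>patterns \<Delta>. ereal (gain (Lam n) \<epsilon> \<Delta> \<xi> \<nu>)))
      \<longlongrightarrow> (\<Sum>\<Delta>\<in>?A i. ?k \<Delta> * (\<Sum>\<xi>\<in>patterns \<Delta>. ?e \<Delta> \<xi>))) (at_right 0) \<and>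
      (\<Sum>\<Delta>\<in>?A i. ?k \<Delta> * (\<Sum>\<xi>\<in>patterns \<Delta>. ?e \<Delta> \<xi>)) \<noteq> \<infinity>"
      by (rule tendsto_sum_ereal_not_PInfty[OF finite_active_at]) (use 2 3 in auto)
    then show "((\<lambda>\<epsilon>. \<Sum>\<Delta>\<in>?A i. ?k \<Delta> * (\<Sum>\<xi>\<in>patterns \<Delta>. ereal (gain (Lam n) \<epsilon> \<Delta> \<xi> \<nu>)))
      \<longlongrightarrow> (\<Sum>\<Delta>\<in>?A i. ?k \<Delta> * (\<Sum>\<xi>\<in>patterns \<Delta>. ?e \<Delta> \<xi>))) (at_right 0)"
      "(\<Sum>\<Delta>\<in>?A i. ?k \<Delta> * (\<Sum>\<xi>\<in>patterns \<Delta>. ?e \<Delta> \<xi>)) \<noteq> \<infinity>" by blast+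
  qed (simp_all add: sum_Pinfty)
  then show ?thesis by (simp add: site_gain_def)
qed

end

section \<open>Uniform control of the gains near a measure\<close>

context gibbs_ips
begin

lemma card_patterns_translate:
  "card (patterns (translate i \<Delta>) :: ('d, 'q) config set) = card (patterns \<Delta> :: ('d, 'q) config set)"
  using bij_betw_same_card[OF bij_betw_shift_patterns] by metis

lemma sum_active_at: "(\<Sum>\<Delta>\<in>{\<Delta> \<in> active. j \<in> \<Delta>}. h \<Delta>) = (\<Sum>\<Delta>\<in>active0. h (translate j \<Delta>))"
  unfolding active_at by (rule sum.reindex[OF inj_translate, unfolded o_def])

text \<open>Double counting: a region hitting \<open>\<Lambda>\<close> is shared by
  \<open>card (\<Delta> \<inter> \<Lambda>)\<close> sites, which cancels the normalising
  factor.\<close>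

lemma total_gain_eq_site_gains:
  assumes "finite \<Lambda>"
  shows "total_gain \<Lambda> \<epsilon> \<nu> = (\<Sum>j\<in>\<Lambda>. site_gain \<Lambda> \<epsilon> \<nu> j)"
proof -
  let ?T = "\<lambda>\<Delta>. \<Sum>\<xi>\<in>patterns \<Delta>. gain \<Lambda> \<epsilon> \<Delta> \<xi> \<nu>"
  have "(\<Sum>j\<in>\<Lambda>. site_gain \<Lambda> \<epsilon> \<nu> j) = (\<Sum>j\<in>\<Lambda>. \<Sum>\<Delta>\<in>{\<Delta> \<in> hitting \<Lambda>. j \<in> \<Delta>}. 1 / real (card (\<Delta> \<inter> \<Lambda>)) * ?T \<Delta>)"
    unfolding site_gain_def by (intro sum.cong refl) (auto simp: hitting_def)
  also have "\<dots> = (\<Sum>\<Delta>\<in>hitting \<Lambda>. \<Sum>j\<in>{j \<in> \<Lambda>. j \<in> \<Delta>}. 1 / real (card (\<Delta> \<inter> \<Lambda>)) * ?T \<Delta>)"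
    by (rule sum.swap_restrict[OF assms finite_hitting[OF assms]])
  also have "\<dots> = (\<Sum>\<Delta>\<in>hitting \<Lambda>. ?T \<Delta>)"
  proof (intro sum.cong refl)
    fix \<Delta> assume "\<Delta> \<in> hitting \<Lambda>"
    then have "card (\<Delta> \<inter> \<Lambda>) \<noteq> 0" using assms by (simp add: hitting_def)
    moreover have "{j \<in> \<Lambda>. j \<in> \<Delta>} = \<Delta> \<inter> \<Lambda>" by blast
    ultimately show "(\<Sum>j\<in>{j \<in> \<Lambda>. j \<in> \<Delta>}. 1 / real (card (\<Delta> \<inter> \<Lambda>)) * ?T \<Delta>) = ?T \<Delta>" by simp
  qed
  finally show ?thesis by (simp add: total_gain_def)
qed

text \<open>Invariance of the rates, of \<open>\<nu>\<close> and of \<open>\<mu>\<close> lets every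
  site be viewed from the origin, where only finitely many regions have to be controlled.\<close>

lemma site_gain_shift:
  assumes \<nu>: "\<nu> \<in> invariant_measures" and \<Lambda>: "finite \<Lambda>"
  shows "site_gain (translate i \<Lambda>) \<epsilon> \<nu> i = site_gain \<Lambda> \<epsilon> \<nu> 0"
proof -
  have "site_gain (translate i \<Lambda>) \<epsilon> \<nu> i =
    (\<Sum>\<Delta>\<in>active0. 1 / real (card (\<Delta> \<inter> \<Lambda>)) * (\<Sum>\<xi>\<in>patterns \<Delta>. gain \<Lambda> \<epsilon> \<Delta> \<xi> \<nu>))"
    unfolding site_gain_def sum_active_at
  proof (intro sum.cong refl)
    fix \<Delta> assume "\<Delta> \<in> active0"
    then have \<Delta>: "\<Delta> \<in> regions" by (auto simp: active0_def active_def)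
    have "translate i \<Delta> \<inter> translate i \<Lambda> = translate i (\<Delta> \<inter> \<Lambda>)" by (auto simp: in_translate)
    moreover have "(\<Sum>\<xi>\<in>patterns (translate i \<Delta>). gain (translate i \<Lambda>) \<epsilon> (translate i \<Delta>) \<xi> \<nu>) =
        (\<Sum>\<xi>\<in>patterns \<Delta>. gain (translate i \<Lambda>) \<epsilon> (translate i \<Delta>) (shift i \<xi>) \<nu>)"
      by (rule sum.reindex_bij_betw[OF bij_betw_shift_patterns, symmetric])
    moreover have "\<dots> = (\<Sum>\<xi>\<in>patterns \<Delta>. gain \<Lambda> \<epsilon> \<Delta> \<xi> \<nu>)"
      by (intro sum.cong refl gain_shift \<nu> \<Delta> \<Lambda>)
    ultimately show "1 / real (card (translate i \<Delta> \<inter> translate i \<Lambda>)) *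
        (\<Sum>\<xi>\<in>patterns (translate i \<Delta>). gain (translate i \<Lambda>) \<epsilon> (translate i \<Delta>) \<xi> \<nu>) =
      1 / real (card (\<Delta> \<inter> \<Lambda>)) * (\<Sum>\<xi>\<in>patterns \<Delta>. gain \<Lambda> \<epsilon> \<Delta> \<xi> \<nu>)" by simp
  qed
  then show ?thesis by (simp add: site_gain_def sum_active_at)
qed

definition site_gain_bound :: real where
  "site_gain_bound = (\<Sum>\<Delta>\<in>active0. real (card (patterns \<Delta> :: ('d, 'q) config set)) *
     (rate_bound * (real (card (patterns \<Delta> :: ('d, 'q) config set)) + 1 - real (card \<Delta>) * ln site_bound)))"

lemma gain_bound_nonneg: "0 \<le> rate_bound * (real k + 1 - real l * ln site_bound)"
proof -
  have "real l * ln site_bound \<le> 0" using site_bound by (simp add: mult_nonneg_nonpos)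
  then have "0 \<le> real k + 1 - real l * ln site_bound" by linarith
  then show ?thesis by (intro mult_nonneg_nonneg rate_bound(1))
qed

lemma site_gain_upper:
  assumes \<nu>: "\<nu> \<in> prob_measures" and \<Lambda>: "finite \<Lambda>"
    and \<epsilon>: "0 < \<epsilon>" "\<epsilon> * real (card (patterns \<Lambda> :: ('d, 'q) config set)) \<le> 1"
  shows "site_gain \<Lambda> \<epsilon> \<nu> j \<le> site_gain_bound"
proof -
  let ?N = "\<lambda>\<Delta>. real (card (patterns \<Delta> :: ('d, 'q) config set))"
  let ?b = "\<lambda>\<Delta>. rate_bound * (?N \<Delta> + 1 - real (card \<Delta>) * ln site_bound)"
  have "site_gain \<Lambda> \<epsilon> \<nu> j \<le> (\<Sum>\<Delta>\<in>{\<Delta> \<in> active. j \<in> \<Delta>}. ?N \<Delta> * ?b \<Delta>)"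
    unfolding site_gain_def
  proof (rule sum_mono)
    fix \<Delta> assume "\<Delta> \<in> {\<Delta> \<in> active. j \<in> \<Delta>}"
    then have \<Delta>: "\<Delta> \<in> active" by simp
    have S: "(\<Sum>\<xi>\<in>patterns \<Delta>. gain \<Lambda> \<epsilon> \<Delta> \<xi> \<nu>) \<le> ?N \<Delta> * ?b \<Delta>"
      by (rule sum_bounded_above[of _ _ "?b \<Delta>", simplified]) (rule gain_upper[OF \<nu> \<Delta> _ \<Lambda> \<epsilon>])
    have nn: "0 \<le> ?N \<Delta> * ?b \<Delta>" by (intro mult_nonneg_nonneg gain_bound_nonneg) simp
    have "1 / real (card (\<Delta> \<inter> \<Lambda>)) * (\<Sum>\<xi>\<in>patterns \<Delta>. gain \<Lambda> \<epsilon> \<Delta> \<xi> \<nu>) \<le> 1 / real (card (\<Delta> \<inter> \<Lambda>)) * (?N \<Delta> * ?b \<Delta>)"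
      by (intro mult_left_mono S) simp
    also have "\<dots> \<le> 1 * (?N \<Delta> * ?b \<Delta>)"
      by (rule mult_right_mono[OF _ nn]) (cases "card (\<Delta> \<inter> \<Lambda>)"; simp)
    finally show "1 / real (card (\<Delta> \<inter> \<Lambda>)) * (\<Sum>\<xi>\<in>patterns \<Delta>. gain \<Lambda> \<epsilon> \<Delta> \<xi> \<nu>) \<le> ?N \<Delta> * ?b \<Delta>" by simp
  qed
  also have "\<dots> = site_gain_bound"
    unfolding sum_active_at site_gain_bound_def by (simp add: card_patterns_translate)
  finally show ?thesis .
qed

text \<open>Once \<open>\<Lambda>0\<close> contains all active regions through the origin, the
  weights \<open>1 / card \<Delta>\<close> no longer depend on the volume, and the refinement bound
  can be summed term by term.\<close>

lemma site_gain_refine: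
  assumes \<nu>: "\<nu> \<in> prob_measures" and \<Lambda>: "finite \<Lambda>" "\<Lambda>0 \<subseteq> \<Lambda>" "\<Union>active0 \<subseteq> \<Lambda>0"
    and \<epsilon>: "0 < \<epsilon>" "0 < \<epsilon>0" "\<epsilon> * real (card (patterns \<Lambda> :: ('d, 'q) config set)) \<le> \<epsilon>0"
    and u: "0 \<le> u"
    and q: "\<And>\<Delta> \<xi> \<omega> \<omega>'. \<Delta> \<in> active0 \<Longrightarrow> \<xi> \<in> patterns \<Delta> \<Longrightarrow> \<omega> \<in> cyl \<Lambda>0 \<omega>' \<Longrightarrow>
      c \<Delta> \<omega> \<xi> \<le> exp u * c \<Delta> \<omega>' \<xi>"
    and l: "\<And>\<Delta> \<xi> \<omega>. \<Delta> \<in> active0 \<Longrightarrow> \<bar>log_ratio \<Delta> \<Lambda> \<xi> \<omega> - log_ratio \<Delta> \<Lambda>0 \<xi> \<omega>\<bar> \<le> u"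
  shows "site_gain \<Lambda> \<epsilon> \<nu> 0 \<le> site_gain \<Lambda>0 \<epsilon>0 \<nu> 0 +
    (\<Sum>\<Delta>\<in>active0. real (card (patterns \<Delta> :: ('d, 'q) config set))) *
    (rate_bound * (2 * u + real (card (patterns \<Lambda>0 :: ('d, 'q) config set)) * \<epsilon>0))"
proof -
  let ?N = "\<lambda>\<Delta>. real (card (patterns \<Delta> :: ('d, 'q) config set))"
  let ?e = "rate_bound * (2 * u + ?N \<Lambda>0 * \<epsilon>0)"
  have e: "0 \<le> ?e" using rate_bound(1) u \<epsilon> by (intro mult_nonneg_nonneg add_nonneg_nonneg) auto
  have eq: "site_gain L \<delta> \<nu> 0 = (\<Sum>\<Delta>\<in>active0. 1 / real (card \<Delta>) * (\<Sum>\<xi>\<in>patterns \<Delta>. gain L \<delta> \<Delta> \<xi> \<nu>))"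
    if "\<Union>active0 \<subseteq> L" for L \<delta>
    unfolding site_gain_def sum_active_at translate_0
  proof (intro sum.cong refl)
    fix \<Delta> assume "\<Delta> \<in> active0"
    then have "\<Delta> \<inter> L = \<Delta>" using that by blast
    then show "1 / real (card (\<Delta> \<inter> L)) * (\<Sum>\<xi>\<in>patterns \<Delta>. gain L \<delta> \<Delta> \<xi> \<nu>) =
      1 / real (card \<Delta>) * (\<Sum>\<xi>\<in>patterns \<Delta>. gain L \<delta> \<Delta> \<xi> \<nu>)" by simp
  qed
  have "site_gain \<Lambda> \<epsilon> \<nu> 0 \<le> (\<Sum>\<Delta>\<in>active0. 1 / real (card \<Delta>) * (\<Sum>\<xi>\<in>patterns \<Delta>. gain \<Lambda>0 \<epsilon>0 \<Delta> \<xi> \<nu>) + ?N \<Delta> * ?e)"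
    unfolding eq[OF order_trans[OF \<Lambda>(3,2)]]
  proof (rule sum_mono)
    fix \<Delta> assume \<Delta>0: "\<Delta> \<in> active0"
    then have \<Delta>: "\<Delta> \<in> active" "\<Delta> \<subseteq> \<Lambda>0" using \<Lambda>(3) by (auto simp: active0_def)
    have "(\<Sum>\<xi>\<in>patterns \<Delta>. gain \<Lambda> \<epsilon> \<Delta> \<xi> \<nu>) \<le> (\<Sum>\<xi>\<in>patterns \<Delta>. gain \<Lambda>0 \<epsilon>0 \<Delta> \<xi> \<nu> + ?e)"
      by (rule sum_mono) (rule gain_refine[OF \<nu> \<Delta>(1) _ \<Lambda>(1,2) \<Delta>(2) \<epsilon> u q[OF \<Delta>0] l[OF \<Delta>0]])
    also have "\<dots> = (\<Sum>\<xi>\<in>patterns \<Delta>. gain \<Lambda>0 \<epsilon>0 \<Delta> \<xi> \<nu>) + ?N \<Delta> * ?e"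
      by (simp only: sum.distrib sum_constant)
    finally have "1 / real (card \<Delta>) * (\<Sum>\<xi>\<in>patterns \<Delta>. gain \<Lambda> \<epsilon> \<Delta> \<xi> \<nu>) \<le>
        1 / real (card \<Delta>) * ((\<Sum>\<xi>\<in>patterns \<Delta>. gain \<Lambda>0 \<epsilon>0 \<Delta> \<xi> \<nu>) + ?N \<Delta> * ?e)"
      by (rule mult_left_mono) (rule divide_nonneg_nonneg; simp)
    also have "\<dots> = 1 / real (card \<Delta>) * (\<Sum>\<xi>\<in>patterns \<Delta>. gain \<Lambda>0 \<epsilon>0 \<Delta> \<xi> \<nu>) + 1 / real (card \<Delta>) * (?N \<Delta> * ?e)"
      by (rule distrib_left)
    also have "1 / real (card \<Delta>) * (?N \<Delta> * ?e) \<le> 1 * (?N \<Delta> * ?e)"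
    proof (rule mult_right_mono)
      show "1 / real (card \<Delta>) \<le> 1" by (cases "card \<Delta>"; simp)
      show "0 \<le> ?N \<Delta> * ?e" by (rule mult_nonneg_nonneg[OF _ e]) simp
    qed
    finally show "1 / real (card \<Delta>) * (\<Sum>\<xi>\<in>patterns \<Delta>. gain \<Lambda> \<epsilon> \<Delta> \<xi> \<nu>) \<le>
        1 / real (card \<Delta>) * (\<Sum>\<xi>\<in>patterns \<Delta>. gain \<Lambda>0 \<epsilon>0 \<Delta> \<xi> \<nu>) + ?N \<Delta> * ?e" by simp
  qed
  also have "\<dots> = site_gain \<Lambda>0 \<epsilon>0 \<nu> 0 + (\<Sum>\<Delta>\<in>active0. ?N \<Delta>) * ?e"
    unfolding eq[OF \<Lambda>(3)] by (simp only: sum.distrib sum_distrib_right)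
  finally show ?thesis .
qed

text \<open>There are finitely many active regions through the origin, so the thresholds for the
  rates and for the energy costs can be united.\<close>

lemma good_region:
  assumes u: "0 < u"
  obtains B where "finite B" "\<Union>active0 \<subseteq> B"
    "\<And>\<Lambda> \<Delta> \<xi> \<omega> \<omega>'. finite \<Lambda> \<Longrightarrow> B \<subseteq> \<Lambda> \<Longrightarrow> \<Delta> \<in> active0 \<Longrightarrow> \<xi> \<in> patterns \<Delta> \<Longrightarrow> \<omega> \<in> cyl \<Lambda> \<omega>' \<Longrightarrow>
      c \<Delta> \<omega> \<xi> \<le> exp u * c \<Delta> \<omega>' \<xi>"
    "\<And>\<Lambda> \<Lambda>' \<Delta> \<xi> \<omega>. finite \<Lambda> \<Longrightarrow> finite \<Lambda>' \<Longrightarrow> B \<subseteq> \<Lambda> \<Longrightarrow> B \<subseteq> \<Lambda>' \<Longrightarrow> \<Delta> \<in> active0 \<Longrightarrow>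
      \<bar>log_ratio \<Delta> \<Lambda> \<xi> \<omega> - log_ratio \<Delta> \<Lambda>' \<xi> \<omega>\<bar> \<le> u"
proof -
  obtain B1 where B1: "finite B1" "\<And>\<Lambda> \<Delta> \<xi> \<omega> \<omega>'. finite \<Lambda> \<Longrightarrow> B1 \<subseteq> \<Lambda> \<Longrightarrow> \<Delta> \<in> active0 \<Longrightarrow> \<xi> \<in> patterns \<Delta> \<Longrightarrow>
    \<omega> \<in> cyl \<Lambda> \<omega>' \<Longrightarrow> c \<Delta> \<omega> \<xi> \<le> exp u * c \<Delta> \<omega>' \<xi>"
    by (rule rate_quotient[OF u]) blast
  have "\<exists>B. finite B \<and> (\<forall>\<Lambda> \<Lambda>' \<xi> \<omega>. finite \<Lambda> \<longrightarrow> finite \<Lambda>' \<longrightarrow> B \<subseteq> \<Lambda> \<longrightarrow> B \<subseteq> \<Lambda>' \<longrightarrow>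
     \<bar>log_ratio \<Delta> \<Lambda> \<xi> \<omega> - log_ratio \<Delta> \<Lambda>' \<xi> \<omega>\<bar> \<le> u)" if "\<Delta> \<in> active0" for \<Delta>
  proof -
    have "\<Delta> \<in> regions" using that by (auto simp: active0_def active_def)
    from log_ratio_limit[OF this u] show ?thesis by metis
  qed
  then obtain B2 where B2: "\<And>\<Delta>. \<Delta> \<in> active0 \<Longrightarrow> finite (B2 \<Delta>)"
    "\<And>\<Delta> \<Lambda> \<Lambda>' \<xi> \<omega>. \<Delta> \<in> active0 \<Longrightarrow> finite \<Lambda> \<Longrightarrow> finite \<Lambda>' \<Longrightarrow> B2 \<Delta> \<subseteq> \<Lambda> \<Longrightarrow> B2 \<Delta> \<subseteq> \<Lambda>' \<Longrightarrow>
     \<bar>log_ratio \<Delta> \<Lambda> \<xi> \<omega> - log_ratio \<Delta> \<Lambda>' \<xi> \<omega>\<bar> \<le> u"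
    by metis
  let ?B = "B1 \<union> (\<Union>\<Delta>\<in>active0. B2 \<Delta> \<union> \<Delta>)"
  show ?thesis
  proof (rule that[of ?B])
    show "finite ?B" using B1(1) B2(1) finite_active0 activeD(2) by (auto simp: active0_def)
    show "\<Union>active0 \<subseteq> ?B" by blast
    show "c \<Delta> \<omega> \<xi> \<le> exp u * c \<Delta> \<omega>' \<xi>"
      if "finite \<Lambda>" "?B \<subseteq> \<Lambda>" "\<Delta> \<in> active0" "\<xi> \<in> patterns \<Delta>" "\<omega> \<in> cyl \<Lambda> \<omega>'" for \<Lambda> \<Delta> \<xi> \<omega> \<omega>'
      using B1(2)[OF that(1) _ that(3-5)] that(2) by blast
    show "\<bar>log_ratio \<Delta> \<Lambda> \<xi> \<omega> - log_ratio \<Delta> \<Lambda>' \<xi> \<omega>\<bar> \<le> u"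
      if "finite \<Lambda>" "finite \<Lambda>'" "?B \<subseteq> \<Lambda>" "?B \<subseteq> \<Lambda>'" "\<Delta> \<in> active0" for \<Lambda> \<Lambda>' \<Delta> \<xi> \<omega>
      using that(3-5) by (intro B2(2)[OF that(5,1,2)]) blast+
  qed
qed

lemma site_gain_continuous:
  assumes \<nu>: "\<nu> \<in> prob_measures" and \<rho>: "\<forall>\<^sub>F x in F. \<rho> x \<in> prob_measures"
    and lim: "\<And>f :: ('d, 'q) config \<Rightarrow>\<^sub>C real. ((\<lambda>x. \<integral>\<omega>. apply_bcontfun f \<omega> \<partial>\<rho> x) \<longlongrightarrow> (\<integral>\<omega>. apply_bcontfun f \<omega> \<partial>\<nu>)) F"
    and \<Lambda>: "finite \<Lambda>" and \<epsilon>: "0 < \<epsilon>"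
  shows "((\<lambda>x. site_gain \<Lambda> \<epsilon> (\<rho> x) j) \<longlongrightarrow> site_gain \<Lambda> \<epsilon> \<nu> j) F"
  unfolding site_gain_def
  by (intro tendsto_sum tendsto_mult tendsto_const gain_tendsto[OF \<nu> \<rho> lim _ _ \<Lambda> \<epsilon>]) (auto simp: active_def)

text \<open>Good regions make the site gains almost monotone in the volume, uniformly in the measure, so a
  bound on the limit superior for one measure persists for all large volumes nearby.\<close>

lemma approx_loss_density_neighbourhood:
  assumes \<nu>: "\<nu> \<in> invariant_measures" and \<rho>: "\<forall>\<^sub>F x in F. \<rho> x \<in> invariant_measures"
    and lim: "\<And>f :: ('d, 'q) config \<Rightarrow>\<^sub>C real. ((\<lambda>x. \<integral>\<omega>. apply_bcontfun f \<omega> \<partial>\<rho> x) \<longlongrightarrow> (\<integral>\<omega>. apply_bcontfun f \<omega> \<partial>\<nu>)) F"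
    and a: "approx_loss_density c \<nu> \<mu> < ereal a"
  obtains m0 \<epsilon>0 where "0 < \<epsilon>0"
    "\<forall>\<^sub>F x in F. \<forall>m\<ge>m0. \<forall>\<epsilon>>0. \<epsilon> * real (card (patterns (Lam m) :: ('d, 'q) config set)) \<le> \<epsilon>0 \<longrightarrow>
       total_gain (Lam m) \<epsilon> (\<rho> x) \<le> a * real (card (Lam m :: 'd site set))"
proof -
  let ?N = "\<lambda>\<Delta>. real (card (patterns \<Delta> :: ('d, 'q) config set))"
  let ?L = "\<lambda>n. real (card (Lam n :: 'd site set))" and ?I = "\<lambda>n. real (card (Lam_inner n :: 'd site set))"
  note \<nu>p = invariant_prob[OF \<nu>]
  obtain a1 where a1: "approx_loss_density c \<nu> \<mu> < ereal a1" "a1 < a"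
  proof -
    obtain b where "approx_loss_density c \<nu> \<mu> < b" "b < ereal a" using dense[OF a] by blast
    then show ?thesis by (cases b) (auto intro: that)
  qed
  \<comment> \<open>The room between \<open>a1\<close> and \<open>a\<close> is split into three: the
    fraction of inner sites in the cube, the refinement error, and the boundary layer of the large
    cubes.\<close>
  define g where "g = (a - a1) / 3"
  have g: "0 < g" using a1 by (simp add: g_def)
  define a2 a3 where "a2 = a1 + g" and "a3 = a1 + 2 * g"
  have "a = a1 + 3 * g" by (simp add: g_def field_simps)
  then have a23: "a1 < a2" "a2 + g = a3" "a3 < a" using g by (simp_all add: a2_def a3_def)
  define M where "M = (\<Sum>\<Delta>\<in>active0. ?N \<Delta>) * rate_bound"
  have M: "0 \<le> M" unfolding M_def using rate_bound(1) by (intro mult_nonneg_nonneg sum_nonneg) auto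
  \<comment> \<open>The oscillation error \<open>M * (2 * u)\<close> takes at most
    \<open>g / 2\<close>; the other half is kept for the error from \<open>\<epsilon>0\<close>.
    Adding 1 to \<open>M\<close> avoids division by 0.\<close>
  define u where "u = g / (4 * (M + 1))"
  have u: "0 < u" using g M by (simp add: u_def)
  have Mu: "M * (2 * u) \<le> g / 2"
  proof -
    have "M * (2 * u) \<le> (M + 1) * (2 * u)" using u by (intro mult_right_mono) auto
    also have "\<dots> = g / 2" using M by (simp add: u_def field_simps)
    finally show ?thesis .
  qed
  obtain B where B: "finite B" "\<Union>active0 \<subseteq> B"
    "\<And>\<Lambda> \<Delta> \<xi> \<omega> \<omega>'. finite \<Lambda> \<Longrightarrow> B \<subseteq> \<Lambda> \<Longrightarrow> \<Delta> \<in> active0 \<Longrightarrow> \<xi> \<in> patterns \<Delta> \<Longrightarrow> \<omega> \<in> cyl \<Lambda> \<omega>' \<Longrightarrow>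
      c \<Delta> \<omega> \<xi> \<le> exp u * c \<Delta> \<omega>' \<xi>"
    "\<And>\<Lambda> \<Lambda>' \<Delta> \<xi> \<omega>. finite \<Lambda> \<Longrightarrow> finite \<Lambda>' \<Longrightarrow> B \<subseteq> \<Lambda> \<Longrightarrow> B \<subseteq> \<Lambda>' \<Longrightarrow> \<Delta> \<in> active0 \<Longrightarrow>
      \<bar>log_ratio \<Delta> \<Lambda> \<xi> \<omega> - log_ratio \<Delta> \<Lambda>' \<xi> \<omega>\<bar> \<le> u"
    by (rule good_region[OF u]) blast
  obtain R where R: "B \<subseteq> lattice_cube (int R)" using finite_subset_lattice_cube[OF B(1)] .
  have ratio: "(\<lambda>n. ?I n / ?L n) \<longlonglongrightarrow> 1"
    unfolding Lam_inner_def
  proof (rule lattice_cube_Lam_ratio)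
    have "(\<lambda>n. 1 - real n / 2 ^ n) \<longlonglongrightarrow> 1 - 0"
      by (intro tendsto_intros lim_n_over_pown[where x = "2 :: real"]) simp
    moreover have "(\<lambda>n. real_of_int (2 ^ n - int n) / 2 ^ n) = (\<lambda>n. 1 - real n / 2 ^ n)"
      by (simp add: diff_divide_distrib)
    ultimately show "(\<lambda>n. real_of_int (2 ^ n - int n) / 2 ^ n) \<longlonglongrightarrow> 1" by simp
  qed
  have "(\<lambda>n. a2 * (?I n / ?L n)) \<longlonglongrightarrow> a2 * 1" by (intro tendsto_intros ratio)
  then have "\<forall>\<^sub>F n in sequentially. a1 < a2 * (?I n / ?L n)" by (rule order_tendstoD) (use a23 in simp)
  moreover have "\<forall>\<^sub>F n in sequentially. 0 < ?I n / ?L n" using ratio by (rule order_tendstoD) simp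
  moreover have "\<forall>\<^sub>F n in sequentially. ereal (1 / ?L n) * approx_loss c n \<nu> \<mu> < ereal a1"
    using a1(1) unfolding approx_loss_density_def by (rule Limsup_lessD)
  moreover have "\<forall>\<^sub>F n in sequentially. n > R" by (rule eventually_gt_at_top)
  ultimately have "\<forall>\<^sub>F n in sequentially. a1 < a2 * (?I n / ?L n) \<and> 0 < ?I n / ?L n \<and>
      ereal (1 / ?L n) * approx_loss c n \<nu> \<mu> < ereal a1 \<and> n > R"
    by eventually_elim blast
  then obtain n where n: "a1 < a2 * (?I n / ?L n)" "0 < ?I n / ?L n"
    "ereal (1 / ?L n) * approx_loss c n \<nu> \<mu> < ereal a1" "n > R"
    unfolding eventually_sequentially by blast
  have L: "0 < ?L n" by (rule card_Lam_pos)
  have I: "0 < ?I n" using n(2) L by (simp add: zero_less_divide_iff)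
  have "approx_loss c n \<nu> \<mu> < ereal (a2 * ?I n)"
  proof -
    have "approx_loss c n \<nu> \<mu> = ereal (?L n) * (ereal (1 / ?L n) * approx_loss c n \<nu> \<mu>)"
    proof -
      have "ereal (?L n) * ereal (1 / ?L n) = ereal (?L n * (1 / ?L n))" by (rule times_ereal.simps)
      also have "\<dots> = 1" using L by (simp only: times_divide_eq_right mult_1_right divide_self[OF less_imp_neq[THEN not_sym]] one_ereal_def)
      finally show ?thesis by (simp only: mult.assoc[symmetric] mult_1)
    qed
    also have "\<dots> < ereal (?L n) * ereal a1" using n(3) L by (intro ereal_mult_strict_left_mono) auto
    also have "\<dots> < ereal (a2 * ?I n)" using n(1) L by (simp add: field_simps)
    finally show ?thesis .
  qed
  with site_gain_tendsto_approx_loss[OF \<nu>p, of n]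
  have ev1: "\<forall>\<^sub>F \<epsilon> in at_right 0. ereal (\<Sum>i\<in>Lam_inner n. site_gain (Lam n) \<epsilon> \<nu> i) < ereal (a2 * ?I n)"
    by (rule order_tendstoD)
  have "((\<lambda>\<epsilon>. M * (?N (Lam n) * \<epsilon>)) \<longlongrightarrow> M * (?N (Lam n) * 0)) (at_right (0::real))" by (intro tendsto_intros)
  then have ev2: "\<forall>\<^sub>F \<epsilon> in at_right 0. M * (?N (Lam n) * \<epsilon>) < g / 2"
    by (rule order_tendstoD) (use g in simp)
  have ev3: "\<forall>\<^sub>F \<epsilon>::real in at_right 0. \<epsilon> < 1 \<and> 0 < \<epsilon>"
    by (rule eventually_conj[OF order_tendstoD(2)[OF tendsto_ident_at] eventually_at_right_less]) simp
  have "\<forall>\<^sub>F \<epsilon>::real in at_right 0. ((\<Sum>i\<in>Lam_inner n. site_gain (Lam n) \<epsilon> \<nu> i) < a2 * ?I n \<and>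
      M * (?N (Lam n) * \<epsilon>) < g / 2) \<and> \<epsilon> < 1 \<and> 0 < \<epsilon>"
    using ev1 ev2 ev3 by eventually_elim simp
  from eventually_happens'[OF _ this] obtain \<epsilon>0 where \<epsilon>0: "(\<Sum>i\<in>Lam_inner n. site_gain (Lam n) \<epsilon>0 \<nu> i) < a2 * ?I n"
    "M * (?N (Lam n) * \<epsilon>0) < g / 2" "\<epsilon>0 < 1" "0 < \<epsilon>0"
    by (auto simp: trivial_limit_at_right_real)
  \<comment> \<open>The sum over the inner cube lies below \<open>a2\<close> times its size, so some
    site lies below \<open>a2\<close>.\<close>
  have "\<exists>i\<in>Lam_inner n. site_gain (Lam n) \<epsilon>0 \<nu> i < a2"
  proof (rule ccontr)
    assume "\<not> ?thesis"
    then have "(\<Sum>i\<in>(Lam_inner n :: 'd site set). a2) \<le> (\<Sum>i\<in>Lam_inner n. site_gain (Lam n) \<epsilon>0 \<nu> i)"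
      by (intro sum_mono) auto
    then show False using \<epsilon>0(1) by (simp add: mult.commute)
  qed
  then obtain i where i: "i \<in> Lam_inner n" "site_gain (Lam n) \<epsilon>0 \<nu> i < a2" by blast
  \<comment> \<open>The cube seen from the chosen site. From here on this fixed region at the origin
    is the reference for all larger volumes.\<close>
  define \<Lambda>0 where "\<Lambda>0 = translate (- i) (Lam n)"
  have fin0: "finite \<Lambda>0" by (simp add: \<Lambda>0_def)
  have N0: "?N \<Lambda>0 = ?N (Lam n)" by (simp add: \<Lambda>0_def card_patterns_translate)
  have s0: "site_gain \<Lambda>0 \<epsilon>0 \<nu> 0 < a2"
    using i(2) site_gain_shift[OF \<nu> fin0, of i \<epsilon>0] by (simp add: \<Lambda>0_def)
  have B0: "B \<subseteq> \<Lambda>0"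
  proof
    fix x assume "x \<in> B"
    then have "x + i \<in> lattice_cube (int R + (2 ^ n - int n))"
      using R i(1) unfolding Lam_inner_def by (intro lattice_cube_add) auto
    \<comment> \<open>The strict inequality \<open>n > R\<close> supplies the missing 1: the radius
      \<open>R + (2 ^ n - n)\<close> is at most \<open>2 ^ n - 1\<close>.\<close>
    moreover have "lattice_cube (int R + (2 ^ n - int n)) \<subseteq> (lattice_cube (2 ^ n - 1) :: 'd site set)"
      using n(4) by (intro lattice_cube_mono) simp
    ultimately show "x \<in> \<Lambda>0" by (auto simp: \<Lambda>0_def in_translate Lam_def)
  qed
  obtain R0 where R0: "\<Lambda>0 \<subseteq> lattice_cube (int R0)" using finite_subset_lattice_cube[OF fin0] .
  \<comment> \<open>The sites \<open>j\<close> for which the translate of \<open>\<Lambda>0\<close>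
    by \<open>j\<close> fits into \<open>Lam m\<close>; for small \<open>m\<close> this set may be
    empty.\<close>
  define inner where "inner m = (lattice_cube (2 ^ m - 1 - int R0) :: 'd site set)" for m
  have ratio': "(\<lambda>m. real (card (inner m)) / ?L m) \<longlonglongrightarrow> 1"
    unfolding inner_def
  proof (rule lattice_cube_Lam_ratio)
    have "(\<lambda>n. 1 - (1 + real R0) / 2 ^ n) \<longlonglongrightarrow> 1 - 0"
      by (intro tendsto_intros LIMSEQ_divide_realpow_zero) simp
    moreover have "(\<lambda>n. real_of_int (2 ^ n - 1 - int R0) / 2 ^ n) = (\<lambda>n. 1 - (1 + real R0) / 2 ^ n)"
      by (simp add: diff_divide_distrib add_divide_distrib algebra_simps)
    ultimately show "(\<lambda>n. real_of_int (2 ^ n - 1 - int R0) / 2 ^ n) \<longlonglongrightarrow> 1" by simp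
  qed
  have "(\<lambda>m. a3 * (real (card (inner m)) / ?L m) + site_gain_bound * (1 - real (card (inner m)) / ?L m)) \<longlonglongrightarrow>
      a3 * 1 + site_gain_bound * (1 - 1)" by (intro tendsto_intros ratio')
  then have "\<forall>\<^sub>F m in sequentially. a3 * (real (card (inner m)) / ?L m) + site_gain_bound * (1 - real (card (inner m)) / ?L m) < a"
    by (rule order_tendstoD) (use a23 in simp)
  then obtain m0 where m0: "\<And>m. m \<ge> m0 \<Longrightarrow>
      a3 * (real (card (inner m)) / ?L m) + site_gain_bound * (1 - real (card (inner m)) / ?L m) < a"
    unfolding eventually_sequentially by blast
  have \<rho>p: "\<forall>\<^sub>F x in F. \<rho> x \<in> prob_measures" using \<rho> by eventually_elim (rule invariant_prob)
  have "\<forall>\<^sub>F x in F. site_gain \<Lambda>0 \<epsilon>0 (\<rho> x) 0 < a2"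
    by (rule order_tendstoD(2)[OF site_gain_continuous[OF \<nu>p \<rho>p lim fin0 \<epsilon>0(4)] s0])
  then have "\<forall>\<^sub>F x in F. \<forall>m\<ge>m0. \<forall>\<epsilon>>0. \<epsilon> * ?N (Lam m) \<le> \<epsilon>0 \<longrightarrow> total_gain (Lam m) \<epsilon> (\<rho> x) \<le> a * ?L m"
    using \<rho>
  proof eventually_elim
    fix x assume x: "site_gain \<Lambda>0 \<epsilon>0 (\<rho> x) 0 < a2" and inv: "\<rho> x \<in> invariant_measures"
    note xp = invariant_prob[OF inv]
    show "\<forall>m\<ge>m0. \<forall>\<epsilon>>0. \<epsilon> * ?N (Lam m) \<le> \<epsilon>0 \<longrightarrow> total_gain (Lam m) \<epsilon> (\<rho> x) \<le> a * ?L m"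
    proof (intro allI impI)
      fix m \<epsilon> assume m: "m0 \<le> m" and \<epsilon>: "(0::real) < \<epsilon>" "\<epsilon> * ?N (Lam m) \<le> \<epsilon>0"
      let ?s = "site_gain (Lam m) \<epsilon> (\<rho> x)"
      \<comment> \<open>Viewed from a deep site the large cube refines \<open>\<Lambda>0\<close>, so
        its gain exceeds the gain on \<open>\<Lambda>0\<close> by less than \<open>g\<close>; the
        latter is below \<open>a2\<close> for measures near \<open>\<nu>\<close>.\<close>
      have deep: "?s j \<le> a3" if j: "j \<in> inner m" for j
      proof -
        let ?\<Lambda> = "translate (- j) (Lam m)"
        have fin: "finite ?\<Lambda>" by simp
        have sub: "\<Lambda>0 \<subseteq> ?\<Lambda>"
        proof
          fix y assume "y \<in> \<Lambda>0"
          then have "y + j \<in> lattice_cube (int R0 + (2 ^ m - 1 - int R0))"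
            using R0 j unfolding inner_def by (intro lattice_cube_add) auto
          then show "y \<in> ?\<Lambda>" by (simp add: in_translate Lam_def)
        qed
        have "?s j = site_gain ?\<Lambda> \<epsilon> (\<rho> x) 0"
          using site_gain_shift[OF inv fin, of j \<epsilon>] by simp
        also have "\<dots> \<le> site_gain \<Lambda>0 \<epsilon>0 (\<rho> x) 0 + (\<Sum>\<Delta>\<in>active0. ?N \<Delta>) * (rate_bound * (2 * u + ?N \<Lambda>0 * \<epsilon>0))"
        proof (rule site_gain_refine[OF xp fin sub order_trans[OF B(2) B0] \<epsilon>(1) \<epsilon>0(4)])
          show "\<epsilon> * ?N ?\<Lambda> \<le> \<epsilon>0" using \<epsilon>(2) by (simp add: card_patterns_translate)
          show "0 \<le> u" using u by simp
          show "c \<Delta> \<omega> \<xi> \<le> exp u * c \<Delta> \<omega>' \<xi>"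
            if "\<Delta> \<in> active0" "\<xi> \<in> patterns \<Delta>" "\<omega> \<in> cyl \<Lambda>0 \<omega>'" for \<Delta> \<xi> \<omega> \<omega>'
            by (rule B(3)[OF fin0 B0 that])
          show "\<bar>log_ratio \<Delta> ?\<Lambda> \<xi> \<omega> - log_ratio \<Delta> \<Lambda>0 \<xi> \<omega>\<bar> \<le> u" if "\<Delta> \<in> active0" for \<Delta> \<xi> \<omega>
            by (rule B(4)[OF fin fin0 order_trans[OF B0 sub] B0 that])
        qed
        also have "(\<Sum>\<Delta>\<in>active0. ?N \<Delta>) * (rate_bound * (2 * u + ?N \<Lambda>0 * \<epsilon>0)) = M * (2 * u) + M * (?N (Lam n) * \<epsilon>0)"
          by (simp add: M_def N0 algebra_simps)
        finally show ?thesis using x Mu \<epsilon>0(2) a23 by linarith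
      qed
      have inner_sub: "inner m \<subseteq> Lam m" unfolding inner_def Lam_def by (intro lattice_cube_mono) simp
      have "total_gain (Lam m) \<epsilon> (\<rho> x) = (\<Sum>j\<in>Lam m. ?s j)" by (rule total_gain_eq_site_gains) simp
      also have "\<dots> = (\<Sum>j\<in>Lam m - inner m. ?s j) + (\<Sum>j\<in>inner m. ?s j)"
        by (rule sum.subset_diff[OF inner_sub]) simp
      also have "\<dots> \<le> (\<Sum>j\<in>Lam m - inner m. site_gain_bound) + (\<Sum>j\<in>inner m. a3)"
      proof (intro add_mono sum_mono deep site_gain_upper[OF xp])
        show "\<epsilon> * ?N (Lam m) \<le> 1" using \<epsilon>(2) \<epsilon>0(3) by simp
      qed (use \<epsilon> in auto)
      also have "\<dots> = (?L m - real (card (inner m))) * site_gain_bound + real (card (inner m)) * a3"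
        using inner_sub by (simp add: card_Diff_subset inner_def card_mono of_nat_diff)
      also have "\<dots> = (a3 * (real (card (inner m)) / ?L m) + site_gain_bound * (1 - real (card (inner m)) / ?L m)) * ?L m"
      proof -
        have "(Lam m :: 'd site set) \<noteq> {}" using card_Lam_pos[where 'd = 'd, of m] by auto
        then show ?thesis by (simp add: field_simps)
      qed
      also have "\<dots> \<le> a * ?L m" using m0[OF m] by (intro mult_right_mono) auto
      finally show "total_gain (Lam m) \<epsilon> (\<rho> x) \<le> a * ?L m" .
    qed
  qed
  then show ?thesis by (rule that[OF \<epsilon>0(4)])
qed

end

section \<open>Descent of the relative entropy\<close>

context gibbs_ips
begin

text \<open>By the mean value theorem the bound on the derivative is needed only strictly between
  the endpoints; this matters because control after a time \<open>t n\<close> starts only at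
  strictly later times.\<close>

lemma rel_entropy_increase:
  assumes P: "has_semigroup c P" and \<Lambda>: "finite \<Lambda>" and \<nu>: "\<nu> \<in> prob_measures" and \<epsilon>: "0 < \<epsilon>"
    and AB: "0 \<le> A" "A < B"
    and le: "\<And>r. A < r \<Longrightarrow> r < B \<Longrightarrow> total_gain \<Lambda> \<epsilon> (evolve P r \<nu>) \<le> k"
  shows "rel_entropy \<Lambda> \<epsilon> (evolve P B \<nu>) - rel_entropy \<Lambda> \<epsilon> (evolve P A \<nu>) \<le> k * (B - A)"
proof -
  let ?H = "\<lambda>r. rel_entropy \<Lambda> \<epsilon> (evolve P r \<nu>)" and ?G = "\<lambda>r. total_gain \<Lambda> \<epsilon> (evolve P r \<nu>)"
  have "\<exists>r\<in>{A<..<B}. ?H B - ?H A = ?G r * (B - A)"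
  proof (rule mvt_simple[OF AB(2), where f' = "\<lambda>r. (*) (?G r)"])
    fix r assume r: "A \<le> r" "r \<le> B"
    then have "(?H has_real_derivative ?G r) (at r within {0..})"
      using AB by (intro rel_entropy_derivative[OF P \<Lambda> \<nu> \<epsilon>]) simp
    then have "(?H has_real_derivative ?G r) (at r within {A..B})"
      by (rule has_field_derivative_subset) (use AB in auto)
    then show "(?H has_derivative (*) (?G r)) (at r within {A..B})" by (rule has_field_derivative_imp_has_derivative)
  qed
  then obtain r where r: "A < r" "r < B" "?H B - ?H A = ?G r * (B - A)" by auto
  have "?G r * (B - A) \<le> k * (B - A)" using le[OF r(1,2)] AB by (intro mult_right_mono) auto
  then show ?thesis using r(3) by simp
qed

text \<open>The number of rounds is chosen against the entropy range per site, and only then a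
  volume for which all rounds are controlled. Along the whole path positive growth of the entropy
  density is limited to any prescribed rate because the loss density is nonpositive on
  \<open>D\<close>.\<close>

lemma not_approx_loss_density_limit_neg:
  fixes D :: "('d, 'q) config measure set" and t :: "nat \<Rightarrow> real"
  assumes P: "has_semigroup c P"
    and D: "D \<subseteq> invariant_measures" "\<And>\<rho> s. \<rho> \<in> D \<Longrightarrow> s \<ge> 0 \<Longrightarrow> evolve P s \<rho> \<in> D"
    and nonpos: "\<And>\<rho>. \<rho> \<in> D \<Longrightarrow> approx_loss_density c \<rho> \<mu> \<le> 0"
    and \<nu>: "\<nu> \<in> D" and \<nu>': "\<nu>' \<in> D"
    and t: "\<And>n. t n \<ge> 0" "filterlim t at_top sequentially"
    and lim: "\<And>f :: ('d, 'q) config \<Rightarrow>\<^sub>C real. (\<lambda>n. \<integral>\<omega>. apply_bcontfun f \<omega> \<partial>evolve P (t n) \<nu>) \<longlonglongrightarrow> (\<integral>\<omega>. apply_bcontfun f \<omega> \<partial>\<nu>')"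
  shows "\<not> approx_loss_density c \<nu>' \<mu> < 0"
proof
  assume "approx_loss_density c \<nu>' \<mu> < 0"
  then obtain b' where b': "approx_loss_density c \<nu>' \<mu> < b'" "b' < ereal 0" using dense by (metis zero_ereal_def)
  then obtain b where b: "approx_loss_density c \<nu>' \<mu> < ereal (- b)" "0 < b"
    by (cases b') (auto intro: that[of "- real_of_ereal b'"])
  have F: "feller_semigroup P" using P by (simp add: has_semigroup_def)
  let ?N = "\<lambda>m. real (card (patterns (Lam m) :: ('d, 'q) config set))" and ?L = "\<lambda>m. real (card (Lam m :: 'd site set))"
  let ?\<nu> = "\<lambda>r. evolve P r \<nu>"
  have inv: "?\<nu> r \<in> invariant_measures" if "0 \<le> r" for r using D \<nu> that by blast
  have \<nu>p: "\<nu> \<in> prob_measures" using D(1) \<nu> invariant_prob by blast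
  \<comment> \<open>Control of the derivative at time \<open>r\<close> for all large cubes and all
    admissible regularisations. Raising \<open>m0\<close> or lowering \<open>\<epsilon>0\<close>
    preserves it, so finitely many times or intervals can share thresholds.\<close>
  define small where "small m0 \<epsilon>0 a r \<longleftrightarrow> (\<forall>m\<ge>m0. \<forall>\<epsilon>>0. \<epsilon> * ?N m \<le> \<epsilon>0 \<longrightarrow>
      total_gain (Lam m) \<epsilon> (?\<nu> r) \<le> a * ?L m)" for m0 :: nat and \<epsilon>0 a r :: real
  have small_mono: "small m1 \<epsilon>1 a r" if "small m0 \<epsilon>0 a r" "m0 \<le> m1" "\<epsilon>1 \<le> \<epsilon>0" for m0 m1 \<epsilon>0 \<epsilon>1 a r
    using that unfolding small_def by (meson order_trans)

  have pointwise: "\<exists>m0 \<epsilon>0 d. 0 < \<epsilon>0 \<and> 0 < d \<and> (\<forall>r\<ge>0. \<bar>r - r0\<bar> < d \<longrightarrow> small m0 \<epsilon>0 a r)"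
    if r0: "0 \<le> r0" and a: "0 < a" for r0 a
  proof -
    \<comment> \<open>Full neighbourhoods rather than punctured ones, so that the time
      \<open>r0\<close> itself is controlled as well.\<close>
    let ?F = "inf (nhds r0) (principal {0..})"
    have lim_f: "((\<lambda>r. \<integral>\<omega>. apply_bcontfun f \<omega> \<partial>?\<nu> r) \<longlongrightarrow> (\<integral>\<omega>. apply_bcontfun f \<omega> \<partial>?\<nu> r0)) ?F" for f :: "('d, 'q) config \<Rightarrow>\<^sub>C real"
      by (rule tendsto_at_within_iff_tendsto_nhds[where g = "\<lambda>r. \<integral>\<omega>. apply_bcontfun f \<omega> \<partial>?\<nu> r", THEN iffD1])
         (rule evolve_continuous[OF F \<nu>p r0])
    have ev: "\<forall>\<^sub>F r in ?F. ?\<nu> r \<in> invariant_measures"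
      by (simp add: eventually_inf_principal inv)
    have less: "approx_loss_density c (?\<nu> r0) \<mu> < ereal a"
      by (rule order_le_less_trans[OF nonpos[OF D(2)[OF \<nu> r0]]]) (use a in simp)
    obtain m0 \<epsilon>0 where "0 < \<epsilon>0" "\<forall>\<^sub>F r in ?F. small m0 \<epsilon>0 a r"
      unfolding small_def by (rule approx_loss_density_neighbourhood[OF inv[OF r0] ev lim_f less])
    then show ?thesis
      by (auto simp: eventually_inf_principal eventually_nhds_metric dist_real_def)
  qed

  \<comment> \<open>Compactness of the time interval in the form of Bolzano's principle: common
    thresholds survive concatenation of intervals and exist on short intervals around each
    time.\<close>
  have interval: "\<exists>m0 \<epsilon>0. 0 < \<epsilon>0 \<and> (\<forall>r. 0 \<le> r \<longrightarrow> A \<le> r \<longrightarrow> r \<le> B \<longrightarrow> small m0 \<epsilon>0 a r)"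
    if AB: "0 \<le> A" "A \<le> B" and a: "0 < a" for A B a
    using AB(2)
  proof (induction rule: Bolzano)
    case (trans x y z)
    then obtain m0 \<epsilon>0 m1 \<epsilon>1 where
      *: "0 < \<epsilon>0" "\<And>r. 0 \<le> r \<Longrightarrow> x \<le> r \<Longrightarrow> r \<le> y \<Longrightarrow> small m0 \<epsilon>0 a r"
         "0 < \<epsilon>1" "\<And>r. 0 \<le> r \<Longrightarrow> y \<le> r \<Longrightarrow> r \<le> z \<Longrightarrow> small m1 \<epsilon>1 a r" by blast
    have "small (max m0 m1) (min \<epsilon>0 \<epsilon>1) a r" if "0 \<le> r" "x \<le> r" "r \<le> z" for r
    proof (cases "r \<le> y")
      case True
      show ?thesis by (rule small_mono[OF *(2)[OF that(1,2) True]]) auto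
    next
      case False
      then have "y \<le> r" by simp
      show ?thesis by (rule small_mono[OF *(4)[OF that(1) \<open>y \<le> r\<close> that(3)]]) auto
    qed
    then show ?case using *(1,3) by (intro exI[of _ "max m0 m1"] exI[of _ "min \<epsilon>0 \<epsilon>1"]) auto
  next
    case (local x)
    then have "0 \<le> x" using AB by simp
    from pointwise[OF this a] obtain m0 \<epsilon>0 d where
      *: "0 < \<epsilon>0" "0 < d" "\<And>r. 0 \<le> r \<Longrightarrow> \<bar>r - x\<bar> < d \<Longrightarrow> small m0 \<epsilon>0 a r" by blast
    have "\<forall>y z. y \<le> x \<and> x \<le> z \<and> z - y < d \<longrightarrow>
        (\<exists>m0 \<epsilon>0. 0 < \<epsilon>0 \<and> (\<forall>r. 0 \<le> r \<longrightarrow> y \<le> r \<longrightarrow> r \<le> z \<longrightarrow> small m0 \<epsilon>0 a r))"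
    proof (intro allI impI)
      fix y z assume yz: "y \<le> x \<and> x \<le> z \<and> z - y < d"
      have "small m0 \<epsilon>0 a r" if "0 \<le> r" "y \<le> r" "r \<le> z" for r
        by (rule *(3)[OF that(1)]) (use that yz in linarith)
      then show "\<exists>m0 \<epsilon>0. 0 < \<epsilon>0 \<and> (\<forall>r. 0 \<le> r \<longrightarrow> y \<le> r \<longrightarrow> r \<le> z \<longrightarrow> small m0 \<epsilon>0 a r)"
        using *(1) by blast
    qed
    then show ?case using *(2) by blast
  qed

  obtain N \<tau> m1 \<epsilon>1 where near: "0 < \<tau>" "0 < \<epsilon>1" "\<And>n s. N \<le> n \<Longrightarrow> 0 < s \<Longrightarrow> s < \<tau> \<Longrightarrow> small m1 \<epsilon>1 (- b) (t n + s)"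
  proof -
    let ?F = "sequentially \<times>\<^sub>F at_right (0::real)"
    have pos: "\<forall>\<^sub>F p in ?F. 0 < snd p"
      using filterlim_snd eventually_at_right_less by (rule filterlim_iff[THEN iffD1, rule_format])
    have lim_f: "((\<lambda>p. \<integral>\<omega>. apply_bcontfun f \<omega> \<partial>?\<nu> (t (fst p) + snd p)) \<longlongrightarrow> (\<integral>\<omega>. apply_bcontfun f \<omega> \<partial>\<nu>')) ?F"
      for f :: "('d, 'q) config \<Rightarrow>\<^sub>C real"
    proof -
      let ?m = "\<lambda>r. \<integral>\<omega>. apply_bcontfun f \<omega> \<partial>?\<nu> r"
      have 1: "((\<lambda>p. ?m (t (fst p))) \<longlongrightarrow> (\<integral>\<omega>. apply_bcontfun f \<omega> \<partial>\<nu>')) ?F"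
        by (rule filterlim_compose[OF lim filterlim_fst])
      have "((\<lambda>p. P (snd p) f) \<longlongrightarrow> f) ?F"
        by (rule filterlim_compose[OF semigroup_at_0[OF F] filterlim_snd])
      then have 2: "((\<lambda>p. norm (P (snd p) f - f)) \<longlongrightarrow> 0) ?F" by (intro tendsto_norm_zero LIM_zero)
      \<comment> \<open>The increment over a short time is bounded by
        \<open>norm (P (snd p) f - f)\<close>, uniformly in \<open>n\<close>, so the two limits can
        be taken jointly.\<close>
      have "((\<lambda>p. ?m (t (fst p) + snd p) - ?m (t (fst p))) \<longlongrightarrow> 0) ?F"
      proof (rule Lim_null_comparison[OF _ 2])
        show "\<forall>\<^sub>F p in ?F. norm (?m (t (fst p) + snd p) - ?m (t (fst p))) \<le> norm (P (snd p) f - f)"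
          using pos by eventually_elim (use evolve_increment[OF F \<nu>p t(1)] in simp)
      qed
      from tendsto_add[OF this 1] show ?thesis by simp
    qed
    have ev: "\<forall>\<^sub>F p in ?F. ?\<nu> (t (fst p) + snd p) \<in> invariant_measures"
      using pos by eventually_elim (intro inv add_nonneg_nonneg t(1), simp)
    have "\<nu>' \<in> invariant_measures" using D(1) \<nu>' by blast
    then obtain m1 \<epsilon>1 where m1: "0 < \<epsilon>1" "\<forall>\<^sub>F p in ?F. small m1 \<epsilon>1 (- b) (t (fst p) + snd p)"
      unfolding small_def by (rule approx_loss_density_neighbourhood[OF _ ev lim_f b(1)])
    \<comment> \<open>An eventual property of the product filter contains a rectangle. Its second
      side yields one window length \<open>\<tau>\<close> valid after every late time
      \<open>t n\<close>.\<close>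
    from m1(2) obtain Q R where Q: "eventually Q sequentially" and R: "eventually R (at_right 0)"
      and QR: "\<And>n s. Q n \<Longrightarrow> R s \<Longrightarrow> small m1 \<epsilon>1 (- b) (t n + s)"
      unfolding eventually_prod_filter by auto
    obtain N where N: "\<And>n. N \<le> n \<Longrightarrow> Q n" using Q unfolding eventually_sequentially by blast
    obtain \<tau> where \<tau>: "0 < \<tau>" "\<And>s. 0 < s \<Longrightarrow> s < \<tau> \<Longrightarrow> R s" using R unfolding eventually_at_right_field by blast
    have "small m1 \<epsilon>1 (- b) (t n + s)" if "N \<le> n" "0 < s" "s < \<tau>" for n s
      using that by (intro QR N \<tau>(2))
    then show ?thesis by (rule that[OF \<tau>(1) m1(1)])
  qed
  \<comment> \<open>The net descent per round: a window lowers the entropy density by at least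
    \<open>b * \<tau> = 2 * \<beta>\<close>, of which at most \<open>\<beta>\<close> is given back
    on the way to the window.\<close>
  define \<beta> where "\<beta> = b * \<tau> / 2"
  have \<beta>: "0 < \<beta>" using b near by (simp add: \<beta>_def)
  let ?H = "\<lambda>m \<epsilon> r. rel_entropy (Lam m) \<epsilon> (?\<nu> r)"
  have descent: "\<exists>T\<ge>0. \<exists>m0 \<epsilon>0. 0 < \<epsilon>0 \<and> (\<forall>m\<ge>m0. \<forall>\<epsilon>>0. \<epsilon> * ?N m \<le> \<epsilon>0 \<longrightarrow>
      ?H m \<epsilon> T - ?H m \<epsilon> 0 \<le> - real k * \<beta> * ?L m)" for k :: nat
  proof (induction k)
    case 0
    show ?case by (intro exI[of _ 0] conjI exI[of _ 1]) auto
  next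
    case (Suc k)
    then obtain T m0 \<epsilon>0 where T: "0 \<le> T" "0 < \<epsilon>0"
      "\<And>m \<epsilon>. m0 \<le> m \<Longrightarrow> 0 < \<epsilon> \<Longrightarrow> \<epsilon> * ?N m \<le> \<epsilon>0 \<Longrightarrow> ?H m \<epsilon> T - ?H m \<epsilon> 0 \<le> - real k * \<beta> * ?L m" by blast
    have "\<forall>\<^sub>F n in sequentially. T + 1 \<le> t n \<and> N \<le> n"
      using t(2) by (intro eventually_conj eventually_ge_at_top) (simp add: filterlim_at_top)
    \<comment> \<open>The next window starts at least one time unit after the previous round ends,
      so the denominator below is positive.\<close>
    then obtain n where n: "T + 1 \<le> t n" "N \<le> n" unfolding eventually_sequentially by blast
    \<comment> \<open>The permitted growth rate, chosen so that the growth over the whole gap from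
      \<open>T\<close> to \<open>t n\<close> is at most \<open>\<beta>\<close>.\<close>
    define a where "a = \<beta> / (t n - T)"
    have a: "0 < a" using \<beta> n by (simp add: a_def)
    have "T \<le> t n" using n by simp
    from interval[OF T(1) this a] obtain m2 \<epsilon>2 where
      *: "0 < \<epsilon>2" "\<And>r. 0 \<le> r \<Longrightarrow> T \<le> r \<Longrightarrow> r \<le> t n \<Longrightarrow> small m2 \<epsilon>2 a r" by blast
    show ?case
    proof (rule exI[of _ "t n + \<tau>"], rule conjI, goal_cases)
      case 1
      show ?case using t(1)[of n] near(1) by simp
    next
      case 2
      show ?case
      proof (rule exI[of _ "max m0 (max m1 m2)"], rule exI[of _ "min \<epsilon>0 (min \<epsilon>1 \<epsilon>2)"], intro conjI allI impI)
      show "0 < min \<epsilon>0 (min \<epsilon>1 \<epsilon>2)" using T near * by simp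
      fix m \<epsilon> assume m: "max m0 (max m1 m2) \<le> m" and \<epsilon>: "(0::real) < \<epsilon>" "\<epsilon> * ?N m \<le> min \<epsilon>0 (min \<epsilon>1 \<epsilon>2)"
      have 1: "?H m \<epsilon> T - ?H m \<epsilon> 0 \<le> - real k * \<beta> * ?L m" using T(3)[of m \<epsilon>] m \<epsilon> by simp
      have "?H m \<epsilon> (t n) - ?H m \<epsilon> T \<le> (a * ?L m) * (t n - T)"
      proof (rule rel_entropy_increase[OF P finite_Lam \<nu>p \<epsilon>(1) T(1)])
        show "T < t n" using n by simp
        fix r assume r: "T < r" "r < t n"
        then have "small m2 \<epsilon>2 a r" using T(1) by (intro *(2)) auto
        then show "total_gain (Lam m) \<epsilon> (?\<nu> r) \<le> a * ?L m" using m \<epsilon> unfolding small_def by simp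
      qed
      moreover have "(a * ?L m) * (t n - T) = \<beta> * ?L m" using n by (simp add: a_def)
      ultimately have 2: "?H m \<epsilon> (t n) - ?H m \<epsilon> T \<le> \<beta> * ?L m" by simp
      have "?H m \<epsilon> (t n + \<tau>) - ?H m \<epsilon> (t n) \<le> (- b * ?L m) * (t n + \<tau> - t n)"
      proof (rule rel_entropy_increase[OF P finite_Lam \<nu>p \<epsilon>(1) t(1)])
        show "t n < t n + \<tau>" using near(1) by simp
        fix r assume r: "t n < r" "r < t n + \<tau>"
        have "small m1 \<epsilon>1 (- b) (t n + (r - t n))" by (rule near(3)[OF n(2)]) (use r in auto)
        then show "total_gain (Lam m) \<epsilon> (?\<nu> r) \<le> - b * ?L m" using m \<epsilon> unfolding small_def by simp
      qed
      then have 3: "?H m \<epsilon> (t n + \<tau>) - ?H m \<epsilon> (t n) \<le> - 2 * (\<beta> * ?L m)" by (simp add: \<beta>_def algebra_simps)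
      have "- real (Suc k) * \<beta> * ?L m = - real k * \<beta> * ?L m - \<beta> * ?L m" by (simp add: algebra_simps)
      then show "?H m \<epsilon> (t n + \<tau>) - ?H m \<epsilon> 0 \<le> - real (Suc k) * \<beta> * ?L m" using 1 2 3 by linarith
      qed
    qed
  qed
  define K where "K = - ln site_bound"
  have K: "0 \<le> K" using site_bound by (simp add: K_def)
  \<comment> \<open>The entropy can vary by at most \<open>2 + 2 * (K * ?L m)\<close>; since
    \<open>?L m\<close> is at least 1, the total descent exceeds this for every volume.\<close>
  obtain k :: nat where k: "2 + 2 * K < real k * \<beta>" using reals_Archimedean3[OF \<beta>] by blast
  from descent[of k] obtain T m \<epsilon>0 where T: "0 \<le> T" "0 < \<epsilon>0"
      "\<And>\<epsilon>. 0 < \<epsilon> \<Longrightarrow> \<epsilon> * ?N m \<le> \<epsilon>0 \<Longrightarrow> ?H m \<epsilon> T - ?H m \<epsilon> 0 \<le> - real k * \<beta> * ?L m" by blast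
  have Np: "0 < ?N m" by (simp add: card_gt_0_iff)
  \<comment> \<open>Small enough for both the descent at this volume and the entropy bounds.\<close>
  define \<epsilon> where "\<epsilon> = min \<epsilon>0 1 / ?N m"
  have \<epsilon>: "0 < \<epsilon>" "\<epsilon> * ?N m \<le> \<epsilon>0" "\<epsilon> * ?N m \<le> 1" using T(2) Np by (auto simp: \<epsilon>_def)
  have p: "?\<nu> r \<in> prob_measures" if "0 \<le> r" for r by (rule invariant_prob[OF inv[OF that]])
  have "?H m \<epsilon> 0 \<le> 2 + K * ?L m"
    using rel_entropy_bounds(1)[OF finite_Lam p \<epsilon>(1,3), of 0] by (simp add: K_def mult.commute)
  moreover have "- (K * ?L m) \<le> ?H m \<epsilon> T"
    using rel_entropy_bounds(2)[OF finite_Lam p[OF T(1)] \<epsilon>(1,3)] by (simp add: K_def mult.commute)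
  moreover have "?H m \<epsilon> T - ?H m \<epsilon> 0 \<le> - real k * \<beta> * ?L m" by (rule T(3)[OF \<epsilon>(1,2)])
  ultimately have "real k * \<beta> * ?L m \<le> 2 + 2 * (K * ?L m)" by simp
  moreover have L: "1 \<le> ?L m" using card_Lam_pos[where 'd = 'd, of m] by simp
  then have "(2 + 2 * K) * ?L m < real k * \<beta> * ?L m" using k by (intro mult_strict_right_mono) auto
  moreover have "(2 + 2 * K) * ?L m = 2 * ?L m + 2 * (K * ?L m)" by (simp add: algebra_simps)
  ultimately show False using L by linarith
qed

end

text \<open>Evaluation at \<open>f\<close> is a coordinate projection after the map that defines the
  weak topology by pullback, hence continuous.\<close>

lemma weak_limit_integral:
  fixes f :: "('d::finite, 'q::finite) config \<Rightarrow>\<^sub>C real"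
  assumes "limitin weak_topology \<rho> \<nu> F"
  shows "((\<lambda>x. \<integral>\<omega>. apply_bcontfun f \<omega> \<partial>\<rho> x) \<longlongrightarrow> (\<integral>\<omega>. apply_bcontfun f \<omega> \<partial>\<nu>)) F"
proof -
  let ?E = "\<lambda>\<nu> (f :: ('d, 'q) config \<Rightarrow>\<^sub>C real). \<integral>\<omega>. apply_bcontfun f \<omega> \<partial>\<nu>"
  have "continuous_map weak_topology euclidean ((\<lambda>h. h f) \<circ> ?E)"
    unfolding weak_topology_def
    by (rule continuous_map_pullback) (simp add: continuous_on_product_coordinates)
  from continuous_map_limit[OF this assms] show ?thesis by (simp add: o_def)
qed

theorem theorem2p10:
  fixes c :: "('d::finite, 'q::finite) rates"
    and P :: "('d, 'q) semigroup"
    and \<gamma> :: "('d, 'q) kernels"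
    and \<mu> \<nu> \<nu>' :: "('d, 'q) config measure"
    and D :: "('d, 'q) config measure set"
    and t :: "nat \<Rightarrow> real"
  assumes "well_defined c"
    and "has_semigroup c P"
    and "rates_translation_invariant c"
    and "finitely_many_types c"
    and "uniformly_continuous_rates c"
    and "positive_minimal_rate c"
    and "no_trap_states c"
    and "is_specification \<gamma>"
    and "spec_translation_invariant \<gamma>"
    and "non_null \<gamma>"
    and "quasilocal \<gamma>"
    and "\<mu> \<in> gibbs_measures \<gamma>"
    and "\<mu> \<in> invariant_measures"
    and "asymptotically_decoupled \<mu>"
    and "\<And>s. s \<ge> 0 \<Longrightarrow> evolve P s \<mu> = \<mu>"
    and "D \<subseteq> invariant_measures"
    and "closedin weak_topology D"
    and "\<mu> \<in> D"
    and "\<And>\<rho> s. \<rho> \<in> D \<Longrightarrow> s \<ge> 0 \<Longrightarrow> evolve P s \<rho> \<in> D"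
    and "\<And>\<rho>. \<rho> \<in> D \<Longrightarrow> approx_loss_density c \<rho> \<mu> \<le> 0"
    and "\<And>\<rho>. \<rho> \<in> D \<Longrightarrow> approx_loss_density c \<rho> \<mu> = 0 \<Longrightarrow> \<rho> \<in> gibbs_measures \<gamma>"
    and "\<nu> \<in> D"
    and "\<And>n. t n \<ge> 0"
    and "incseq t"
    and "filterlim t at_top sequentially"
    and "limitin weak_topology (\<lambda>n. evolve P (t n) \<nu>) \<nu>' sequentially"
  shows "\<nu>' \<in> gibbs_measures \<gamma>"
proof -
  interpret gibbs_ips \<gamma> \<mu> c
    by unfold_locales (use assms(1,3-6,8-13) in \<open>auto simp: well_defined_def\<close>)
  \<comment> \<open>All measures along the sequence lie in \<open>D\<close>, which is weakly
    closed.\<close>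
  have \<nu>': "\<nu>' \<in> D"
    by (rule limitin_closedin[OF assms(26,17)]) (use assms(19,22,23) in auto)
  have "\<not> approx_loss_density c \<nu>' \<mu> < 0"
    by (rule not_approx_loss_density_limit_neg[OF assms(2,16,19,20,22) \<nu>' assms(23,25) weak_limit_integral[OF assms(26)]])
  then have "approx_loss_density c \<nu>' \<mu> = 0" using assms(20)[OF \<nu>'] by simp
  then show ?thesis by (rule assms(21)[OF \<nu>'])
qed

end
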